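(* Let $k\ge 3$, $g\ge 2$, and let $s=\frac{n}{k-1}-g$. (1) Let $\mathcal{G}$ be a $k$-uniform octopuslike hypergraph $\mathcal{O}_{n,k,g}$ of order $n$. Then $\rho(Lop_{g,k,s;2})\le\rho(\mathcal{G})$, with equality if and only if $\mathcal{G}\cong Lop_{g,k,s;2}$. (2) Let $\mathcal{G}$ be a $k$-uniform octopuslike hypergraph $\mathcal{O}_{n,k,g;1}$ of order $n$. Then $\rho(Lop_{g,k,s;1})\le\rho(\mathcal{G})$, with equality if and only if $\mathcal{G}\cong Lop_{g,k,s;1}$. (3) Let $\mathcal{G}$ be a $k$-uniform octopuslike hypergraph $\mathcal{O}_{n,k,g;2}$ of order $n$. Then $\rho(Lop_{g,k,s;2})\le\rho(\mathcal{G})$, with equality if and only if $\mathcal{G}\cong Lop_{g,k,s;2}$.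
   Context: A hypergraph $\mathcal{G}=(V,E)$ consists of a finite nonempty vertex set $V$ and a set $E$ of edges, each edge being a subset of $V$ with at least two elements (edges are pairwise distinct, undirected). Its order is $|V|$. It is $k$-uniform if every edge has exactly $k$ elements. Isomorphism $\cong$ means a bijection of vertex sets that induces a bijection of edge sets. Adjacency matrix: $\mathcal{A}_{\mathcal{G}}$ is the real symmetric matrix indexed by $V$ with $(\mathcal{A}_{\mathcal{G}})_{ij}=\sum_{e\in E,\ i,j\in e}\frac{1}{|e|-1}$ for $i\ne j$, and zero diagonal. The spectral radius $\rho(\mathcal{G})$ is the maximum modulus of the eigenvalues of $\mathcal{A}_{\mathcal{G}}$. A hyperpath of length $q$ is an alternating sequence $v_1e_1v_2e_2\cdots v_qe_qv_{q+1}$ of distinct vertices and distinct edges with $v_i,v_{i+1}\in e_i$, $e_i\cap e_{i+1}=\{v_{i+1}\}$, and $e_i\cap e_j=\emptyset$ if $|i-j|\ge 2$. A hypergraph is connected if any two vertices are joined by a hyperpath. A supertree is a connected hypergraph containing no hypercycle (in particular any two of its edges share at most one vertex); a $k$-uniform supertree is equivalently a connected $k$-uniform hypergraph with $n'$ vertices and $m'$ edges with $n'-1=(k-1)m'$. For $g\ge 2$, $\mathcal{C}_g$ denotes the $k$-uniform $g$-hypercycle $v_1e_1v_2e_2\cdots v_ge_gv_1$ with $e_i=\{v_i,v_{a(i,1)},\dots,v_{a(i,k-2)},v_{i+1}\}$ for $1\le i\le g$ (where $v_{g+1}:=v_1$), all the vertices $v_i$ and $v_{a(i,j)}$ ($1\le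 i\le g$, $1\le j\le k-2$) being distinct; for $g=2$ the two edges share exactly the two vertices $v_1,v_2$. A $k$-uniform octopuslike hypergraph $\mathcal{O}_{n,k,g}$ of order $n$ is a hypergraph of order $n$ obtained by attaching a $k$-uniform supertree at a vertex of $\mathcal{C}_g$, i.e. identifying one vertex of the supertree with one vertex of $\mathcal{C}_g$, the two being otherwise disjoint. $\mathcal{O}_{n,k,g;1}$ denotes such a hypergraph where the supertree is attached at $v_1$; $\mathcal{O}_{n,k,g;2}$ one where it is attached at $v_{a(1,1)}$. $Lop_{g,k,s;1}$ (resp. $Lop_{g,k,s;2}$) is the $k$-uniform lollipop hypergraph obtained by attaching a pendant $k$-uniform hyperpath of length $s$ at vertex $v_1$ (resp. $v_{a(1,1)}$) of $\mathcal{C}_g$, i.e. identifying the initial vertex of the hyperpath with that vertex, the two being otherwise disjoint; for $s=0$ it is $\mathcal{C}_g$ itself. *)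

theory Defs
  imports "Jordan_Normal_Form.Spectral_Radius"
begin

record 'a pre_hypergraph =
  verts :: "'a set"
  edges :: "'a set set"

definition hypergraph :: "'a pre_hypergraph \<Rightarrow> bool" where
  "hypergraph G \<longleftrightarrow> finite (verts G) \<and> verts G \<noteq> {} \<and>
     (\<forall>e\<in>edges G. e \<subseteq> verts G \<and> card e \<ge> 2)"

abbreviation order_hg :: "'a pre_hypergraph \<Rightarrow> nat" where
  "order_hg G \<equiv> card (verts G)"

definition uniform :: "nat \<Rightarrow> 'a pre_hypergraph \<Rightarrow> bool" where
  "uniform k G \<longleftrightarrow> (\<forall>e\<in>edges G. card e = k)"

definition isomorphic :: "'a pre_hypergraph \<Rightarrow> 'b pre_hypergraph \<Rightarrow> bool" where
  "isomorphic G H \<longleftrightarrow>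
     (\<exists>f. bij_betw f (verts G) (verts H) \<and> bij_betw ((`) f) (edges G) (edges H))"


definition adjacency :: "'a pre_hypergraph \<Rightarrow> 'a \<Rightarrow> 'a \<Rightarrow> real" where
  "adjacency G i j =
     (if i = j then 0 else \<Sum>e\<in>{e \<in> edges G. i \<in> e \<and> j \<in> e}. 1 / (real (card e) - 1))"

text \<open>The matrices have index set \<open>{..<n}\<close>, so the vertices are listed first. The
  spectral radius does not depend on the list: see \<open>rho_eq\<close> below. The entries are real, but
  are taken in \<open>complex\<close> because \<^const>\<open>spectral_radius\<close> is defined for complex matrices.\<close>

definition adjacency_mat :: "'a pre_hypergraph \<Rightarrow> 'a list \<Rightarrow> complex mat" where
  "adjacency_mat G vs = mat (length vs) (length vs)
     (\<lambda>(i, j). complex_of_real (adjacency G (vs ! i) (vs ! j)))"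

definition rho :: "'a pre_hypergraph \<Rightarrow> real" where
  "rho G = spectral_radius (adjacency_mat G (SOME vs. distinct vs \<and> set vs = verts G))"

lemma eigenvalue_adjacency_mat:
  assumes "distinct vs"
  shows "eigenvalue (adjacency_mat G vs) l \<longleftrightarrow>
    (\<exists>x. (\<exists>i\<in>set vs. x i \<noteq> 0) \<and>
      (\<forall>i\<in>set vs. (\<Sum>j\<in>set vs. complex_of_real (adjacency G i j) * x j) = l * x i))"
    (is "_ \<longleftrightarrow> ?R")
proof -
  let ?n = "length vs" and ?A = "adjacency_mat G vs"
  have sum_vs: "(\<Sum>j\<in>set vs. h j) = (\<Sum>j<?n. h (vs ! j))" for h :: "'a \<Rightarrow> complex"
    by (rule sum.reindex_bij_betw[symmetric]) (use bij_betw_nth[OF assms] in auto)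
  have mult: "(?A *\<^sub>v v) $ i = (\<Sum>j<?n. complex_of_real (adjacency G (vs ! i) (vs ! j)) * v $ j)"
    if "i < ?n" "v \<in> carrier_vec ?n" for i v
    using that by (simp add: adjacency_mat_def scalar_prod_def atLeast0LessThan)
  show ?thesis
  proof
    assume "eigenvalue ?A l"
    then obtain v where v: "v \<in> carrier_vec ?n" "v \<noteq> 0\<^sub>v ?n" "?A *\<^sub>v v = l \<cdot>\<^sub>v v"
      by (auto simp: eigenvalue_def eigenvector_def adjacency_mat_def)
    define x where "x u = v $ (THE i. i < ?n \<and> vs ! i = u)" for u
    have x: "x (vs ! i) = v $ i" if "i < ?n" for i
      unfolding x_def using that assms
      by (intro arg_cong[where f = "($) v"] the_equality) (auto simp: nth_eq_iff_index_eq)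
    obtain i where i: "i < ?n" "v $ i \<noteq> 0" using v(1,2) by (metis carrier_vecD eq_vecI index_zero_vec)
    show ?R
    proof (intro exI[of _ x] conjI ballI)
      show "\<exists>i\<in>set vs. x i \<noteq> 0" using i x by (metis nth_mem)
      fix u assume "u \<in> set vs"
      then obtain m where m: "m < ?n" "u = vs ! m" by (metis in_set_conv_nth)
      have "(?A *\<^sub>v v) $ m = l * v $ m" using v m by auto
      then show "(\<Sum>j\<in>set vs. complex_of_real (adjacency G u j) * x j) = l * x u"
        using m v(1) by (simp add: sum_vs x mult)
    qed
  next
    assume ?R
    then obtain x where nz: "\<exists>i\<in>set vs. x i \<noteq> 0"
      and ev: "\<forall>i\<in>set vs. (\<Sum>j\<in>set vs. complex_of_real (adjacency G i j) * x j) = l * x i" by blast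
    define v where "v = vec ?n (\<lambda>i. x (vs ! i))"
    have vc: "v \<in> carrier_vec ?n" and vi: "\<And>i. i < ?n \<Longrightarrow> v $ i = x (vs ! i)" by (auto simp: v_def)
    have "v \<noteq> 0\<^sub>v ?n" using nz vi by (metis in_set_conv_nth index_zero_vec(1))
    moreover have "?A *\<^sub>v v = l \<cdot>\<^sub>v v"
    proof (rule eq_vecI)
      show "dim_vec (?A *\<^sub>v v) = dim_vec (l \<cdot>\<^sub>v v)" using vc by (simp add: adjacency_mat_def)
      fix i assume "i < dim_vec (l \<cdot>\<^sub>v v)"
      then have i: "i < ?n" using vc by simp
      then have "(\<Sum>j\<in>set vs. complex_of_real (adjacency G (vs ! i) j) * x j) = l * x (vs ! i)"
        using ev by auto
      then show "(?A *\<^sub>v v) $ i = (l \<cdot>\<^sub>v v) $ i"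
        using i vc by (simp add: mult sum_vs vi)
    qed
    ultimately show "eigenvalue ?A l"
      using vc by (auto simp: eigenvalue_def eigenvector_def adjacency_mat_def)
  qed
qed

lemma rho_eq:
  assumes "distinct vs" "set vs = verts G"
  shows "rho G = spectral_radius (adjacency_mat G vs)"
proof -
  let ?ws = "SOME vs. distinct vs \<and> set vs = verts G"
  have ws: "distinct ?ws \<and> set ?ws = verts G" by (rule someI[of _ vs]) (use assms in auto)
  have "spectrum (adjacency_mat G ?ws) = spectrum (adjacency_mat G vs)"
    unfolding spectrum_def using ws assms by (auto simp: eigenvalue_adjacency_mat)
  then show ?thesis unfolding rho_def spectral_radius_def by simp
qed


text \<open>In the following lists, \<open>vs ! i\<close> and \<open>es ! i\<close> are the vertex and the edge with number
  \<open>i + 1\<close>. A single vertex is a hyperpath of length 0.\<close>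

definition hyperpath :: "'a pre_hypergraph \<Rightarrow> 'a list \<Rightarrow> 'a set list \<Rightarrow> bool" where
  "hyperpath G vs es \<longleftrightarrow>
     length vs = length es + 1 \<and> distinct vs \<and> distinct es \<and>
     set vs \<subseteq> verts G \<and> set es \<subseteq> edges G \<and>
     (\<forall>i<length es. vs ! i \<in> es ! i \<and> vs ! (i + 1) \<in> es ! i) \<and>
     (\<forall>i. i + 1 < length es \<longrightarrow> es ! i \<inter> es ! (i + 1) = {vs ! (i + 1)}) \<and>
     (\<forall>i j. i + 2 \<le> j \<and> j < length es \<longrightarrow> es ! i \<inter> es ! j = {})"

definition connected_hg :: "'a pre_hypergraph \<Rightarrow> bool" where
  "connected_hg G \<longleftrightarrow>
     (\<forall>u\<in>verts G. \<forall>w\<in>verts G. \<exists>vs es. hyperpath G vs es \<and> hd vs = u \<and> last vs = w)"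

text \<open>A hypercycle of length 2 consists of two edges with at least two common vertices; this is
  why two edges of a supertree have at most one common vertex.\<close>

definition hypercycle :: "'a pre_hypergraph \<Rightarrow> 'a list \<Rightarrow> 'a set list \<Rightarrow> bool" where
  "hypercycle G vs es \<longleftrightarrow> (let g = length es in
     g \<ge> 2 \<and> length vs = g \<and> distinct vs \<and> distinct es \<and>
     set vs \<subseteq> verts G \<and> set es \<subseteq> edges G \<and>
     (\<forall>i<g. vs ! i \<in> es ! i \<and> vs ! ((i + 1) mod g) \<in> es ! i) \<and>
     (g \<ge> 3 \<longrightarrow>
       (\<forall>i<g. es ! i \<inter> es ! ((i + 1) mod g) = {vs ! ((i + 1) mod g)}) \<and>
       (\<forall>i<g. \<forall>j<g. j \<noteq> i \<and> j \<noteq> (i + 1) mod g \<and> i \<noteq> (j + 1) mod g \<longrightarrow>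
          es ! i \<inter> es ! j = {})))"

definition supertree :: "'a pre_hypergraph \<Rightarrow> bool" where
  "supertree G \<longleftrightarrow> hypergraph G \<and> connected_hg G \<and> \<not> (\<exists>vs es. hypercycle G vs es)"


text \<open>\<open>Joint i\<close> is \<open>v\<^sub>i\<close> and \<open>Inner i j\<close> is the vertex with index \<open>a(i,j)\<close>.\<close>

datatype cycle_vertex = Joint nat | Inner nat nat

definition cycle_edge :: "nat \<Rightarrow> nat \<Rightarrow> nat \<Rightarrow> cycle_vertex set" where
  "cycle_edge k g i = {Joint i, Joint (if i = g then 1 else i + 1)} \<union> Inner i ` {1..k - 2}"

definition cycle_hg :: "nat \<Rightarrow> nat \<Rightarrow> cycle_vertex pre_hypergraph" where
  "cycle_hg k g =
     \<lparr> verts = Joint ` {1..g} \<union> (\<lambda>(i, j). Inner i j) ` ({1..g} \<times> {1..k - 2}),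
       edges = cycle_edge k g ` {1..g} \<rparr>"

text \<open>The \<open>k\<close>-uniform hyperpath of length \<open>s\<close>, with initial vertex \<open>0\<close>; the joints are the
  multiples of \<open>k - 1\<close>.\<close>

definition path_hg :: "nat \<Rightarrow> nat \<Rightarrow> nat pre_hypergraph" where
  "path_hg k s =
     \<lparr> verts = {0..s * (k - 1)},
       edges = (\<lambda>i. {i * (k - 1)..(i + 1) * (k - 1)}) ` {..<s} \<rparr>"

text \<open>The disjoint union of \<open>H\<close> and \<open>T\<close> with the vertex \<open>u\<close> of \<open>T\<close> identified with the vertex
  \<open>w\<close> of \<open>H\<close>; the identified vertex is \<open>Inl w\<close>.\<close>

definition attach ::
  "'a pre_hypergraph \<Rightarrow> 'a \<Rightarrow> 'b pre_hypergraph \<Rightarrow> 'b \<Rightarrow> ('a + 'b) pre_hypergraph" where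
  "attach H w T u = (let q = (\<lambda>x. if x = u then Inl w else Inr x) in
     \<lparr> verts = Inl ` verts H \<union> q ` verts T,
       edges = (`) Inl ` edges H \<union> (`) q ` edges T \<rparr>)"

text \<open>The supertree may be taken on the vertex type of \<open>G\<close>, because \<open>G\<close> contains a copy of it.
  It may be a single vertex.\<close>

definition octopuslike_at :: "nat \<Rightarrow> nat \<Rightarrow> cycle_vertex \<Rightarrow> 'a pre_hypergraph \<Rightarrow> bool" where
  "octopuslike_at k g w G \<longleftrightarrow> hypergraph G \<and>
     (\<exists>(T :: 'a pre_hypergraph) u. supertree T \<and> uniform k T \<and> u \<in> verts T \<and>
        isomorphic G (attach (cycle_hg k g) w T u))"

definition octopuslike :: "nat \<Rightarrow> nat \<Rightarrow> 'a pre_hypergraph \<Rightarrow> bool" where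
  "octopuslike k g G \<longleftrightarrow> (\<exists>w\<in>verts (cycle_hg k g). octopuslike_at k g w G)"

definition octopuslike1 :: "nat \<Rightarrow> nat \<Rightarrow> 'a pre_hypergraph \<Rightarrow> bool" where
  "octopuslike1 k g G \<longleftrightarrow> octopuslike_at k g (Joint 1) G"

definition octopuslike2 :: "nat \<Rightarrow> nat \<Rightarrow> 'a pre_hypergraph \<Rightarrow> bool" where
  "octopuslike2 k g G \<longleftrightarrow> octopuslike_at k g (Inner 1 1) G"

text \<open>For \<open>s = 0\<close> these are copies of \<open>cycle_hg k g\<close>.\<close>

definition Lop1 :: "nat \<Rightarrow> nat \<Rightarrow> nat \<Rightarrow> (cycle_vertex + nat) pre_hypergraph" where
  "Lop1 g k s = attach (cycle_hg k g) (Joint 1) (path_hg k s) 0"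

definition Lop2 :: "nat \<Rightarrow> nat \<Rightarrow> nat \<Rightarrow> (cycle_vertex + nat) pre_hypergraph" where
  "Lop2 g k s = attach (cycle_hg k g) (Inner 1 1) (path_hg k s) 0"

end

theory Submission imports Defs begin

text \<open>
  Write \<open>\<rho>\<close> for \<open>k - 1\<close> times the spectral radius. For a \<open>k\<close>-uniform hypergraph the matrix
  \<open>(k - 1) A\<close> maps \<open>x\<close> to its neighbour sum, which at \<open>v\<close> adds up \<open>x(e) - x v\<close> over the edges
  \<open>e\<close> at \<open>v\<close>, where \<open>x(e)\<close> is the sum of \<open>x\<close> over \<open>e\<close>. All comparisons of spectral radii are
  made with test vectors: a connected hypergraph has a positive Perron vector, and pairing a
  positive \<open>y\<close> with it shows that \<open>y\<close> having neighbour sums at most \<open>\<rho> y\<close> bounds the spectral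
  radius from above, strictly if one of these inequalities is strict; the dual bounds it from
  below.

  For the comparison of supertrees at the same vertex \<open>w\<close>, take the Perron vector \<open>x\<close> of the
  octopuslike hypergraph. On the cycle it only sees the tree through the \<open>load\<close> of the tree, the
  ratio of the neighbour sum within the tree to \<open>x w\<close>. It therefore suffices that among the trees
  with \<open>s\<close> edges the path attached at its end has the least load at this \<open>\<rho>\<close>
  (\<open>rtree_load\<close>): then \<open>x\<close> on the cycle, continued by the solution on the path
  (\<open>rpath_solution\<close>), is a test vector for the lollipop. To see that the path has the least load,
  remove a leaf edge \<open>e\<close> at \<open>v\<close> together with the paths that hang at its other vertices, and hang
  at \<open>v\<close> one path with all these edges. The load does not grow, because the load of a path and the
  share of an edge sum which its end vertex receives are both concave functions of the length
  which start at \<open>0\<close> (the share after subtraction of its initial value), hence subadditive.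
  Strict concavity also gives the case of equality: two paths with edges are never merged, so the
  tree is a path attached at its end. Concavity comes from the recursion for the ratios of consecutive joint
  values, which needs that \<open>\<rho>\<close> exceeds the value of the bare cycle
  (\<open>above_cycle_if_strict_supersolution\<close>).

  A joint and an inner vertex of the cycle are compared for the same tree
  (\<open>rho_inner_less_joint\<close>). If \<open>x\<close> is the Perron vector with the tree at an inner vertex \<open>a\<close> of the
  first edge, then the sum of \<open>x\<close> and its rotation by one edge is a solution on the cycle
  with two sources, at \<open>a\<close> and at its rotated copy, in the two edges at the joint \<open>v\<close>. Moving the
  surplus of these two vertices to \<open>v\<close> preserves all edge sums, and yields a test vector with the
  tree at \<open>v\<close>.

  Automorphisms of the cycle take every position to one of these two, and supertrees are the
  hypergraphs grown from the root by adding leaf edges (\<open>supertree_rtree\<close>), which is the form that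
  the induction uses.
\<close>

section \<open>The path recursion\<close>

lemma strictly_subadditive_if_strictly_concave:
  fixes f :: "nat \<Rightarrow> real"
  assumes "\<And>n. f (Suc (Suc n)) - f (Suc n) < f (Suc n) - f n" and "f 0 = 0"
  shows "f (m + n) \<le> f m + f n" and "m > 0 \<Longrightarrow> n > 0 \<Longrightarrow> f (m + n) < f m + f n"
proof -
  have decr: "f (Suc (m + i)) - f (m + i) \<le> f (Suc i) - f i" for i m
  proof (induction m)
    case (Suc m)
    show ?case using Suc assms(1)[of "m + i"] by simp
  qed simp
  have decr': "f (Suc (m + i)) - f (m + i) < f (Suc i) - f i" if "m > 0" for i m
  proof -
    obtain l where l: "m = Suc l" using \<open>m > 0\<close> gr0_implies_Suc by blast
    show ?thesis using decr[of l "Suc i"] assms(1)[of i] by (simp add: l)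
  qed
  show le: "f (m + n) \<le> f m + f n" for m n
  proof (induction n)
    case (Suc n)
    show ?case using Suc decr[of m n] by simp
  qed (simp add: assms(2))
  show "f (m + n) < f m + f n" if mn: "m > 0" "n > 0"
  proof -
    obtain l where l: "n = Suc l" using \<open>n > 0\<close> gr0_implies_Suc by blast
    show ?thesis using decr'[of m l] le[of m l] mn by (simp add: l)
  qed
qed

text \<open>The case of equality is what later forces a tree to be a path: at most one of the parts
  that are merged is nontrivial.\<close>

lemma subadditive_sum:
  fixes f :: "nat \<Rightarrow> real"
  assumes le: "\<And>m n. f (m + n) \<le> f m + f n"
    and less: "\<And>m n. m > 0 \<Longrightarrow> n > 0 \<Longrightarrow> f (m + n) < f m + f n"
    and "f 0 = 0" and "finite W"
  shows "f (sum c W) \<le> (\<Sum>w\<in>W. f (c w)) \<and>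
    (f (sum c W) = (\<Sum>w\<in>W. f (c w)) \<longrightarrow> (\<exists>t. \<forall>w\<in>W. w \<noteq> t \<longrightarrow> c w = 0))"
  using \<open>finite W\<close>
proof induction
  case empty
  then show ?case using \<open>f 0 = 0\<close> by simp
next
  case (insert w W)
  have *: "f (sum c (insert w W)) \<le> f (c w) + f (sum c W)"
    using le[of "c w" "sum c W"] insert.hyps by simp
  show ?case
  proof (intro conjI impI)
    show "f (sum c (insert w W)) \<le> (\<Sum>w\<in>insert w W. f (c w))"
      using * insert by simp
    assume "f (sum c (insert w W)) = (\<Sum>w\<in>insert w W. f (c w))"
    then have tight: "f (c w + sum c W) = f (c w) + f (sum c W)"
      and IH: "f (sum c W) = (\<Sum>w\<in>W. f (c w))"
      using * insert by auto
    from tight less have "c w = 0 \<or> sum c W = 0"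
      by (metis less_irrefl not_gr_zero)
    then show "\<exists>t. \<forall>v\<in>insert w W. v \<noteq> t \<longrightarrow> c v = 0"
    proof
      assume "c w = 0"
      then show ?thesis using insert.IH IH by auto
    next
      assume "sum c W = 0"
      then show ?thesis using insert.hyps by auto
    qed
  qed
qed

text \<open>The last assumption says that \<open>\<rho>\<close> exceeds the largest eigenvalue of the neighbour sum
  operator of every \<open>k\<close>-uniform hypercycle: the vectors on it that are constant on joints and on
  inner vertices lead to the equation \<open>(\<rho> - 2) (\<rho> - k + 3) = 4 (k - 2)\<close>.\<close>

locale path_recursion =
  fixes k :: nat and \<rho> :: real
  assumes k3: "k \<ge> 3"
    and \<rho>_gt: "\<rho> > real k - 3"
    and above_cycle: "(\<rho> - 2) * (\<rho> - real k + 3) > 4 * (real k - 2)"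
begin

text \<open>Let \<open>y\<close> have neighbour sums \<open>\<rho> y\<close> on a path with joint values \<open>w\<^sub>i\<close>. The \<open>k - 2\<close> inner vertices
  of an edge take a common value, a multiple of the sum of the two joint values. Eliminating them
  leaves \<open>\<rho> w\<^sub>i = coupling (w\<^sub>i\<^sub>-\<^sub>1 + w\<^sub>i\<^sub>+\<^sub>1) + 2 (coupling - 1) w\<^sub>i\<close> at an interior joint, that is,
  \<open>w\<^sub>i\<^sub>-\<^sub>1 + w\<^sub>i\<^sub>+\<^sub>1 = \<tau> w\<^sub>i\<close>.\<close>

definition coupling :: real where "coupling = (\<rho> + 1) / (\<rho> - real k + 3)"

definition \<tau> :: real where "\<tau> = (\<rho> + 2) / coupling - 2"

text \<open>The quotient of consecutive joint values, the one closer to the tip divided by the other,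
  when \<open>j\<close> edges remain. The value at \<open>0\<close> belongs to a fictitious joint beyond the tip; it is
  chosen such that the tip has load \<open>0\<close>.\<close>

fun ratio :: "nat \<Rightarrow> real" where
  "ratio 0 = 1 / coupling - 1"
| "ratio (Suc j) = 1 / (\<tau> - ratio j)"

text \<open>The neighbour sum at the initial vertex of the path with \<open>j\<close> edges, if that vertex has value
  \<open>1\<close>.\<close>

definition load :: "nat \<Rightarrow> real" where "load j = coupling * (1 + ratio j) - 1"

text \<open>The value of a vertex with a path of \<open>j\<close> edges hanging at it, as a fraction of the sum over
  its other edge.\<close>

definition share :: "nat \<Rightarrow> real" where "share j = 1 / (\<rho> + 1 - load j)"

lemma \<rho>_pos: "\<rho> > 0" using \<rho>_gt k3 by simp

lemma coupling_gt_1: "coupling > 1"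
  using \<rho>_gt k3 by (simp add: coupling_def)

lemma \<tau>_gt_2: "\<tau> > 2"
proof -
  have "(\<rho> + 2) * (\<rho> - real k + 3) > 4 * (\<rho> + 1)"
    using above_cycle by (simp add: algebra_simps)
  then show ?thesis using \<rho>_gt \<rho>_pos unfolding \<tau>_def coupling_def by (simp add: field_simps)
qed

lemma ratio_less_1: "ratio j < 1"
proof (induction j)
  case 0
  show ?case using coupling_gt_1 by (simp add: field_simps)
next
  case (Suc j)
  then show ?case using \<tau>_gt_2 by simp
qed

lemma ratio_Suc_pos: "ratio (Suc j) > 0"
  using ratio_less_1[of j] \<tau>_gt_2 by simp

lemma ratio_gt: "ratio j > -1"
proof (cases j)
  case 0 then show ?thesis using coupling_gt_1 by simp
next
  case (Suc i) then show ?thesis using ratio_Suc_pos[of i] by (simp del: ratio.simps)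
qed

lemma ratio_step: "ratio (Suc (Suc j)) - ratio (Suc j)
    = ratio (Suc (Suc j)) * ratio (Suc j) * (ratio (Suc j) - ratio j)"
proof -
  have "\<tau> - ratio j \<noteq> 0" "\<tau> - ratio (Suc j) \<noteq> 0"
    using ratio_less_1[of j] ratio_less_1[of "Suc j"] \<tau>_gt_2 by linarith+
  then show ?thesis
    unfolding ratio.simps(2)[of "Suc j"] ratio.simps(2)[of j] by (simp add: field_simps)
qed

lemma ratio_increasing: "ratio j < ratio (Suc j)"
proof (induction j)
  case 0
  have "ratio 0 < 0" using coupling_gt_1 by simp
  then show ?case using ratio_Suc_pos[of 0] by linarith
next
  case (Suc j)
  have "ratio (Suc (Suc j)) * ratio (Suc j) * (ratio (Suc j) - ratio j) > 0"
    by (intro mult_pos_pos ratio_Suc_pos) (use Suc in simp)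
  then show ?case using ratio_step[of j] by linarith
qed

text \<open>The increments satisfy a multiplicative recursion (\<open>ratio_step\<close>) whose factor is less than \<open>1\<close>
  since \<open>\<tau> > 2\<close> keeps the ratios below \<open>1\<close>.\<close>

lemma ratio_concave: "ratio (Suc (Suc j)) - ratio (Suc j) < ratio (Suc j) - ratio j"
proof -
  have "ratio (Suc (Suc j)) * ratio (Suc j) < 1 * 1"
    by (intro mult_strict_mono ratio_less_1) (use ratio_Suc_pos[of j] in auto)
  then have "ratio (Suc (Suc j)) * ratio (Suc j) * (ratio (Suc j) - ratio j)
      < 1 * (ratio (Suc j) - ratio j)"
    using ratio_increasing[of j] by (intro mult_strict_right_mono) auto
  then show ?thesis using ratio_step[of j] by simp
qed

lemma load_0: "load 0 = 0"
  using coupling_gt_1 by (simp add: load_def)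

lemma load_strictly_subadditive:
  shows "load (m + n) \<le> load m + load n"
    and "m > 0 \<Longrightarrow> n > 0 \<Longrightarrow> load (m + n) < load m + load n"
proof -
  have "load (Suc (Suc n)) - load (Suc n) < load (Suc n) - load n" for n
  proof -
    have "coupling * (ratio (Suc (Suc n)) - ratio (Suc n)) < coupling * (ratio (Suc n) - ratio n)"
      using coupling_gt_1 ratio_concave[of n] by (intro mult_strict_left_mono) auto
    then show ?thesis by (simp add: load_def algebra_simps del: ratio.simps)
  qed
  then show "load (m + n) \<le> load m + load n"
    and "m > 0 \<Longrightarrow> n > 0 \<Longrightarrow> load (m + n) < load m + load n"
    using strictly_subadditive_if_strictly_concave[of load] load_0 by auto
qed

lemma share_eq: "share j = (1 - 1 / (1 + ratio (Suc j))) / coupling"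
proof -
  have *: "\<tau> - ratio j > 0" using ratio_less_1[of j] \<tau>_gt_2 by linarith
  have coupling_pos: "coupling > 0" using coupling_gt_1 by simp
  have "coupling * \<tau> = \<rho> + 2 - 2 * coupling"
    using coupling_pos by (simp add: \<tau>_def field_simps)
  then have **: "\<rho> + 1 - load j = coupling * (\<tau> - ratio j + 1)"
    by (simp add: load_def algebra_simps)
  have "1 - 1 / (1 + ratio (Suc j)) = 1 / (\<tau> - ratio j + 1)"
    using * by (simp add: field_simps)
  then show ?thesis unfolding share_def ** by simp
qed

lemma load_less: "load j < \<rho> + 1"
proof -
  have *: "\<tau> - ratio j > 0" using ratio_less_1[of j] \<tau>_gt_2 by linarith
  have coupling_pos: "coupling > 0" using coupling_gt_1 by simp
  have "coupling * \<tau> = \<rho> + 2 - 2 * coupling"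
    using coupling_pos by (simp add: \<tau>_def field_simps)
  then have **: "\<rho> + 1 - load j = coupling * (\<tau> - ratio j + 1)"
    by (simp add: load_def algebra_simps)
  have "coupling * (\<tau> - ratio j + 1) > 0" using coupling_pos * by simp
  then show ?thesis using ** by linarith
qed

lemma share_pos: "share j > 0"
  using load_less[of j] by (simp add: share_def)

text \<open>By \<open>share_eq\<close> the share is an increasing concave function of the ratio, so it inherits
  concavity from \<open>ratio_concave\<close>. The share of a bare vertex is not \<open>0\<close>, so it is subtracted.\<close>

lemma share_strictly_subadditive:
  shows "share (m + n) - share 0 \<le> (share m - share 0) + (share n - share 0)"
    and "m > 0 \<Longrightarrow> n > 0 \<Longrightarrow>
      share (m + n) - share 0 < (share m - share 0) + (share n - share 0)"
proof -
  let ?f = "\<lambda>j. share j - share 0"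
  have "?f (Suc (Suc n)) - ?f (Suc n) < ?f (Suc n) - ?f n" for n
  proof -
    define p q r where "p = ratio (Suc n)" and "q = ratio (Suc (Suc n))"
      and "r = ratio (Suc (Suc (Suc n)))"
    have pqr: "0 < p" "p < q" "q < r" "r - q < q - p"
      unfolding p_def q_def r_def
      using ratio_Suc_pos[of n] ratio_increasing[of "Suc n"] ratio_increasing[of "Suc (Suc n)"]
        ratio_concave[of "Suc n"] by auto
    have "1 / (1 + q) - 1 / (1 + r) = (r - q) / ((1 + q) * (1 + r))"
      using pqr by (simp add: field_simps)
    also have "\<dots> < (q - p) / ((1 + p) * (1 + q))"
      using pqr by (intro frac_less mult_mono) (auto simp: mult.commute)
    also have "\<dots> = 1 / (1 + p) - 1 / (1 + q)"
      using pqr by (simp add: field_simps)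
    finally have "(1 / (1 + q) - 1 / (1 + r)) / coupling < (1 / (1 + p) - 1 / (1 + q)) / coupling"
      using coupling_gt_1 by (simp add: divide_strict_right_mono)
    then show ?thesis
      unfolding share_eq p_def[symmetric] q_def[symmetric] r_def[symmetric]
      by (simp add: diff_divide_distrib)
  qed
  from strictly_subadditive_if_strictly_concave[of ?f, OF this]
  show "?f (m + n) \<le> ?f m + ?f n" and "m > 0 \<Longrightarrow> n > 0 \<Longrightarrow> ?f (m + n) < ?f m + ?f n"
    by auto
qed

lemma load_Suc_pos: "1 + load j > 0"
  using coupling_gt_1 ratio_gt[of j] by (simp add: load_def)

text \<open>The shares of the vertices of an edge, one with a path of \<open>j\<close> edges and \<open>k - 2\<close> bare ones, leave
  the remaining fraction of the edge sum for the initial vertex of the path of \<open>j + 1\<close> edges.\<close>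

lemma load_Suc: "1 / (1 + load (Suc j)) = 1 - share j - (real k - 2) * share 0"
proof -
  have "(real k - 2) * share 0 = 1 - 1 / coupling"
    using \<rho>_gt \<rho>_pos by (simp add: share_def load_0 coupling_def field_simps)
  moreover have "1 / (1 + load (Suc j)) = 1 / coupling / (1 + ratio (Suc j))"
    by (simp add: load_def)
  moreover have "share j = 1 / coupling - 1 / coupling / (1 + ratio (Suc j))"
    unfolding share_eq by (simp add: diff_divide_distrib)
  ultimately show ?thesis by simp
qed

end

section \<open>Neighbour sums and rooted supertrees\<close>

definition nbr_sum :: "'a set set \<Rightarrow> ('a \<Rightarrow> real) \<Rightarrow> 'a \<Rightarrow> real" where
  "nbr_sum E x v = (\<Sum>e | e \<in> E \<and> v \<in> e. sum x e - x v)"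

lemma nbr_sum_insert:
  assumes "finite E" and "e \<notin> E"
  shows "nbr_sum (insert e E) x v = nbr_sum E x v + (if v \<in> e then sum x e - x v else 0)"
proof -
  have "{f. f \<in> insert e E \<and> v \<in> f}
      = (if v \<in> e then insert e {f. f \<in> E \<and> v \<in> f} else {f. f \<in> E \<and> v \<in> f})" by auto
  then show ?thesis using assms unfolding nbr_sum_def by auto
qed

lemma nbr_sum_union_disjoint:
  assumes "finite E" and "finite F" and "E \<inter> F = {}"
  shows "nbr_sum (E \<union> F) x v = nbr_sum E x v + nbr_sum F x v"
proof -
  have "{e. e \<in> E \<union> F \<and> v \<in> e} = {e. e \<in> E \<and> v \<in> e} \<union> {e. e \<in> F \<and> v \<in> e}" by auto
  then show ?thesis unfolding nbr_sum_def using assms by (simp add: sum.union_disjoint disjoint_iff)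
qed

lemma nbr_sum_eq_0:
  assumes "\<And>e. e \<in> E \<Longrightarrow> v \<notin> e"
  shows "nbr_sum E x v = 0"
proof -
  have "{e. e \<in> E \<and> v \<in> e} = {}" using assms by blast
  then show ?thesis by (simp only: nbr_sum_def sum.empty)
qed

lemma nbr_sum_cong:
  assumes "\<And>e u. e \<in> E \<Longrightarrow> v \<in> e \<Longrightarrow> u \<in> e \<Longrightarrow> x u = y u"
  shows "nbr_sum E x v = nbr_sum E y v"
  unfolding nbr_sum_def using assms by (intro sum.cong) (auto intro!: arg_cong2[where f = minus] sum.cong)

lemma nbr_sum_image:
  assumes "inj f"
  shows "nbr_sum ((`) f ` E) x (f v) = nbr_sum E (x \<circ> f) v"
proof -
  have "f v \<in> f ` e \<longleftrightarrow> v \<in> e" for e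
    using assms by (rule inj_image_mem_iff)
  then have "{e. e \<in> (`) f ` E \<and> f v \<in> e} = (`) f ` {e. e \<in> E \<and> v \<in> e}"
    by blast
  moreover have "inj_on ((`) f) A" for A
    using assms by (auto simp: inj_on_def inj_image_eq_iff)
  ultimately show ?thesis unfolding nbr_sum_def
    using assms by (simp add: sum.reindex inj_on_subset[OF assms])
qed

lemma nbr_sum_scale: "nbr_sum E (\<lambda>v. c * x v) v = c * nbr_sum E x v"
  unfolding nbr_sum_def by (simp add: sum_distrib_left right_diff_distrib)

text \<open>Supertrees with root \<open>u\<close>. The edge added last is a leaf edge, so induction over this predicate
  removes leaf edges and leaves the root in place.\<close>

inductive rtree :: "nat \<Rightarrow> 'a \<Rightarrow> 'a set \<Rightarrow> 'a set set \<Rightarrow> bool" for k u where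
  root: "rtree k u {u} {}"
| grow: "rtree k u V E \<Longrightarrow> v \<in> V \<Longrightarrow> e \<inter> V = {v} \<Longrightarrow> finite e \<Longrightarrow> card e = k
    \<Longrightarrow> rtree k u (V \<union> e) (insert e E)"

text \<open>Paths with initial vertex \<open>u\<close> and tip \<open>t\<close>, as special rooted supertrees. With no edges, the tip
  is the root.\<close>

inductive rpath :: "nat \<Rightarrow> 'a \<Rightarrow> 'a set \<Rightarrow> 'a set set \<Rightarrow> 'a \<Rightarrow> bool" for k u where
  root: "rpath k u {u} {} u"
| grow: "rpath k u V E t \<Longrightarrow> e \<inter> V = {t} \<Longrightarrow> finite e \<Longrightarrow> card e = k \<Longrightarrow> t' \<in> e - {t}
    \<Longrightarrow> rpath k u (V \<union> e) (insert e E) t'"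

lemma rtree_basic:
  assumes "rtree k u V E"
  shows "finite V \<and> finite E \<and> u \<in> V \<and> (\<forall>e\<in>E. e \<subseteq> V \<and> card e = k)"
  using assms by induction auto

lemma not_subset_if_meets_once:
  assumes "e \<inter> V = {v}" and "card e = k" and "k \<ge> 2"
  shows "\<not> e \<subseteq> V"
proof
  assume "e \<subseteq> V"
  then have "e = {v}" using assms(1) by blast
  then show False using assms by simp
qed

lemma rtree_card:
  assumes "rtree k u V E" and "k \<ge> 2"
  shows "card V = 1 + (k - 1) * card E"
  using assms(1)
proof induction
  case (grow V E v e)
  note basic = rtree_basic[OF grow.hyps(1)]
  have "e \<notin> E" using basic not_subset_if_meets_once[OF grow.hyps(3,5) assms(2)] by blast
  moreover have "card (V \<union> e) + 1 = card V + k"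
    using card_Un_Int[of V e] basic grow.hyps by (simp add: Int_commute)
  moreover obtain l where "k = Suc l" using assms(2) by (cases k) auto
  ultimately show ?case using basic grow.IH by simp
qed simp

lemma rpath_rtree:
  assumes "rpath k u V E t"
  shows "rtree k u V E \<and> t \<in> V"
  using assms by induction (auto intro: rtree.intros)

text \<open>Connectivity as a cut condition, in the form needed for irreducibility of the adjacency matrix.\<close>

definition edge_connected :: "'a set \<Rightarrow> 'a set set \<Rightarrow> bool" where
  "edge_connected V E \<longleftrightarrow> (\<forall>S\<subseteq>V. S \<noteq> {} \<and> (\<forall>e\<in>E. e \<inter> S \<noteq> {} \<longrightarrow> e \<subseteq> S) \<longrightarrow> S = V)"

lemma rtree_edge_connected:
  assumes "rtree k u V E"
  shows "edge_connected V E"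
  using assms
proof induction
  case root
  then show ?case by (auto simp: edge_connected_def)
next
  case (grow V E v e)
  note basic = rtree_basic[OF grow.hyps(1)]
  show ?case unfolding edge_connected_def
  proof (intro allI impI, elim conjE)
    fix S assume S: "S \<subseteq> V \<union> e" "S \<noteq> {}" "\<forall>f\<in>insert e E. f \<inter> S \<noteq> {} \<longrightarrow> f \<subseteq> S"
    have "v \<in> S"
    proof (cases "S \<inter> V = {}")
      case True
      then show ?thesis using S grow.hyps by auto
    next
      case False
      have "S \<inter> V = V"
        using grow.IH[unfolded edge_connected_def, rule_format, of "S \<inter> V"] False S(3) basic by blast
      then show ?thesis using grow.hyps by auto
    qed
    then have "e \<subseteq> S" "S \<inter> V \<noteq> {}" using S(3) grow.hyps by auto
    moreover have "S \<inter> V = V"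
      using grow.IH[unfolded edge_connected_def, rule_format, of "S \<inter> V"] calculation S(3) basic by blast
    ultimately show "S = V \<union> e" using S(1) by blast
  qed
qed

lemma nbr_sum_rtree_root_pos:
  assumes "rtree k u V E" and "E \<noteq> {}" and "k \<ge> 2" and pos: "\<And>v. v \<in> V \<Longrightarrow> x v > 0"
  shows "nbr_sum E x u > 0"
proof -
  note basic = rtree_basic[OF assms(1)]
  have "\<exists>e\<in>E. u \<in> e"
  proof (rule ccontr)
    assume "\<not> ?thesis"
    then have "{u} = V"
      using rtree_edge_connected[OF assms(1), unfolded edge_connected_def, rule_format, of "{u}"]
        basic by auto
    moreover from \<open>E \<noteq> {}\<close> obtain e where "e \<in> E" by blast
    ultimately have "e \<subseteq> {u}" "card e = k" using basic by auto
    then show False using \<open>k \<ge> 2\<close> card_mono[of "{u}" e] by simp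
  qed
  then obtain e where e: "e \<in> E" "u \<in> e" by blast
  have pos': "sum x f - x u > 0" if "f \<in> E" "u \<in> f" for f
  proof -
    have f: "finite f" "card f = k" "f \<subseteq> V" using basic that finite_subset by blast+
    then have "f \<noteq> {u}" using \<open>k \<ge> 2\<close> by auto
    then have "f - {u} \<noteq> {}" using that by blast
    then have "sum x (f - {u}) > 0" using f pos by (intro sum_pos) auto
    then show ?thesis using f that by (simp add: sum_diff1)
  qed
  show ?thesis unfolding nbr_sum_def
    by (rule sum_pos) (use basic e pos' in auto)
qed

section \<open>Loads of rooted supertrees\<close>

context path_recursion
begin

text \<open>If each other vertex of \<open>e\<close> carries at least the load of a path, it receives at least the
  corresponding share of the edge sum. By subadditivity of the shares, the sum of these shares is
  least when all the paths are merged into one, and then \<open>load_Suc\<close> gives the load at \<open>v\<close>.\<close>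

lemma edge_load:
  assumes e: "finite e" "card e = k" "v \<in> e"
    and pos: "\<And>w. w \<in> e \<Longrightarrow> x w > 0"
    and sub: "\<And>w. w \<in> e - {v} \<Longrightarrow> sum x e - x w + load (c w) * x w \<le> \<rho> * x w"
  shows "load (1 + sum c (e - {v})) * x v \<le> sum x e - x v \<and>
    (load (1 + sum c (e - {v})) * x v = sum x e - x v \<longrightarrow>
      (\<forall>w\<in>e - {v}. sum x e - x w + load (c w) * x w = \<rho> * x w) \<and>
      (\<exists>t\<in>e - {v}. \<forall>w\<in>e - {v}. w \<noteq> t \<longrightarrow> c w = 0))"
proof -
  let ?W = "e - {v}" and ?S = "sum x e" and ?C = "sum c (e - {v})"
  have S: "?S = x v + sum x ?W" using e by (simp add: sum.remove)
  have Spos: "?S > 0" using e pos by (intro sum_pos) auto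
  have xw: "share (c w) * ?S \<le> x w" if "w \<in> ?W" for w
  proof -
    have "?S \<le> (\<rho> + 1 - load (c w)) * x w" using sub[OF that] by (simp add: algebra_simps)
    then show ?thesis using load_less[of "c w"] by (simp add: share_def field_simps)
  qed
  have xw_eq: "?S - x w + load (c w) * x w = \<rho> * x w" if "share (c w) * ?S = x w" for w
  proof -
    have "?S = (\<rho> + 1 - load (c w)) * x w"
      using load_less[of "c w"] that by (simp add: share_def field_simps)
    then show ?thesis by (simp add: algebra_simps)
  qed
  let ?f = "\<lambda>j. share j - share 0"
  have sub_share: "?f ?C \<le> (\<Sum>w\<in>?W. ?f (c w)) \<and>
    (?f ?C = (\<Sum>w\<in>?W. ?f (c w)) \<longrightarrow> (\<exists>t. \<forall>w\<in>?W. w \<noteq> t \<longrightarrow> c w = 0))"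
    by (rule subadditive_sum) (use share_strictly_subadditive e in auto)
  have cardW: "card ?W = k - 1" "real (k - 1) = real k - 1"
    using e k3 by auto
  have sum_f: "(\<Sum>w\<in>?W. ?f (c w)) = (\<Sum>w\<in>?W. share (c w)) - (real k - 1) * share 0"
    by (simp only: sum_subtractf sum_constant cardW)
  have D: "1 / (1 + load (Suc ?C)) = 1 - share ?C - (real k - 2) * share 0"
    by (rule load_Suc)
  have Lp: "1 + load (Suc ?C) > 0" by (rule load_Suc_pos)
  have le1: "(\<Sum>w\<in>?W. share (c w)) * ?S \<le> sum x ?W"
    unfolding sum_distrib_right by (rule sum_mono) (rule xw)
  have le2: "1 - (\<Sum>w\<in>?W. share (c w)) \<le> 1 / (1 + load (Suc ?C))"
    using sub_share sum_f D by (simp add: algebra_simps)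
  have le3: "(1 - (\<Sum>w\<in>?W. share (c w))) * ?S \<le> ?S / (1 + load (Suc ?C))"
    using mult_right_mono[OF le2, of ?S] Spos by simp
  have le4: "x v \<le> (1 - (\<Sum>w\<in>?W. share (c w))) * ?S"
    using le1 S by (simp add: left_diff_distrib)
  show ?thesis
  proof (intro conjI impI)
    have "x v \<le> ?S / (1 + load (Suc ?C))" using le3 le4 by linarith
    then show "load (1 + ?C) * x v \<le> ?S - x v" using Lp by (simp add: field_simps)
    assume "load (1 + ?C) * x v = ?S - x v"
    then have "x v = ?S / (1 + load (Suc ?C))" using Lp by (simp add: field_simps)
    then have eq3: "(1 - (\<Sum>w\<in>?W. share (c w))) * ?S = ?S / (1 + load (Suc ?C))"
      and eq4: "x v = (1 - (\<Sum>w\<in>?W. share (c w))) * ?S" using le3 le4 by linarith+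
    have "(\<Sum>w\<in>?W. share (c w) * ?S) = sum x ?W"
      using eq4 S by (simp add: left_diff_distrib sum_distrib_right)
    then have "\<forall>w\<in>?W. share (c w) * ?S = x w"
      using sum_mono_inv[of "\<lambda>w. share (c w) * ?S" ?W x] xw e(1) by blast
    then show "\<forall>w\<in>?W. ?S - x w + load (c w) * x w = \<rho> * x w" using xw_eq by blast
    have "1 - (\<Sum>w\<in>?W. share (c w)) = 1 / (1 + load (Suc ?C))"
      using eq3 Spos mult_right_cancel[of ?S "1 - (\<Sum>w\<in>?W. share (c w))" "1 / (1 + load (Suc ?C))"]
      by simp
    then have "?f ?C = (\<Sum>w\<in>?W. ?f (c w))" using sum_f D by (simp add: algebra_simps)
    then obtain t where t: "\<forall>w\<in>?W. w \<noteq> t \<longrightarrow> c w = 0" using sub_share by blast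
    have "?W \<noteq> {}"
    proof
      assume "?W = {}"
      then have "card ?W = 0" by (simp only: card.empty)
      then show False using cardW(1) k3 by linarith
    qed
    then obtain w where w: "w \<in> ?W" by blast
    show "\<exists>t\<in>?W. \<forall>w\<in>?W. w \<noteq> t \<longrightarrow> c w = 0"
    proof (cases "t \<in> ?W")
      case True
      then show ?thesis using t by (rule_tac bexI[of _ t])
    next
      case False
      then have "c v = 0" if "v \<in> ?W" for v using t that by metis
      then show ?thesis using w by (rule_tac bexI[of _ w]) simp
    qed
  qed
qed

text \<open>The weight \<open>c v\<close> is the length of a path that hangs at \<open>v\<close> and is represented by its load only.
  This generality makes the induction work: a leaf edge at \<open>v\<close> and the weights of its vertices are
  turned into weight at \<open>v\<close>. Equality at the root is passed down to equality at all vertices,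
  which is needed to use the equality case of \<open>edge_load\<close> for an edge far from the root. Weights
  vanish off the tip then, so that the weight at \<open>v\<close> just created makes \<open>v\<close> the tip of the remaining
  path.\<close>

lemma rtree_load:
  assumes "rtree k u V E"
    and "\<And>v. v \<in> V \<Longrightarrow> x v > 0"
    and "\<And>v. v \<in> V - {u} \<Longrightarrow> nbr_sum E x v + load (c v) * x v \<le> \<rho> * x v"
  shows "load (card E + sum c V) * x u \<le> nbr_sum E x u + load (c u) * x u \<and>
    (load (card E + sum c V) * x u = nbr_sum E x u + load (c u) * x u \<longrightarrow>
      (\<forall>v\<in>V - {u}. nbr_sum E x v + load (c v) * x v = \<rho> * x v) \<and>
      (\<exists>t. rpath k u V E t \<and> (\<forall>v\<in>V. v \<noteq> t \<longrightarrow> c v = 0)))"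
  using assms
proof (induction arbitrary: c)
  case root
  then show ?case by (auto simp: nbr_sum_def intro: rpath.root)
next
  case (grow V E v e)
  note basic = rtree_basic[OF grow.hyps(1)]
  let ?W = "e - {v}"
  have ve: "v \<in> e" and W: "?W \<inter> V = {}" using grow.hyps(3) by auto
  have enE: "e \<notin> E"
    using basic not_subset_if_meets_once[OF grow.hyps(3,5)] k3 by auto
  have ns: "nbr_sum (insert e E) x z = nbr_sum E x z + (if z \<in> e then sum x e - x z else 0)" for z
    using nbr_sum_insert[of E e] basic enE by blast
  have nsW: "nbr_sum (insert e E) x w = sum x e - x w" if "w \<in> ?W" for w
  proof -
    have "nbr_sum E x w = 0" using basic W that by (intro nbr_sum_eq_0) blast
    then show ?thesis using ns[of w] that by simp
  qed
  have nsv: "nbr_sum (insert e E) x v = nbr_sum E x v + (sum x e - x v)" using ns[of v] ve by simp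
  have nsV: "nbr_sum (insert e E) x z = nbr_sum E x z" if "z \<in> V - {v}" for z
    using ns[of z] W that by auto
  have uW: "u \<notin> ?W" using W basic by blast
  have edge: "load (1 + sum c ?W) * x v \<le> sum x e - x v \<and>
    (load (1 + sum c ?W) * x v = sum x e - x v \<longrightarrow>
      (\<forall>w\<in>?W. sum x e - x w + load (c w) * x w = \<rho> * x w) \<and>
      (\<exists>t\<in>?W. \<forall>w\<in>?W. w \<noteq> t \<longrightarrow> c w = 0))"
  proof (rule edge_load)
    fix w assume "w \<in> ?W"
    then show "sum x e - x w + load (c w) * x w \<le> \<rho> * x w"
      using grow.prems(2)[of w] nsW[of w] uW by auto
  qed (use grow ve in auto)
  \<comment> \<open>the weights after \<open>e\<close> has been absorbed at \<open>v\<close>\<close>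
  define c' where "c' = c(v := c v + (1 + sum c ?W))"
  have c'v: "load (c' v) \<le> load (c v) + load (1 + sum c ?W)"
    by (simp only: c'_def fun_upd_same load_strictly_subadditive)
  have xv: "x v > 0" using grow by auto
  have at_v: "nbr_sum E x v + load (c' v) * x v
      \<le> nbr_sum (insert e E) x v + load (c v) * x v"
    using mult_right_mono[OF c'v, of "x v"] xv nsv edge by (simp add: distrib_right)
  have at_z: "nbr_sum E x z + load (c' z) * x z = nbr_sum (insert e E) x z + load (c z) * x z"
    if "z \<in> V - {v}" for z
    using nsV[OF that] that by (simp add: c'_def)
  have le_V: "nbr_sum E x z + load (c' z) * x z \<le> nbr_sum (insert e E) x z + load (c z) * x z"
    if "z \<in> V" for z
    using at_v at_z[of z] that by (cases "z = v") auto
  have IH: "load (card E + sum c' V) * x u \<le> nbr_sum E x u + load (c' u) * x u \<and>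
    (load (card E + sum c' V) * x u = nbr_sum E x u + load (c' u) * x u \<longrightarrow>
      (\<forall>v\<in>V - {u}. nbr_sum E x v + load (c' v) * x v = \<rho> * x v) \<and>
      (\<exists>t. rpath k u V E t \<and> (\<forall>v\<in>V. v \<noteq> t \<longrightarrow> c' v = 0)))"
  proof (rule grow.IH)
    fix z assume z: "z \<in> V - {u}"
    then show "nbr_sum E x z + load (c' z) * x z \<le> \<rho> * x z"
      using le_V[of z] grow.prems(2)[of z] by auto
  qed (use grow in auto)
  have total: "card (insert e E) + sum c (V \<union> e) = card E + sum c' V"
  proof -
    have "V \<union> e = V \<union> ?W" using grow.hyps by blast
    then have "sum c (V \<union> e) = sum c V + sum c ?W"
      using W grow.hyps basic by (simp only:) (rule sum.union_disjoint; auto)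
    moreover have "sum c' V = sum c V + (1 + sum c ?W)"
      using basic grow.hyps by (simp add: c'_def sum.remove[of V v])
    ultimately show ?thesis using basic enE by simp
  qed
  show ?case unfolding total
  proof (rule conjI, goal_cases)
    case 1
    show ?case using IH le_V[of u] basic by linarith
  next
    case 2
    show ?case
    proof
      assume eq: "load (card E + sum c' V) * x u = nbr_sum (insert e E) x u + load (c u) * x u"
      then have eqIH: "load (card E + sum c' V) * x u = nbr_sum E x u + load (c' u) * x u"
        and equ: "nbr_sum E x u + load (c' u) * x u = nbr_sum (insert e E) x u + load (c u) * x u"
        using IH le_V[of u] basic by linarith+
      then obtain t where tight': "\<And>z. z \<in> V - {u} \<Longrightarrow> nbr_sum E x z + load (c' z) * x z = \<rho> * x z"
        and t: "rpath k u V E t" "\<And>z. z \<in> V \<Longrightarrow> z \<noteq> t \<Longrightarrow> c' z = 0"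
        using IH by blast
      have tightV: "nbr_sum (insert e E) x z + load (c z) * x z = \<rho> * x z" if "z \<in> V - {u}" for z
        using tight'[OF that] le_V[of z] grow.prems(2)[of z] that by auto
      have eqv: "nbr_sum E x v + load (c' v) * x v = nbr_sum (insert e E) x v + load (c v) * x v"
        using equ tightV[of v] tight'[of v] grow.hyps by (cases "v = u") auto
      have load_c'v: "load (c' v) * x v \<le> load (c v) * x v + load (1 + sum c ?W) * x v"
        using mult_right_mono[OF c'v, of "x v"] xv by (simp add: distrib_right)
      then have edge_eq: "load (1 + sum c ?W) * x v = sum x e - x v"
        using eqv nsv edge by linarith
      have "load (c' v) * x v = (load (c v) + load (1 + sum c ?W)) * x v"
        using eqv nsv edge_eq by (simp add: distrib_right)
      then have "load (c v + (1 + sum c ?W)) = load (c v) + load (1 + sum c ?W)"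
        using xv by (simp add: c'_def)
      then have cv: "c v = 0"
        using load_strictly_subadditive(2)[of "c v" "1 + sum c ?W"] by force
      from edge edge_eq obtain t' where t': "t' \<in> ?W" "\<And>w. w \<in> ?W \<Longrightarrow> w \<noteq> t' \<Longrightarrow> c w = 0"
        and tightW: "\<And>w. w \<in> ?W \<Longrightarrow> sum x e - x w + load (c w) * x w = \<rho> * x w" by blast
      have "c' v > 0" by (simp add: c'_def)
      then have "t = v" using t(2)[OF \<open>v \<in> V\<close>] by fastforce
      then have "rpath k u (V \<union> e) (insert e E) t'"
        using rpath.grow[OF t(1)] grow.hyps t'(1) by blast
      moreover have "c z = 0" if "z \<in> V \<union> e" "z \<noteq> t'" for z
      proof (cases "z \<in> ?W")
        case True
        then show ?thesis using t'(2) that by blast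
      next
        case False
        then show ?thesis using that t(2)[of z] cv \<open>t = v\<close> by (cases "z = v") (auto simp: c'_def)
      qed
      moreover have "nbr_sum (insert e E) x z + load (c z) * x z = \<rho> * x z"
        if "z \<in> V \<union> e - {u}" for z
        using that tightV[of z] tightW[of z] nsW[of z] ve grow.hyps by (cases "z \<in> ?W") auto
      ultimately show "(\<forall>v\<in>V \<union> e - {u}. nbr_sum (insert e E) x v + load (c v) * x v = \<rho> * x v) \<and>
        (\<exists>t. rpath k u (V \<union> e) (insert e E) t \<and> (\<forall>v\<in>V \<union> e. v \<noteq> t \<longrightarrow> c v = 0))"
        by blast
    qed
  qed
qed

text \<open>A solution on the path is built from the root towards the tip; the rest of the path
  is represented by the load \<open>c\<close> at the current tip.\<close>

lemma rpath_solution: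
  assumes "rpath k u V E t"
  shows "\<exists>x. (\<forall>v\<in>V. x v > 0) \<and> x u = 1 \<and>
    (\<forall>v\<in>V - {u}. nbr_sum E x v + (if v = t then load c * x v else 0) = \<rho> * x v) \<and>
    nbr_sum E x u + (if u = t then load c else 0) = load (card E + c)"
  using assms
proof (induction arbitrary: c)
  case root
  show ?case by (intro exI[of _ "\<lambda>_. 1"]) (auto simp: nbr_sum_def)
next
  case (grow V E t e t')
  note basic = rtree_basic[OF conjunct1[OF rpath_rtree[OF grow.hyps(1)]]]
  from grow.IH[of "Suc c"] obtain x where x: "\<And>v. v \<in> V \<Longrightarrow> x v > 0" "x u = 1"
    "\<And>v. v \<in> V - {u} \<Longrightarrow> nbr_sum E x v + (if v = t then load (Suc c) * x v else 0) = \<rho> * x v"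
    "nbr_sum E x u + (if u = t then load (Suc c) else 0) = load (card E + Suc c)" by blast
  have tV: "t \<in> V" "t \<in> e" using grow.hyps by auto
  have enE: "e \<notin> E"
    using basic not_subset_if_meets_once[OF grow.hyps(2,4)] k3 by auto
  define S where "S = (1 + load (Suc c)) * x t"
  define y where "y z = (if z \<in> V then x z else if z = t' then share c * S else share 0 * S)" for z
  have Spos: "S > 0" using x(1)[OF tV(1)] load_Suc_pos by (simp add: S_def)
  have ypos: "y z > 0" for z using x(1) Spos share_pos by (auto simp: y_def)
  have sum_e: "sum y e = S"
  proof -
    have "sum y e = y t + (y t' + sum y (e - {t} - {t'}))"
      using grow.hyps tV by (simp add: sum.remove)
    also have "sum y (e - {t} - {t'}) = (\<Sum>z\<in>e - {t} - {t'}. share 0 * S)"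
      using grow.hyps by (intro sum.cong) (auto simp: y_def)
    also have "\<dots> = real (k - 2) * (share 0 * S)"
      using grow.hyps tV by (simp add: card_Diff_singleton_if numeral_2_eq_2)
    also have "y t = x t" using tV by (simp add: y_def)
    also have "y t' = share c * S" using grow.hyps by (auto simp: y_def)
    also have "x t + (share c * S + real (k - 2) * (share 0 * S))
        = x t + S * (share c + (real k - 2) * share 0)"
      using k3 by (simp add: algebra_simps)
    also have "share c + (real k - 2) * share 0 = 1 - 1 / (1 + load (Suc c))"
      using load_Suc[of c] by simp
    also have "x t + S * (1 - 1 / (1 + load (Suc c))) = S"
      using load_Suc_pos[of "Suc c"] by (simp add: S_def field_simps)
    finally show ?thesis .
  qed
  have nsE: "nbr_sum E y z = nbr_sum E x z" for z
    by (rule nbr_sum_cong) (use basic in \<open>auto simp: y_def\<close>)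
  have ns: "nbr_sum (insert e E) y z = nbr_sum E x z + (if z \<in> e then S - y z else 0)" for z
    using nbr_sum_insert[of E e y z] basic enE sum_e nsE by simp
  have t't: "t' \<notin> V" "t' \<in> e" using grow.hyps by auto
  have nsE0: "nbr_sum E x w = 0" if "w \<notin> V" for w
    using basic that by (intro nbr_sum_eq_0) blast
  have share_load: "S - share j * S + load j * (share j * S) = \<rho> * (share j * S)" for j
  proof -
    have "(\<rho> + 1 - load j) * (share j * S) = S" using load_less[of j] by (simp add: share_def)
    then show ?thesis by (simp add: algebra_simps)
  qed
  have St: "S - x t = load (Suc c) * x t" by (simp add: S_def algebra_simps)
  show ?case
  proof (intro exI[of _ y] conjI ballI)
    show "y u = 1" using x basic by (simp add: y_def)
    show "nbr_sum (insert e E) y u + (if u = t' then load c else 0) = load (card (insert e E) + c)"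
    proof -
      have "u \<in> V" "u \<noteq> t'" using basic t't by auto
      moreover have "u \<in> e \<longleftrightarrow> u = t" using grow.hyps \<open>u \<in> V\<close> by auto
      ultimately show ?thesis using x(2,4) ns[of u] St basic enE by (auto simp: y_def)
    qed
    fix z assume z: "z \<in> V \<union> e - {u}"
    show "nbr_sum (insert e E) y z + (if z = t' then load c * y z else 0) = \<rho> * y z"
    proof (cases "z \<in> V")
      case True
      then have "z \<noteq> t'" and "z \<in> e \<longleftrightarrow> z = t" using t't grow.hyps by auto
      then show ?thesis using True z x(3)[of z] ns[of z] St by (auto simp: y_def)
    next
      case False
      then have "z \<in> e" using z by blast
      then show ?thesis
        using False ns[of z] nsE0[of z] share_load[of c] share_load[of 0] by (auto simp: y_def load_0)
    qed
  qed (use ypos in auto)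
qed

end

section \<open>Perron vectors\<close>

definition act :: "'a set \<Rightarrow> ('a \<Rightarrow> 'a \<Rightarrow> real) \<Rightarrow> ('a \<Rightarrow> real) \<Rightarrow> 'a \<Rightarrow> real" where
  "act V a f i = (\<Sum>j\<in>V. a i j * f j)"

lemma act_cong: "(\<And>j. j \<in> V \<Longrightarrow> f j = g j) \<Longrightarrow> act V a f i = act V a g i"
  unfolding act_def by (intro sum.cong) auto

lemma act_linear: "act V a (\<lambda>i. c * f i + d * g i) i = c * act V a f i + d * act V a g i"
  unfolding act_def by (simp add: sum.distrib sum_distrib_left algebra_simps)

lemma act_mono:
  assumes "\<And>j. j \<in> V \<Longrightarrow> f j \<le> g j" and "\<And>j. j \<in> V \<Longrightarrow> a i j \<ge> 0"
  shows "act V a f i \<le> act V a g i"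
  unfolding act_def by (intro sum_mono mult_left_mono) (use assms in auto)

text \<open>By irreducibility, each step enlarges the support until it is all of \<open>V\<close>.\<close>

lemma positive_after_steps:
  assumes fin: "finite V" and nonneg: "\<And>i j. a i j \<ge> 0"
    and irred: "\<And>S. S \<subseteq> V \<Longrightarrow> S \<noteq> {} \<Longrightarrow> S \<noteq> V \<Longrightarrow> \<exists>i\<in>V - S. \<exists>j\<in>S. a i j > 0"
    and f: "\<And>i. i \<in> V \<Longrightarrow> f i \<ge> 0" "\<exists>i\<in>V. f i > 0"
    and i: "i \<in> V"
  shows "((\<lambda>f i. f i + act V a f i) ^^ card V) f i > 0"
proof -
  let ?T = "\<lambda>f i. f i + act V a f i"
  define supp where "supp n = {i \<in> V. (?T ^^ n) f i > 0}" for n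
  have nn: "\<forall>i\<in>V. (?T ^^ n) f i \<ge> 0" for n
    by (induction n) (use f nonneg in \<open>auto simp: act_def intro!: add_nonneg_nonneg sum_nonneg\<close>)
  have mono: "supp n \<subseteq> supp (Suc n)" for n
    using nn[of n] nonneg by (auto simp: supp_def act_def intro!: add_pos_nonneg sum_nonneg)
  have "supp n = V \<or> card (supp n) > n" for n
  proof (induction n)
    case 0
    have "supp 0 \<noteq> {}" using f by (auto simp: supp_def)
    moreover have "finite (supp 0)" using fin by (simp add: supp_def)
    ultimately show ?case by (simp add: card_gt_0_iff)
  next
    case (Suc n)
    show ?case
    proof (cases "supp n = V")
      case True
      then show ?thesis using mono[of n] by (auto simp: supp_def)
    next
      case False
      then have c: "card (supp n) > n" using Suc by blast
      then have "supp n \<noteq> {}" by auto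
      moreover have "supp n \<subseteq> V" by (auto simp: supp_def)
      ultimately obtain i j where ij: "i \<in> V - supp n" "j \<in> supp n" "a i j > 0"
        using irred[of "supp n"] False by blast
      have "a i j * (?T ^^ n) f j > 0" "j \<in> V" using ij by (auto simp: supp_def)
      then have "act V a ((?T ^^ n) f) i > 0"
        unfolding act_def[of V a "(?T ^^ n) f" i] using nn[of n] nonneg fin
        by (intro sum_pos2[of V j] mult_nonneg_nonneg) blast+
      then have "i \<in> supp (Suc n)"
        using ij nn[of n] by (auto simp: supp_def intro: add_nonneg_pos)
      then have "insert i (supp n) \<subseteq> supp (Suc n)" using mono[of n] by blast
      moreover have "finite (supp (Suc n))" using fin by (simp add: supp_def)
      ultimately have "card (insert i (supp n)) \<le> card (supp (Suc n))" by (intro card_mono)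
      then show ?thesis using c ij by (auto simp: supp_def fin)
    qed
  qed
  then have "supp (card V) = V"
    using card_mono[of V "supp (card V)"] fin by (force simp: supp_def)
  then show ?thesis using i by (auto simp: supp_def)
qed

text \<open>If \<open>d = a f - r f\<close> were nonzero, then \<open>card V\<close> steps of the operator \<open>1 + a\<close>, which commutes with
  \<open>a\<close>, would make both \<open>d\<close> and \<open>f\<close> positive. The image of \<open>f\<close> would be a positive vector that \<open>a\<close>
  stretches by more than \<open>r\<close>.\<close>

lemma perron_if_maximal:
  assumes fin: "finite V" and nonneg: "\<And>i j. a i j \<ge> 0"
    and irred: "\<And>S. S \<subseteq> V \<Longrightarrow> S \<noteq> {} \<Longrightarrow> S \<noteq> V \<Longrightarrow> \<exists>i\<in>V - S. \<exists>j\<in>S. a i j > 0"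
    and f: "\<And>i. i \<in> V \<Longrightarrow> f i \<ge> 0" "\<exists>i\<in>V. f i > 0"
    and sub: "\<And>i. i \<in> V \<Longrightarrow> r * f i \<le> act V a f i"
    and r: "r \<ge> 0"
    and max: "\<And>\<mu> y. \<mu> > r \<Longrightarrow> (\<And>i. i \<in> V \<Longrightarrow> y i > 0) \<Longrightarrow> (\<And>i. i \<in> V \<Longrightarrow> \<mu> * y i \<le> act V a y i)
      \<Longrightarrow> False"
  shows "\<exists>x. (\<forall>i\<in>V. x i > 0) \<and> (\<forall>i\<in>V. act V a x i = r * x i)"
proof -
  let ?T = "\<lambda>f i. f i + act V a f i"
  define F where "F = (?T ^^ card V)"
  define d where "d = (\<lambda>i. 1 * act V a f i + (- r) * f i)"
  have comm: "act V a ((?T ^^ n) f) i - r * (?T ^^ n) f i = (?T ^^ n) d i" for n i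
  proof (induction n arbitrary: i)
    case 0 then show ?case by (simp add: d_def)
  next
    case (Suc n)
    let ?g = "(?T ^^ n) f"
    have g: "(?T ^^ n) d = (\<lambda>i. 1 * act V a ?g i + (- r) * ?g i)" using Suc by auto
    have "(?T ^^ Suc n) d i = (?T ^^ n) d i + act V a ((?T ^^ n) d) i" by simp
    also have "act V a ((?T ^^ n) d) i = act V a (act V a ?g) i - r * act V a ?g i"
      unfolding g act_linear by simp
    also have "(?T ^^ n) d i = act V a ?g i - r * ?g i" using Suc by simp
    moreover have "act V a ((?T ^^ Suc n) f) i = act V a ?g i + act V a (act V a ?g) i"
      using act_linear[of V a 1 ?g 1 "act V a ?g" i] by simp
    ultimately show ?case by (simp add: algebra_simps)
  qed
  have pos: "F f i > 0" if "i \<in> V" for i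
    unfolding F_def using positive_after_steps[OF fin nonneg irred f that] by blast
  have dn: "d i \<ge> 0" if "i \<in> V" for i using sub[OF that] by (simp add: d_def)
  have d0: "\<forall>i\<in>V. d i = 0"
  proof (rule ccontr)
    assume "\<not> ?thesis"
    then have dpos: "\<exists>i\<in>V. d i > 0" using dn by force
    have Fd: "F d i > 0" if "i \<in> V" for i
      unfolding F_def by (rule positive_after_steps[where f = d]) (use fin nonneg irred dn dpos that in blast)+
    have "V \<noteq> {}" using f by blast
    define e where "e = Min ((\<lambda>i. F d i / F f i) ` V)"
    have "e > 0" unfolding e_def using fin \<open>V \<noteq> {}\<close> Fd pos by (subst Min_gr_iff) auto
    moreover have "e * F f i \<le> F d i" if "i \<in> V" for i
    proof -
      have "e \<le> F d i / F f i" unfolding e_def using fin that by (intro Min_le) auto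
      then show ?thesis using pos[OF that] by (simp add: field_simps)
    qed
    then have "(r + e) * F f i \<le> act V a (F f) i" if "i \<in> V" for i
      using comm[of "card V" i] that unfolding F_def[symmetric] by (force simp: algebra_simps)
    ultimately show False using max[of "r + e" "F f"] pos by simp
  qed
  have zero: "(?T ^^ n) d i = 0" if "i \<in> V" for n i
    using that
  proof (induction n arbitrary: i)
    case (Suc n)
    have "act V a ((?T ^^ n) d) i = act V a (\<lambda>_. 0) i" by (rule act_cong) (use Suc in auto)
    then show ?case using Suc by (simp add: act_def)
  qed (use d0 in auto)
  have "act V a (F f) i = r * F f i" if "i \<in> V" for i
    using comm[of "card V" i] zero[OF that, of "card V"] unfolding F_def by linarith
  then show ?thesis using pos by blast
qed

lemma adjacency_nonneg: "adjacency G i j \<ge> 0" if "hypergraph G"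
proof -
  have "1 / (real (card e) - 1) \<ge> 0" if "e \<in> edges G" for e
    using that \<open>hypergraph G\<close> by (fastforce simp: hypergraph_def)
  then show ?thesis by (auto simp: adjacency_def intro!: sum_nonneg)
qed

lemma adjacency_sym: "adjacency G i j = adjacency G j i"
  by (simp add: adjacency_def conj_commute)

lemma hypergraph_list:
  assumes "hypergraph G"
  obtains vs where "distinct vs" "set vs = verts G" "vs \<noteq> []"
proof -
  have "finite (verts G)" "verts G \<noteq> {}" using assms by (auto simp: hypergraph_def)
  then show ?thesis using that finite_distinct_list[of "verts G"] by (metis set_empty)
qed

text \<open>For \<open>rho G < c < \<mu>\<close>, the powers of \<open>A / c\<close> are bounded since this matrix has spectral radius less
  than \<open>1\<close>, but they stretch \<open>y\<close> by at least the powers of \<open>\<mu> / c\<close>.\<close>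

lemma adjacency_no_faster_growth:
  assumes G: "hypergraph G" and \<mu>: "\<mu> > rho G"
    and y: "\<And>i. i \<in> verts G \<Longrightarrow> y i > 0"
    and grow: "\<And>i. i \<in> verts G \<Longrightarrow> \<mu> * y i \<le> act (verts G) (adjacency G) y i"
  shows False
proof -
  obtain vs where vs: "distinct vs" "set vs = verts G" "vs \<noteq> []" using hypergraph_list[OF G] .
  let ?n = "length vs" and ?A = "adjacency_mat G vs" and ?V = "verts G"
  have A: "?A \<in> carrier_mat ?n ?n" by (simp add: adjacency_mat_def)
  have n0: "?n > 0" using vs by simp
  have rho: "rho G = spectral_radius ?A" using vs by (intro rho_eq) auto
  have rho0: "rho G \<ge> 0" using spectral_radius_mem_max(1)[OF A n0] unfolding rho by auto
  define c where "c = (rho G + \<mu>) / 2"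
  have c: "rho G < c" "c < \<mu>" "c > 0" using rho0 \<mu> by (auto simp: c_def)
  define B where "B = (complex_of_real (1 / c)) \<cdot>\<^sub>m ?A"
  have B: "B \<in> carrier_mat ?n ?n" using A by (simp add: B_def)
  have "spectral_radius B < 1"
  proof -
    obtain l where l: "l \<in> spectrum B" "spectral_radius B = norm l"
      using spectral_radius_mem_max(1)[OF B n0] by auto
    then obtain v where v: "v \<in> carrier_vec ?n" "v \<noteq> 0\<^sub>v ?n" "B *\<^sub>v v = l \<cdot>\<^sub>v v"
      using B by (auto simp: spectrum_def eigenvalue_def eigenvector_def)
    have "?A *\<^sub>v v = (complex_of_real c * l) \<cdot>\<^sub>v v"
    proof -
      have "complex_of_real c \<cdot>\<^sub>v (B *\<^sub>v v) = ?A *\<^sub>v v"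
        unfolding B_def using A v(1) c by (intro eq_vecI) auto
      then show ?thesis using v by (simp add: smult_smult_assoc)
    qed
    then have "complex_of_real c * l \<in> spectrum ?A"
      using v A by (auto simp: spectrum_def eigenvalue_def eigenvector_def)
    then have "norm (complex_of_real c * l) \<le> rho G"
      unfolding rho using spectral_radius_mem_max(2)[OF A n0] by blast
    then have "c * norm l \<le> rho G" using c by (simp add: norm_mult)
    then have "c * norm l < c * 1" using c by linarith
    then show ?thesis using l c by simp
  qed
  then obtain K where K: "\<And>k. norm_bound (B ^\<^sub>m k) K"
    using spectral_radius_jnf_norm_bound_less_1_upper_triangular[OF B] by blast
  define a where "a i j = adjacency G i j / c" for i j
  have a0: "a i j \<ge> 0" for i j using adjacency_nonneg[OF G] c by (simp add: a_def)
  have act_a: "act ?V a f i = act ?V (adjacency G) f i / c" for f i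
    by (simp add: act_def a_def sum_divide_distrib)
  define vec_of where "vec_of f = vec ?n (\<lambda>i. complex_of_real (f (vs ! i)))" for f :: "'a \<Rightarrow> real"
  have sum_vs: "(\<Sum>j\<in>?V. h j) = (\<Sum>j<?n. h (vs ! j))" for h :: "'a \<Rightarrow> real"
    unfolding vs(2)[symmetric]
    by (rule sum.reindex_bij_betw[symmetric]) (use bij_betw_nth[OF vs(1)] in auto)
  have Bv: "B *\<^sub>v vec_of f = vec_of (act ?V a f)" for f
  proof (rule eq_vecI)
    fix i assume "i < dim_vec (vec_of (act ?V a f))"
    then have i: "i < ?n" by (simp add: vec_of_def)
    then have "(B *\<^sub>v vec_of f) $ i
        = (\<Sum>j<?n. complex_of_real (1 / c * adjacency G (vs ! i) (vs ! j) * f (vs ! j)))"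
      by (simp add: B_def adjacency_mat_def scalar_prod_def vec_of_def atLeast0LessThan)
    also have "\<dots> = complex_of_real (act ?V a f (vs ! i))"
      by (simp add: act_def sum_vs a_def)
    finally show "(B *\<^sub>v vec_of f) $ i = vec_of (act ?V a f) $ i" using i by (simp add: vec_of_def)
  qed (simp add: vec_of_def B_def adjacency_mat_def)
  have Bk: "B ^\<^sub>m m *\<^sub>v vec_of f = vec_of ((act ?V a ^^ m) f)" for m f
  proof (induction m arbitrary: f)
    case 0
    show ?case using B by (simp add: vec_of_def)
  next
    case (Suc m)
    have "B ^\<^sub>m Suc m *\<^sub>v vec_of f = B ^\<^sub>m m *\<^sub>v (B *\<^sub>v vec_of f)"
      using B by (simp, subst assoc_mult_mat_vec[of _ ?n ?n]) (auto simp: vec_of_def)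
    also have "\<dots> = vec_of ((act ?V a ^^ Suc m) f)" unfolding Bv Suc by (simp add: funpow_swap1)
    finally show ?case .
  qed
  define q where "q = \<mu> / c"
  have q: "q > 1" using c by (simp add: q_def)
  have power: "q ^ m * y i \<le> (act ?V a ^^ m) y i" if "i \<in> ?V" for m i
    using that
  proof (induction m arbitrary: i)
    case (Suc m)
    have "q * y i \<le> act ?V a y i"
      using grow[OF Suc.prems] c by (simp add: act_a q_def divide_right_mono)
    then have "q ^ m * (q * y i) \<le> q ^ m * act ?V a y i" using q by (intro mult_left_mono) auto
    also have "\<dots> = act ?V a (\<lambda>j. q ^ m * y j) i"
      by (simp add: act_def sum_distrib_left algebra_simps)
    also have "\<dots> \<le> act ?V a ((act ?V a ^^ m) y) i"
      by (rule act_mono) (use Suc.IH a0 in auto)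
    finally show ?case by (simp add: mult.assoc mult.commute[of q])
  qed simp
  define i where "i = vs ! 0"
  have i: "i \<in> ?V" using n0 vs by (simp add: i_def flip: vs(2))
  have bound: "(act ?V a ^^ m) y i \<le> (\<Sum>j<?n. K * y (vs ! j))" for m
  proof -
    have Bm: "B ^\<^sub>m m \<in> carrier_mat ?n ?n" using B by simp
    have "complex_of_real ((act ?V a ^^ m) y i) = (B ^\<^sub>m m *\<^sub>v vec_of y) $ 0"
      unfolding Bk using n0 by (simp add: vec_of_def i_def)
    also have "\<dots> = row (B ^\<^sub>m m) 0 \<bullet> vec_of y"
      by (rule index_mult_mat_vec) (use carrier_matD[OF B] n0 in simp)
    also have "\<dots> = (\<Sum>j<?n. (B ^\<^sub>m m) $$ (0, j) * complex_of_real (y (vs ! j)))"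
      unfolding scalar_prod_def using carrier_matD[OF Bm] n0
      by (intro sum.cong) (auto simp: vec_of_def)
    finally have "norm (complex_of_real ((act ?V a ^^ m) y i))
        \<le> (\<Sum>j<?n. norm ((B ^\<^sub>m m) $$ (0, j) * complex_of_real (y (vs ! j))))"
      by (simp only: norm_sum)
    also have "\<dots> \<le> (\<Sum>j<?n. K * y (vs ! j))"
    proof (rule sum_mono)
      fix j assume "j \<in> {..<?n}"
      then have j: "j < ?n" "vs ! j \<in> ?V" by (auto simp flip: vs(2))
      have "norm ((B ^\<^sub>m m) $$ (0, j)) \<le> K" using K[of m] n0 j unfolding norm_bound_def carrier_matD[OF Bm] by blast
      then show "norm ((B ^\<^sub>m m) $$ (0, j) * complex_of_real (y (vs ! j))) \<le> K * y (vs ! j)"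
        using y[OF j(2)] by (simp add: norm_mult mult_right_mono)
    qed
    finally show ?thesis by simp
  qed
  obtain m where "(\<Sum>j<?n. K * y (vs ! j)) / y i < q ^ m" using real_arch_pow[OF q] by blast
  then have "(\<Sum>j<?n. K * y (vs ! j)) < q ^ m * y i" using y[OF i] by (simp add: field_simps)
  then show False using power[OF i, of m] bound[of m] by linarith
qed

text \<open>The moduli of the entries of a complex eigenvector for an eigenvalue of maximal modulus, by the
  triangle inequality.\<close>

lemma adjacency_subeigenvector:
  assumes G: "hypergraph G"
  shows "\<exists>f. (\<forall>i\<in>verts G. f i \<ge> 0) \<and> (\<exists>i\<in>verts G. f i > 0) \<and>
    (\<forall>i\<in>verts G. rho G * f i \<le> act (verts G) (adjacency G) f i)" and "rho G \<ge> 0"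
proof -
  obtain vs where vs: "distinct vs" "set vs = verts G" "vs \<noteq> []" using hypergraph_list[OF G] .
  let ?n = "length vs" and ?A = "adjacency_mat G vs"
  have A: "?A \<in> carrier_mat ?n ?n" by (simp add: adjacency_mat_def)
  have n0: "?n > 0" using vs by simp
  have rho: "rho G = spectral_radius ?A" using vs by (intro rho_eq) auto
  show "rho G \<ge> 0" using spectral_radius_mem_max(1)[OF A n0] unfolding rho by auto
  obtain l where "eigenvalue ?A l" and l: "rho G = norm l"
    using spectral_radius_mem_max(1)[OF A n0] unfolding rho spectrum_def by auto
  then obtain x where x: "\<exists>i\<in>verts G. x i \<noteq> 0"
    "\<And>i. i \<in> verts G \<Longrightarrow> (\<Sum>j\<in>verts G. complex_of_real (adjacency G i j) * x j) = l * x i"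
    unfolding eigenvalue_adjacency_mat[OF vs(1)] vs(2) by blast
  show "\<exists>f. (\<forall>i\<in>verts G. f i \<ge> 0) \<and> (\<exists>i\<in>verts G. f i > 0) \<and>
    (\<forall>i\<in>verts G. rho G * f i \<le> act (verts G) (adjacency G) f i)"
  proof (intro exI[of _ "\<lambda>i. norm (x i)"] conjI ballI)
    fix i assume "i \<in> verts G"
    then have "rho G * norm (x i) = norm (\<Sum>j\<in>verts G. complex_of_real (adjacency G i j) * x j)"
      using x(2) l by (simp add: norm_mult)
    also have "\<dots> \<le> (\<Sum>j\<in>verts G. norm (complex_of_real (adjacency G i j) * x j))"
      by (rule norm_sum)
    also have "\<dots> = act (verts G) (adjacency G) (\<lambda>i. norm (x i)) i"
      using adjacency_nonneg[OF G] by (simp add: act_def norm_mult)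
    finally show "rho G * norm (x i) \<le> act (verts G) (adjacency G) (\<lambda>i. norm (x i)) i" .
  qed (use x in auto)
qed

lemma act_adjacency_uniform:
  assumes G: "hypergraph G" and unif: "uniform k G" and i: "i \<in> verts G"
  shows "(real k - 1) * act (verts G) (adjacency G) x i = nbr_sum (edges G) x i"
proof (cases "k \<ge> 2")
  case True
  have finV: "finite (verts G)" and sub: "\<And>e. e \<in> edges G \<Longrightarrow> e \<subseteq> verts G"
    using G by (auto simp: hypergraph_def)
  have finE: "finite (edges G)" using finV sub by (meson Pow_iff finite_Pow_iff finite_subset subsetI)
  let ?E = "{e. e \<in> edges G \<and> i \<in> e}"
  have adj: "(real k - 1) * adjacency G i j = (\<Sum>e\<in>?E. of_bool (j \<in> e - {i}))" for j
  proof -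
    have "(\<Sum>e\<in>{e \<in> edges G. i \<in> e \<and> j \<in> e}. 1 / (real (card e) - 1))
        = (\<Sum>e\<in>{e \<in> edges G. i \<in> e \<and> j \<in> e}. 1 / (real k - 1))"
      using unif by (intro sum.cong) (auto simp: uniform_def)
    moreover have "(\<Sum>e\<in>?E. of_bool (j \<in> e)) = real (card {e \<in> edges G. i \<in> e \<and> j \<in> e})"
      using finE by (simp add: sum.If_cases of_bool_def Int_def conj_assoc)
    ultimately show ?thesis using True by (auto simp: adjacency_def)
  qed
  have "(real k - 1) * act (verts G) (adjacency G) x i
      = (\<Sum>j\<in>verts G. (\<Sum>e\<in>?E. of_bool (j \<in> e - {i})) * x j)"
    unfolding act_def sum_distrib_left adj[symmetric] by (simp add: mult.assoc)
  also have "\<dots> = (\<Sum>e\<in>?E. \<Sum>j\<in>verts G. of_bool (j \<in> e - {i}) * x j)"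
    unfolding sum_distrib_right by (rule sum.swap)
  also have "\<dots> = (\<Sum>e\<in>?E. sum x e - x i)"
  proof (rule sum.cong)
    fix e assume e: "e \<in> ?E"
    then have "e \<subseteq> verts G" using sub by blast
    then have fe: "finite e" using finV finite_subset by blast
    have "(\<Sum>j\<in>verts G. of_bool (j \<in> e - {i}) * x j) = sum x (verts G \<inter> (e - {i}))"
      using finV by (simp add: sum.inter_restrict)
    also have "verts G \<inter> (e - {i}) = e - {i}" using \<open>e \<subseteq> verts G\<close> by blast
    also have "sum x (e - {i}) = sum x e - x i" using e fe by (simp add: sum_diff1)
    finally show "(\<Sum>j\<in>verts G. of_bool (j \<in> e - {i}) * x j) = sum x e - x i" .
  qed simp
  finally show ?thesis unfolding nbr_sum_def .
next
  case False
  then have "edges G = {}" using G unif by (fastforce simp: hypergraph_def uniform_def)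
  then show ?thesis by (simp add: act_def adjacency_def nbr_sum_def)
qed

lemma edge_connected_adjacency:
  assumes G: "hypergraph G" and conn: "edge_connected (verts G) (edges G)"
    and S: "S \<subseteq> verts G" "S \<noteq> {}" "S \<noteq> verts G"
  shows "\<exists>i\<in>verts G - S. \<exists>j\<in>S. adjacency G i j > 0"
proof -
  obtain e where e: "e \<in> edges G" "e \<inter> S \<noteq> {}" "\<not> e \<subseteq> S"
    using conn S unfolding edge_connected_def by blast
  then obtain i j where ij: "i \<in> e" "i \<notin> S" "j \<in> e" "j \<in> S" by blast
  have finV: "finite (verts G)" and sub: "\<And>e. e \<in> edges G \<Longrightarrow> e \<subseteq> verts G"
    and card2: "\<And>e. e \<in> edges G \<Longrightarrow> card e \<ge> 2"
    using G by (auto simp: hypergraph_def)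
  have finE: "finite (edges G)" using finV sub by (meson Pow_iff finite_Pow_iff finite_subset subsetI)
  have "i \<noteq> j" using ij by blast
  have "(\<Sum>e\<in>{e \<in> edges G. i \<in> e \<and> j \<in> e}. 1 / (real (card e) - 1)) > 0"
  proof (rule sum_pos)
    show "{e \<in> edges G. i \<in> e \<and> j \<in> e} \<noteq> {}" using ij e by blast
    fix e assume "e \<in> {e \<in> edges G. i \<in> e \<and> j \<in> e}"
    then have "card e \<ge> 2" using card2 by blast
    then show "1 / (real (card e) - 1) > 0" by simp
  qed (use finE in simp)
  then have "adjacency G i j > 0" using \<open>i \<noteq> j\<close> by (simp add: adjacency_def)
  then show ?thesis using ij e sub by blast
qed

lemma perron_vector:
  assumes "hypergraph G" and "uniform k G" and "edge_connected (verts G) (edges G)"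
  obtains x where "\<And>v. v \<in> verts G \<Longrightarrow> x v > 0"
    and "\<And>v. v \<in> verts G \<Longrightarrow> nbr_sum (edges G) x v = (real k - 1) * rho G * x v"
proof -
  obtain f where f: "\<And>i. i \<in> verts G \<Longrightarrow> f i \<ge> 0" "\<exists>i\<in>verts G. f i > 0"
    "\<And>i. i \<in> verts G \<Longrightarrow> rho G * f i \<le> act (verts G) (adjacency G) f i"
    using adjacency_subeigenvector(1)[OF assms(1)] by blast
  have "\<exists>x. (\<forall>i\<in>verts G. x i > 0) \<and> (\<forall>i\<in>verts G. act (verts G) (adjacency G) x i = rho G * x i)"
  proof (rule perron_if_maximal[where f = f])
    show "finite (verts G)" using assms(1) by (simp add: hypergraph_def)
    show "\<exists>i\<in>verts G - S. \<exists>j\<in>S. adjacency G i j > 0"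
      if "S \<subseteq> verts G" "S \<noteq> {}" "S \<noteq> verts G" for S
      using edge_connected_adjacency[OF assms(1,3) that] .
    show False if "\<mu> > rho G" "\<And>i. i \<in> verts G \<Longrightarrow> y i > 0"
      "\<And>i. i \<in> verts G \<Longrightarrow> \<mu> * y i \<le> act (verts G) (adjacency G) y i" for \<mu> y
      by (rule adjacency_no_faster_growth[OF assms(1) that])
  qed (fact f adjacency_nonneg[OF assms(1)] adjacency_subeigenvector(2)[OF assms(1)])+
  then obtain x where x: "\<And>v. v \<in> verts G \<Longrightarrow> x v > 0"
    "\<And>v. v \<in> verts G \<Longrightarrow> act (verts G) (adjacency G) x v = rho G * x v" by blast
  show thesis
    by (rule that[of x]) (use x act_adjacency_uniform[OF assms(1,2), symmetric] in \<open>auto simp: mult.assoc\<close>)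
qed

lemma nbr_sum_sym:
  assumes G: "hypergraph G" and unif: "uniform k G"
  shows "(\<Sum>v\<in>verts G. x v * nbr_sum (edges G) y v) = (\<Sum>v\<in>verts G. y v * nbr_sum (edges G) x v)"
proof -
  let ?V = "verts G"
  have *: "(\<Sum>v\<in>?V. p v * nbr_sum (edges G) q v)
      = (real k - 1) * (\<Sum>v\<in>?V. \<Sum>u\<in>?V. adjacency G v u * p v * q u)" for p q
  proof -
    have "(\<Sum>v\<in>?V. p v * nbr_sum (edges G) q v)
        = (\<Sum>v\<in>?V. p v * ((real k - 1) * act ?V (adjacency G) q v))"
      using act_adjacency_uniform[OF G unif] by (intro sum.cong) auto
    then show ?thesis by (simp add: act_def sum_distrib_left algebra_simps)
  qed
  have "(\<Sum>v\<in>?V. \<Sum>u\<in>?V. adjacency G v u * x v * y u)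
      = (\<Sum>v\<in>?V. \<Sum>u\<in>?V. adjacency G v u * y v * x u)"
    by (subst sum.swap) (simp add: adjacency_sym[of G] mult_ac)
  then show ?thesis by (simp add: *)
qed

text \<open>Symmetry of the adjacency matrix makes the Perron vector a left eigenvector.\<close>

lemma perron_pairing:
  assumes G: "hypergraph G" "uniform k G" "edge_connected (verts G) (edges G)"
  obtains x where "\<And>v. v \<in> verts G \<Longrightarrow> x v > 0"
    and "\<And>y. (\<Sum>v\<in>verts G. x v * nbr_sum (edges G) y v)
      = (\<Sum>v\<in>verts G. x v * ((real k - 1) * rho G * y v))"
proof -
  obtain x where x: "\<And>v. v \<in> verts G \<Longrightarrow> x v > 0"
    "\<And>v. v \<in> verts G \<Longrightarrow> nbr_sum (edges G) x v = (real k - 1) * rho G * x v"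
    using perron_vector[OF G] by blast
  have "(\<Sum>v\<in>verts G. x v * nbr_sum (edges G) y v)
      = (\<Sum>v\<in>verts G. x v * ((real k - 1) * rho G * y v))" for y
    unfolding nbr_sum_sym[OF G(1,2), of x y]
    by (rule sum.cong) (simp_all add: x(2) mult_ac)
  with x(1) show thesis by (rule that)
qed

lemma positive_pairing:
  assumes "hypergraph G" and "k \<ge> 2"
    and "\<And>v. v \<in> verts G \<Longrightarrow> x v > 0" and "\<And>v. v \<in> verts G \<Longrightarrow> y v > 0"
  obtains P where "P > 0" and "\<And>r. (\<Sum>v\<in>verts G. x v * ((real k - 1) * r * y v)) = P * r"
proof
  show "(real k - 1) * (\<Sum>v\<in>verts G. x v * y v) > 0"
    using assms by (intro mult_pos_pos sum_pos) (auto simp: hypergraph_def)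
  show "(\<Sum>v\<in>verts G. x v * ((real k - 1) * r * y v))
      = (real k - 1) * (\<Sum>v\<in>verts G. x v * y v) * r" for r
    by (simp add: sum_distrib_left sum_distrib_right mult_ac)
qed

lemma rho_le_if_supersolution:
  assumes G: "hypergraph G" "uniform k G" "edge_connected (verts G) (edges G)" and k: "k \<ge> 2"
    and y: "\<And>v. v \<in> verts G \<Longrightarrow> y v > 0"
    and le: "\<And>v. v \<in> verts G \<Longrightarrow> nbr_sum (edges G) y v \<le> (real k - 1) * r * y v"
  shows "rho G \<le> r"
    and "w \<in> verts G \<Longrightarrow> nbr_sum (edges G) y w < (real k - 1) * r * y w \<Longrightarrow> rho G < r"
proof -
  let ?V = "verts G"
  have V: "finite ?V" using G(1) by (simp add: hypergraph_def)
  obtain x where x: "\<And>v. v \<in> ?V \<Longrightarrow> x v > 0"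
    "\<And>y. (\<Sum>v\<in>?V. x v * nbr_sum (edges G) y v) = (\<Sum>v\<in>?V. x v * ((real k - 1) * rho G * y v))"
    using perron_pairing[OF G] by blast
  obtain P where P: "P > 0" "\<And>r. (\<Sum>v\<in>?V. x v * ((real k - 1) * r * y v)) = P * r"
    using positive_pairing[of G k x y] G(1) k x(1) y by blast
  have term_le: "x v * nbr_sum (edges G) y v \<le> x v * ((real k - 1) * r * y v)" if "v \<in> ?V" for v
    using le[OF that] x(1)[OF that] by (intro mult_left_mono) auto
  have "P * rho G \<le> P * r" unfolding P(2)[symmetric] x(2)[symmetric]
    by (rule sum_mono) (rule term_le)
  then show "rho G \<le> r" using P by simp
  assume w: "w \<in> ?V" "nbr_sum (edges G) y w < (real k - 1) * r * y w"
  have "P * rho G < P * r" unfolding P(2)[symmetric] x(2)[symmetric]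
    by (rule sum_strict_mono_ex1)
      (use V w x(1) term_le in \<open>auto intro!: bexI[of _ w] mult_strict_left_mono\<close>)
  then show "rho G < r" using P by simp
qed

lemma rho_greater_if_subsolution:
  assumes G: "hypergraph G" "uniform k G" "edge_connected (verts G) (edges G)" and k: "k \<ge> 2"
    and y: "\<And>v. v \<in> verts G \<Longrightarrow> y v > 0"
    and ge: "\<And>v. v \<in> verts G \<Longrightarrow> nbr_sum (edges G) y v \<ge> (real k - 1) * r * y v"
    and w: "w \<in> verts G" "nbr_sum (edges G) y w > (real k - 1) * r * y w"
  shows "rho G > r"
proof -
  let ?V = "verts G"
  have V: "finite ?V" using G(1) by (simp add: hypergraph_def)
  obtain x where x: "\<And>v. v \<in> ?V \<Longrightarrow> x v > 0"
    "\<And>y. (\<Sum>v\<in>?V. x v * nbr_sum (edges G) y v) = (\<Sum>v\<in>?V. x v * ((real k - 1) * rho G * y v))"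
    using perron_pairing[OF G] by blast
  obtain P where P: "P > 0" "\<And>r. (\<Sum>v\<in>?V. x v * ((real k - 1) * r * y v)) = P * r"
    using positive_pairing[of G k x y] G(1) k x(1) y by blast
  have term_ge: "x v * nbr_sum (edges G) y v \<ge> x v * ((real k - 1) * r * y v)" if "v \<in> ?V" for v
    using ge[OF that] x(1)[OF that] by (intro mult_left_mono) auto
  have "P * r < P * rho G" unfolding P(2)[symmetric] x(2)[symmetric]
    by (rule sum_strict_mono_ex1)
      (use V w x(1) term_ge in \<open>auto intro!: bexI[of _ w] mult_strict_left_mono\<close>)
  then show ?thesis using P by simp
qed

section \<open>Supertrees are grown edge by edge\<close>

lemma hyperpath_extend:
  assumes p: "hyperpath G vs es"
    and e: "e \<in> edges G" "e \<notin> set es" "last vs \<in> e"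
    and meet: "\<And>i. Suc i < length es \<Longrightarrow> e \<inter> es ! i = {}"
      "es \<noteq> [] \<Longrightarrow> last es \<inter> e = {last vs}"
    and c: "c \<in> e" "c \<in> verts G" "c \<notin> set vs"
  shows "hyperpath G (vs @ [c]) (es @ [e])"
proof -
  have len: "length vs = Suc (length es)" using p by (simp add: hyperpath_def)
  then have ne: "vs \<noteq> []" by auto
  then have last: "last vs = vs ! length es" using len by (simp add: last_conv_nth)
  let ?n = "length es"
  have nv: "(vs @ [c]) ! i = (if i \<le> ?n then vs ! i else c)" if "i \<le> Suc ?n" for i
    using that len by (auto simp: nth_append)
  have ne: "(es @ [e]) ! i = (if i < ?n then es ! i else e)" if "i \<le> ?n" for i
    using that by (auto simp: nth_append)
  show ?thesis unfolding hyperpath_def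
  proof (intro conjI allI impI)
    fix i assume i: "i < length (es @ [e])"
    show "(vs @ [c]) ! i \<in> (es @ [e]) ! i" "(vs @ [c]) ! (i + 1) \<in> (es @ [e]) ! i"
      using i p e(3) c(1) last nv[of i] nv[of "i + 1"] ne[of i]
      by (auto simp: hyperpath_def less_Suc_eq)
  next
    fix i assume i: "i + 1 < length (es @ [e])"
    show "(es @ [e]) ! i \<inter> (es @ [e]) ! (i + 1) = {(vs @ [c]) ! (i + 1)}"
    proof (cases "i + 1 < ?n")
      case True
      then show ?thesis using p nv[of "i + 1"] ne[of i] ne[of "i + 1"] by (auto simp: hyperpath_def)
    next
      case False
      then have n: "?n = Suc i" using i by simp
      then have "es \<noteq> []" by auto
      then have "last es = es ! i" using n by (simp add: last_conv_nth)
      then show ?thesis using meet(2) \<open>es \<noteq> []\<close> n last nv[of "i + 1"] ne[of i] ne[of "i + 1"] by simp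
    qed
  next
    fix i j assume ij: "i + 2 \<le> j \<and> j < length (es @ [e])"
    show "(es @ [e]) ! i \<inter> (es @ [e]) ! j = {}"
    proof (cases "j < ?n")
      case True
      then show ?thesis using p ij ne[of i] ne[of j] by (auto simp: hyperpath_def)
    next
      case False
      then show ?thesis using meet(1)[of i] ij ne[of i] ne[of j] by (auto simp: Int_commute)
    qed
  qed (use p e c in \<open>auto simp: hyperpath_def\<close>)
qed

lemma hyperpath_rev:
  assumes p: "hyperpath G vs es"
  shows "hyperpath G (rev vs) (rev es)"
proof -
  let ?n = "length es"
  have len: "length vs = Suc ?n" using p by (simp add: hyperpath_def)
  have inc: "\<And>i. i < ?n \<Longrightarrow> vs ! i \<in> es ! i \<and> vs ! (i + 1) \<in> es ! i"
    and adj: "\<And>i. i + 1 < ?n \<Longrightarrow> es ! i \<inter> es ! (i + 1) = {vs ! (i + 1)}"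
    and far: "\<And>i j. i + 2 \<le> j \<Longrightarrow> j < ?n \<Longrightarrow> es ! i \<inter> es ! j = {}"
    using p by (auto simp: hyperpath_def)
  have rv: "rev vs ! i = vs ! (?n - i)" if "i \<le> ?n" for i using that len by (simp add: rev_nth)
  have re: "rev es ! i = es ! (?n - Suc i)" if "i < ?n" for i using that by (simp add: rev_nth)
  show ?thesis unfolding hyperpath_def
  proof (intro conjI allI impI)
    fix i assume i: "i < length (rev es)"
    show "rev vs ! i \<in> rev es ! i" "rev vs ! (i + 1) \<in> rev es ! i"
      using inc[of "?n - Suc i"] i rv[of i] rv[of "i + 1"] re[of i] by (simp_all add: Suc_diff_Suc)
  next
    fix i assume i: "i + 1 < length (rev es)"
    then have "es ! (?n - Suc (Suc i)) \<inter> es ! (?n - Suc i) = {vs ! (?n - Suc i)}"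
      using adj[of "?n - Suc (Suc i)"] by (simp add: Suc_diff_Suc)
    then show "rev es ! i \<inter> rev es ! (i + 1) = {rev vs ! (i + 1)}"
      using i rv[of "i + 1"] re[of i] re[of "i + 1"] by (simp add: Int_commute)
  next
    fix i j assume ij: "i + 2 \<le> j \<and> j < length (rev es)"
    then have "?n - Suc j + 2 \<le> ?n - Suc i" "?n - Suc i < ?n" by auto
    then show "rev es ! i \<inter> rev es ! j = {}"
      using ij far[of "?n - Suc j" "?n - Suc i"] re[of i] re[of j] by (auto simp: Int_commute)
  qed (use p in \<open>auto simp: hyperpath_def\<close>)
qed

lemma hyperpath_take:
  assumes "hyperpath G vs es" and "j \<le> length es"
  shows "hyperpath G (take (Suc j) vs) (take j es)"
  using assms set_take_subset[of "Suc j" vs] set_take_subset[of j es]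
  unfolding hyperpath_def by (auto simp: distinct_take)

lemma hyperpath_single: "v \<in> verts G \<Longrightarrow> hyperpath G [v] []"
  by (simp add: hyperpath_def)

lemma hyperpath_edge:
  "e \<in> edges G \<Longrightarrow> e \<subseteq> verts G \<Longrightarrow> a \<in> e \<Longrightarrow> b \<in> e \<Longrightarrow> a \<noteq> b \<Longrightarrow> hyperpath G [a, b] [e]"
  by (auto simp: hyperpath_def)

lemma hyperpath_mono:
  assumes "hyperpath G vs es" and "verts G \<subseteq> verts H" and "edges G \<subseteq> edges H"
  shows "hyperpath H vs es"
  using assms unfolding hyperpath_def by auto

text \<open>A hyperpath can therefore be continued by any edge that meets its vertices only in the last one.\<close>

lemma hyperpath_last_not_in_earlier:
  assumes "hyperpath G vs es" and "Suc i < length es"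
  shows "last vs \<notin> es ! i"
proof
  assume l: "last vs \<in> es ! i"
  have len: "length vs = Suc (length es)" using assms by (simp add: hyperpath_def)
  then have last: "last vs = vs ! length es" by (subst last_conv_nth) auto
  have inc: "vs ! length es \<in> es ! (length es - 1)"
  proof -
    have "\<forall>i<length es. vs ! i \<in> es ! i \<and> vs ! (i + 1) \<in> es ! i"
      using assms(1) unfolding hyperpath_def by blast
    then have "vs ! (length es - 1 + 1) \<in> es ! (length es - 1)" using assms(2) by force
    moreover have "length es - 1 + 1 = length es" using assms(2) by linarith
    ultimately show ?thesis by metis
  qed
  show False
  proof (cases "i + 2 < length es")
    case True
    then have "es ! i \<inter> es ! (length es - 1) = {}"
    proof -
      have "\<forall>i j. i + 2 \<le> j \<and> j < length es \<longrightarrow> es ! i \<inter> es ! j = {}"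
        using assms(1) unfolding hyperpath_def by blast
      moreover have "i + 2 \<le> length es - 1" "length es - 1 < length es" using True by linarith+
      ultimately show ?thesis by blast
    qed
    then show False using l last inc by auto
  next
    case False
    then have i: "length es = i + 2" using assms(2) by simp
    then have "es ! i \<inter> es ! (i + 1) = {vs ! (i + 1)}"
      using assms(1) by (auto simp: hyperpath_def)
    then have "vs ! (i + 2) = vs ! (i + 1)" using l last inc i by auto
    then show False using assms(1) len i by (auto simp: hyperpath_def nth_eq_iff_index_eq)
  qed
qed

lemma rtree_hyperpath:
  assumes "rtree k u V E" and "k \<ge> 2" and "a \<in> V" and "b \<in> V"
  shows "\<exists>vs es. hyperpath \<lparr>verts = V, edges = E\<rparr> vs es \<and> hd vs = a \<and> last vs = b"
  using assms(1,3,4)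
proof (induction arbitrary: a b)
  case root
  then show ?case
    using hyperpath_single[of u "\<lparr>verts = {u}, edges = {}\<rparr>"] by force
next
  case (grow V E v e)
  note basic = rtree_basic[OF grow.hyps(1)]
  let ?H = "\<lparr>verts = V \<union> e, edges = insert e E\<rparr>"
  have enE: "e \<notin> E" using basic not_subset_if_meets_once[OF grow.hyps(3,5) assms(2)] by blast
  have into_new: "\<exists>vs es. hyperpath ?H vs es \<and> hd vs = a \<and> last vs = b"
    if ab: "a \<in> V" "b \<in> e - V" for a b
  proof -
    obtain vs es where p: "hyperpath \<lparr>verts = V, edges = E\<rparr> vs es" "hd vs = a" "last vs = v"
      using grow.IH[OF ab(1) grow.hyps(2)] by blast
    have sub: "set vs \<subseteq> V" "set es \<subseteq> E" and ne: "vs \<noteq> []" and len: "length vs = Suc (length es)"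
      using p(1) by (auto simp: hyperpath_def)
    have V: "es ! i \<subseteq> V" if "i < length es" for i using basic sub(2) that nth_mem by blast
    have "hyperpath ?H (vs @ [b]) (es @ [e])"
    proof (rule hyperpath_extend)
      show "hyperpath ?H vs es" by (rule hyperpath_mono[OF p(1)]) auto
      show "e \<inter> es ! i = {}" if "Suc i < length es" for i
        using hyperpath_last_not_in_earlier[OF p(1) that] V[of i] that grow.hyps(3)
        unfolding p(3) by (metis Int_assoc Int_insert_left_if0 Suc_lessD inf.absorb_iff2 inf_bot_left)
      show "last es \<inter> e = {last vs}" if "es \<noteq> []"
      proof -
        have "last vs \<in> last es"
          using p(1) that ne len
          by (auto simp: hyperpath_def last_conv_nth dest!: spec[of _ "length es - 1"])
        moreover have "last es \<subseteq> V" using V[of "length es - 1"] that by (simp add: last_conv_nth)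
        ultimately show ?thesis using p(3) grow.hyps(3) by auto
      qed
    qed (use sub enE ab p grow.hyps in auto)
    then show ?thesis using p ne by (intro exI[of _ "vs @ [b]"] exI[of _ "es @ [e]"]) auto
  qed
  consider "a \<in> V" "b \<in> V" | "a \<in> V" "b \<in> e - V" | "a \<in> e - V" "b \<in> V" | "a \<in> e" "b \<in> e"
    using grow.prems by blast
  then show ?case
  proof cases
    case 1
    then obtain vs es where "hyperpath \<lparr>verts = V, edges = E\<rparr> vs es" "hd vs = a" "last vs = b"
      using grow.IH by blast
    then show ?thesis using hyperpath_mono[of "\<lparr>verts = V, edges = E\<rparr>" vs es ?H] by auto
  next
    case 2
    then show ?thesis by (rule into_new)
  next
    case 3
    then obtain vs es where p: "hyperpath ?H vs es" "hd vs = b" "last vs = a"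
      using into_new by blast
    then have "vs \<noteq> []" by (auto simp: hyperpath_def)
    then show ?thesis using hyperpath_rev[OF p(1)] p(2,3)
      by (intro exI[of _ "rev vs"] exI[of _ "rev es"]) (auto simp: hd_rev last_rev)
  next
    case 4
    show ?thesis
    proof (cases "a = b")
      case True
      then show ?thesis using hyperpath_single[of a ?H] 4
        by (intro exI[of _ "[a]"] exI[of _ "[]"]) auto
    next
      case False
      then show ?thesis using hyperpath_edge[of e ?H a b] 4
        by (intro exI[of _ "[a, b]"] exI[of _ "[e]"]) auto
    qed
  qed
qed

text \<open>Among the hyperpaths in the tree whose ends are distinct vertices of \<open>e\<close>, a shortest one closes
  to a hypercycle with \<open>e\<close>: a further common vertex of \<open>e\<close> and the path would give a shorter one.
  If the shortest one is a single edge, it forms a hypercycle of length \<open>2\<close> with \<open>e\<close>.\<close>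

lemma hypercycle_of_chord:
  assumes "rtree k u V E" and k: "k \<ge> 2"
    and sub: "V \<subseteq> verts G" "E \<subseteq> edges G"
    and e: "e \<in> edges G" "e \<notin> E" "a \<in> e \<inter> V" "b \<in> e \<inter> V" "a \<noteq> b"
  shows "\<exists>vs es. hypercycle G vs es"
proof -
  note basic = rtree_basic[OF assms(1)]
  let ?H = "\<lparr>verts = V, edges = E\<rparr>"
  define P where "P n \<longleftrightarrow> (\<exists>vs es. hyperpath ?H vs es \<and> length es = n \<and> n > 0 \<and>
    hd vs \<in> e \<and> last vs \<in> e)" for n
  have P_intro: "P (length es)" if p: "hyperpath ?H vs es" "es \<noteq> []" "hd vs \<in> e" "last vs \<in> e" for vs es
    unfolding P_def using that by auto
  obtain vs0 es0 where p0: "hyperpath ?H vs0 es0" "hd vs0 = a" "last vs0 = b"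
    using rtree_hyperpath[OF assms(1) k] e by blast
  have "es0 \<noteq> []"
  proof
    assume "es0 = []"
    then have "length vs0 = 1" using p0(1) by (simp add: hyperpath_def)
    then show False using p0(2,3) e(5) by (auto simp: length_Suc_conv)
  qed
  then have "P (length es0)" using p0 e by (intro P_intro) auto
  then obtain q where q: "P q" and least: "\<And>m. P m \<Longrightarrow> q \<le> m" by (metis LeastI Least_le)
  from q obtain vs es where p: "hyperpath ?H vs es" and len_es: "length es = q" and q0: "q > 0"
    and ends: "hd vs \<in> e" "last vs \<in> e" unfolding P_def by blast
  have len: "length vs = Suc q" and dist: "distinct vs" "distinct es"
    and sub_p: "set vs \<subseteq> V" "set es \<subseteq> E"
    and inc: "\<And>i. i < q \<Longrightarrow> vs ! i \<in> es ! i \<and> vs ! Suc i \<in> es ! i"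
    and adj: "\<And>i. Suc i < q \<Longrightarrow> es ! i \<inter> es ! Suc i = {vs ! Suc i}"
    and far: "\<And>i j. i + 2 \<le> j \<Longrightarrow> j < q \<Longrightarrow> es ! i \<inter> es ! j = {}"
    using p len_es by (auto simp: hyperpath_def)
  have hd: "vs ! 0 \<in> e" and last: "vs ! q \<in> e"
    using ends len by (auto simp: hd_conv_nth last_conv_nth simp flip: length_0_conv)
  have es_sub: "es ! i \<subseteq> V" "es ! i \<in> E" if "i < q" for i
  proof -
    show "es ! i \<in> E" using that len_es sub_p nth_mem[of i es] by auto
    then show "es ! i \<subseteq> V" using basic by blast
  qed
  have e_es: "e \<notin> set es" using e sub_p by blast
  have meets_once: "x = y" if "i < q" "x \<in> e \<inter> es ! i" "y \<in> e \<inter> es ! i" "q \<ge> 2" for i x y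
  proof (rule ccontr)
    assume "x \<noteq> y"
    then have "hyperpath ?H [x, y] [es ! i]" using that es_sub[of i] by (intro hyperpath_edge) auto
    then have "P 1" using P_intro[of "[x, y]" "[es ! i]"] that by simp
    then show False using least[of 1] that by simp
  qed
  have inner: "e \<inter> es ! j = {}" if j: "0 < j" "Suc j < q" for j
  proof (rule ccontr)
    assume "\<not> ?thesis"
    then obtain c where c: "c \<in> e" "c \<in> es ! j" by blast
    have pj: "hyperpath ?H (take (Suc j) vs) (take j es)"
      using p j len_es by (intro hyperpath_take) auto
    have hd_j: "hd (take (Suc j) vs) \<in> e" using ends len by (simp add: hd_take)
    have last_j: "last (take (Suc j) vs) = vs ! j" using len j by (simp add: take_Suc_conv_app_nth)
    show False
    \<comment> \<open>the initial part of the path ends at \<open>vs ! j\<close>; if \<open>c\<close> is another vertex, it is reached along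
        the next edge\<close>
    proof (cases "c = vs ! j")
      case True
      have "P (length (take j es))"
        by (rule P_intro[OF pj _ hd_j]) (use True last_j c j len_es in auto)
      then show False using least[of j] j len_es by simp
    next
      case False
      have not_in: "c \<notin> set (take (Suc j) vs)"
      proof
        assume "c \<in> set (take (Suc j) vs)"
        then obtain i where "i < Suc j" "c = vs ! i" using len j
          by (auto simp: in_set_conv_nth)
        then have i: "i \<le> j" "c = vs ! i" by auto
        then have "i < j" using False by (cases "i = j") auto
        show False
        proof (cases "i + 2 \<le> j")
          case True
          then show False using far[of i j] inc[of i] j i c by auto
        next
          case False
          then have "j = Suc i" using \<open>i < j\<close> by simp
          then have "vs ! i = vs ! Suc i" using adj[of i] inc[of i] i c j by auto
          then show False using dist len j \<open>j = Suc i\<close> by (simp add: nth_eq_iff_index_eq)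
        qed
      qed
      have "hyperpath ?H (take (Suc j) vs @ [c]) (take j es @ [es ! j])"
      proof (rule hyperpath_extend[OF pj])
        show "es ! j \<notin> set (take j es)"
          using dist j len_es by (auto simp: in_set_conv_nth nth_eq_iff_index_eq)
        show "last (take (Suc j) vs) \<in> es ! j" using last_j inc[of j] j by simp
        show "es ! j \<inter> take j es ! i = {}" if "Suc i < length (take j es)" for i
          using far[of i j] that j len_es by (auto simp: Int_commute)
        show "last (take j es) \<inter> es ! j = {last (take (Suc j) vs)}"
        proof -
          have "length (take j es) = j" using j len_es by simp
          then have "last (take j es) = take j es ! (j - 1)" using j by (subst last_conv_nth) auto
          then have "last (take j es) = es ! (j - 1)" using j by simp
          then show ?thesis using adj[of "j - 1"] j last_j by simp
        qed
      qed (use c es_sub[of j] j not_in in auto)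
      then have "P (length (take j es @ [es ! j]))"
        by (rule P_intro) (use hd_j c len in \<open>auto simp: hd_append take_eq_Nil\<close>)
      then show False using least[of "Suc j"] j len_es by simp
    qed
  qed
  show ?thesis
  proof (cases "q = 1")
    case True
    have "hypercycle G vs [es ! 0, e]"
      using inc[of 0] hd last len True sub sub_p es_sub[of 0] e dist
      unfolding hypercycle_def Let_def by (auto simp: less_Suc_eq numeral_2_eq_2)
    then show ?thesis by blast
  next
    case False
    then have q2: "q \<ge> 2" using q0 by simp
    let ?es = "es @ [e]"
    have nth: "?es ! i = (if i < q then es ! i else e)" if "i \<le> q" for i
      using that len_es by (auto simp: nth_append)
    have first: "e \<inter> es ! 0 = {vs ! 0}"
      using meets_once[of 0 _ "vs ! 0"] hd inc[of 0] q2 by auto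
    have final: "es ! (q - 1) \<inter> e = {vs ! q}"
      using meets_once[of "q - 1" _ "vs ! q"] last inc[of "q - 1"] q2 by auto
    have "hypercycle G vs ?es" unfolding hypercycle_def Let_def
    proof (intro conjI allI impI)
      fix i assume i: "i < length ?es"
      then show "vs ! i \<in> ?es ! i" using inc[of i] last nth[of i] len_es by (cases "i = q") auto
      show "vs ! ((i + 1) mod length ?es) \<in> ?es ! i"
        using i inc[of i] hd nth[of i] len_es by (cases "i = q") auto
      show "?es ! i \<inter> ?es ! ((i + 1) mod length ?es) = {vs ! ((i + 1) mod length ?es)}"
      proof -
        consider "Suc i < q" | "i = q - 1" | "i = q" using i len_es by fastforce
        then show ?thesis
          using adj[of i] first final nth[of i] nth[of "Suc i"] nth[of 0] q2 len_es
          by cases auto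
      qed
      fix j assume j: "j < length ?es"
        "j \<noteq> i \<and> j \<noteq> (i + 1) mod length ?es \<and> i \<noteq> (j + 1) mod length ?es"
      consider "i < q" "j < q" | "i = q" "j < q" | "j = q" "i < q"
        using i j len_es by fastforce
      then show "?es ! i \<inter> ?es ! j = {}"
      proof cases
        case 1
        then have "i + 2 \<le> j \<or> j + 2 \<le> i" using j len_es by auto
        then show ?thesis using far[of i j] far[of j i] 1 nth[of i] nth[of j]
          by (auto simp: Int_commute)
      next
        case 2
        then have "0 < j" "Suc j < q" using j len_es by (auto intro: Suc_lessI)
        then show ?thesis using inner[of j] 2 nth[of i] nth[of j] by auto
      next
        case 3
        then have "0 < i" "Suc i < q" using j len_es by (auto intro: Suc_lessI)
        then show ?thesis using inner[of i] 3 nth[of i] nth[of j] by auto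
      qed
    qed (use len len_es q2 dist e_es sub sub_p e in auto)
    then show ?thesis by blast
  qed
qed

text \<open>A maximal tree grown from \<open>u\<close> inside \<open>T\<close> is all of \<open>T\<close>: an edge that meets it in one vertex
  could be added, one that meets it in more vertices closes a hypercycle, and if it misses a vertex,
  then a hyperpath to this vertex contains an edge leaving it.\<close>

lemma supertree_rtree:
  assumes T: "supertree T" and unif: "uniform k T" and u: "u \<in> verts T" and k: "k \<ge> 2"
  shows "rtree k u (verts T) (edges T)"
proof -
  have hyp: "hypergraph T" and conn: "connected_hg T" and acyc: "\<not> (\<exists>vs es. hypercycle T vs es)"
    using T by (auto simp: supertree_def)
  have finV: "finite (verts T)" and sub: "\<And>e. e \<in> edges T \<Longrightarrow> e \<subseteq> verts T"
    using hyp by (auto simp: hypergraph_def)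
  have finE: "finite (edges T)" using finV sub by (meson Pow_iff finite_Pow_iff finite_subset subsetI)
  define Q where "Q V E \<longleftrightarrow> rtree k u V E \<and> V \<subseteq> verts T \<and> E \<subseteq> edges T" for V E
  have "\<exists>V E. Q V E \<and> (\<forall>V' E'. Q V' E' \<longrightarrow> card E' \<le> card E)"
  proof -
    have "Q {u} {}" using u by (auto simp: Q_def intro: rtree.root)
    moreover have "\<forall>p. Q (fst p) (snd p) \<longrightarrow> card (snd p) < Suc (card (edges T))"
      using finE by (auto simp: Q_def less_Suc_eq_le intro: card_mono)
    ultimately have "\<exists>p. Q (fst p) (snd p) \<and> (\<forall>p'. Q (fst p') (snd p') \<longrightarrow> card (snd p') \<le> card (snd p))"
      using ex_has_greatest_nat[of "\<lambda>p. Q (fst p) (snd p)" "({u}, {})" "\<lambda>p. card (snd p)" "Suc (card (edges T))"]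
      by auto
    then show ?thesis by auto
  qed
  then obtain V E where Q: "Q V E" and max: "\<And>V' E'. Q V' E' \<Longrightarrow> card E' \<le> card E" by blast
  have rt: "rtree k u V E" and VT: "V \<subseteq> verts T" and ET: "E \<subseteq> edges T" using Q by (auto simp: Q_def)
  note basic = rtree_basic[OF rt]
  have no_chord: False if "e \<in> edges T" "e \<notin> E" "a \<in> e" "a \<in> V" "b \<in> e" "b \<in> V" "a \<noteq> b" for e a b
    using hypercycle_of_chord[OF rt k VT ET that(1,2), of a b] acyc that by blast
  have touching: "e \<in> E" if e: "e \<in> edges T" "e \<inter> V \<noteq> {}" for e
  proof (rule ccontr)
    assume "e \<notin> E"
    obtain v where v: "v \<in> e \<inter> V" using e by blast
    have "e \<inter> V = {v}" using no_chord[OF e(1) \<open>e \<notin> E\<close>] v by blast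
    moreover have "card e = k" "finite e"
      using unif e(1) finite_subset[OF sub finV] by (auto simp: uniform_def)
    ultimately have "rtree k u (V \<union> e) (insert e E)" using rtree.grow[OF rt, of v e] v by blast
    then have "Q (V \<union> e) (insert e E)" using VT ET e sub by (auto simp: Q_def)
    then show False using max[of "V \<union> e" "insert e E"] \<open>e \<notin> E\<close> basic by simp
  qed
  have "V = verts T"
  proof (rule ccontr)
    assume "V \<noteq> verts T"
    then obtain w where w: "w \<in> verts T" "w \<notin> V" using VT by blast
    obtain vs es where p: "hyperpath T vs es" "hd vs = u" "last vs = w"
      using conn u w unfolding connected_hg_def by blast
    have len: "length vs = Suc (length es)" using p by (simp add: hyperpath_def)
    have "vs ! i \<in> V" if "i \<le> length es" for i
      using that
    proof (induction i)
      case 0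
      then show ?case using p(2) len basic by (cases vs) auto
    next
      case (Suc i)
      then have i: "vs ! i \<in> es ! i" "vs ! Suc i \<in> es ! i" "es ! i \<in> edges T"
        using p(1) nth_mem[of i es] by (auto simp: hyperpath_def)
      then have "es ! i \<in> E" using touching Suc by auto
      then show ?case using basic i by auto
    qed
    then have "last vs \<in> V" using len by (subst last_conv_nth) auto
    then show False using w p by simp
  qed
  moreover have "E = edges T"
  proof -
    have "e \<inter> V \<noteq> {}" if "e \<in> edges T" for e
    proof -
      have "card e \<ge> 2" using hyp that by (simp add: hypergraph_def)
      then have "e \<noteq> {}" by auto
      then show ?thesis using sub[OF that] \<open>V = verts T\<close> by blast
    qed
    then show ?thesis using touching ET by blast
  qed
  ultimately show ?thesis using rt by simp
qed

section \<open>Isomorphisms and attached trees\<close>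

lemma isomorphicI:
  assumes "inj_on f (verts G)" and "f ` verts G = verts H" and "(`) f ` edges G = edges H"
    and "\<And>e. e \<in> edges G \<Longrightarrow> e \<subseteq> verts G"
  shows "isomorphic G H"
proof -
  have "inj_on ((`) f) (edges G)"
  proof (rule inj_onI)
    fix d e assume de: "d \<in> edges G" "e \<in> edges G" "f ` d = f ` e"
    show "d = e"
      using inj_on_image_eq_iff[OF assms(1) assms(4)[OF de(1)] assms(4)[OF de(2)]] de(3) by simp
  qed
  then show ?thesis using assms unfolding isomorphic_def bij_betw_def by blast
qed

lemma isomorphic_sym:
  assumes "isomorphic G H" and sub: "\<And>e. e \<in> edges G \<Longrightarrow> e \<subseteq> verts G"
  shows "isomorphic H G"
proof -
  obtain f where f: "bij_betw f (verts G) (verts H)" "bij_betw ((`) f) (edges G) (edges H)"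
    using assms(1) by (auto simp: isomorphic_def)
  let ?g = "the_inv_into (verts G) f"
  have g: "bij_betw ?g (verts H) (verts G)" by (rule bij_betw_the_inv_into[OF f(1)])
  have inj: "inj_on f (verts G)" using f(1) by (simp add: bij_betw_def)
  have gf: "?g ` f ` e = e" if "e \<in> edges G" for e
  proof -
    have "?g (f v) = v" if "v \<in> e" for v
      using the_inv_into_f_f[OF inj] sub[OF \<open>e \<in> edges G\<close>] that by blast
    then show ?thesis by (force simp: image_image)
  qed
  have edges: "edges H = (`) f ` edges G" using f(2) by (simp add: bij_betw_def)
  show ?thesis
  proof (rule isomorphicI)
    show "inj_on ?g (verts H)" "?g ` verts H = verts G" using g by (auto simp: bij_betw_def)
    show "(`) ?g ` edges H = edges G" unfolding edges using gf by (force simp: image_iff)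
    show "e \<subseteq> verts H" if "e \<in> edges H" for e
      using that sub f(1) unfolding edges bij_betw_def by blast
  qed
qed

lemma isomorphic_trans:
  assumes "isomorphic G H" and "isomorphic H K"
  shows "isomorphic G K"
proof -
  obtain f h where f: "bij_betw f (verts G) (verts H)" "bij_betw ((`) f) (edges G) (edges H)"
    and h: "bij_betw h (verts H) (verts K)" "bij_betw ((`) h) (edges H) (edges K)"
    using assms by (auto simp: isomorphic_def)
  have "(`) (h \<circ> f) = (`) h \<circ> (`) f" by (auto simp: image_comp)
  then show ?thesis unfolding isomorphic_def
    using bij_betw_trans[OF f(1) h(1)] bij_betw_trans[OF f(2) h(2)] by (intro exI[of _ "h \<circ> f"]) simp
qed

lemma isomorphic_order: "isomorphic G H \<Longrightarrow> order_hg G = order_hg H"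
  using bij_betw_same_card by (auto simp: isomorphic_def)

lemma isomorphic_rho:
  assumes G: "hypergraph G" and "isomorphic G H"
  shows "rho G = rho H"
proof -
  obtain f where f: "bij_betw f (verts G) (verts H)" "bij_betw ((`) f) (edges G) (edges H)"
    using assms by (auto simp: isomorphic_def)
  have inj: "inj_on f (verts G)" using f by (simp add: bij_betw_def)
  have sub: "\<And>e. e \<in> edges G \<Longrightarrow> e \<subseteq> verts G" using G by (simp add: hypergraph_def)
  have adj: "adjacency H (f i) (f j) = adjacency G i j" if ij: "i \<in> verts G" "j \<in> verts G" for i j
  proof -
    have mem: "f v \<in> f ` e \<longleftrightarrow> v \<in> e" if "e \<in> edges G" "v \<in> verts G" for e v
      using inj_on_image_mem_iff[OF inj] sub that by blast
    let ?D = "{e \<in> edges G. i \<in> e \<and> j \<in> e}"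
    have "edges H = (`) f ` edges G" using f(2) by (simp add: bij_betw_def)
    have *: "{e \<in> edges H. f i \<in> e \<and> f j \<in> e} = (`) f ` ?D"
    proof (intro equalityI subsetI)
      fix e' assume "e' \<in> {e \<in> edges H. f i \<in> e \<and> f j \<in> e}"
      then obtain e where "e \<in> edges G" "e' = f ` e" "f i \<in> f ` e" "f j \<in> f ` e"
        using \<open>edges H = (`) f ` edges G\<close> by auto
      then show "e' \<in> (`) f ` ?D" using mem[of e i] mem[of e j] ij by simp
    qed (use \<open>edges H = (`) f ` edges G\<close> in auto)
    have **: "inj_on ((`) f) ?D" using f(2) by (auto simp: bij_betw_def inj_on_def)
    have "(\<Sum>e\<in>{e \<in> edges H. f i \<in> e \<and> f j \<in> e}. 1 / (real (card e) - 1))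
        = (\<Sum>e\<in>?D. 1 / (real (card (f ` e)) - 1))"
      unfolding * by (simp add: sum.reindex[OF **])
    also have "\<dots> = (\<Sum>e\<in>?D. 1 / (real (card e) - 1))"
      using sub by (intro sum.cong refl) (auto simp: card_image inj_on_subset[OF inj])
    finally show ?thesis using inj ij by (auto simp: adjacency_def inj_on_eq_iff)
  qed
  obtain vs where vs: "distinct vs" "set vs = verts G"
    using G finite_distinct_list[of "verts G"] by (auto simp: hypergraph_def)
  have "adjacency_mat H (map f vs) = adjacency_mat G vs"
    using adj vs(2) nth_mem[of _ vs] by (intro eq_matI) (simp_all add: adjacency_mat_def)
  moreover have "rho H = spectral_radius (adjacency_mat H (map f vs))"
    using f(1) vs by (intro rho_eq) (auto simp: distinct_map bij_betw_def)
  ultimately show ?thesis using rho_eq[OF vs] by simp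
qed

text \<open>The embedding of the tree that the definition of \<^const>\<open>attach\<close> uses.\<close>

definition glue :: "'a \<Rightarrow> 'b \<Rightarrow> 'b \<Rightarrow> 'a + 'b" where
  "glue w u x = (if x = u then Inl w else Inr x)"

lemma inj_glue: "inj (glue w u)"
  by (auto simp: inj_def glue_def)

lemma glue_root [simp]: "glue w u u = Inl w"
  by (simp add: glue_def)

lemma verts_attach: "verts (attach H w T u) = Inl ` verts H \<union> glue w u ` verts T"
  and edges_attach: "edges (attach H w T u) = (`) Inl ` edges H \<union> (`) (glue w u) ` edges T"
  unfolding glue_def[abs_def] by (simp_all add: attach_def Let_def)

lemma sub_attach:
  assumes sub: "\<And>e. e \<in> edges H \<Longrightarrow> e \<subseteq> verts H" "\<And>e. e \<in> edges T \<Longrightarrow> e \<subseteq> verts T"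
    and "e \<in> edges (attach H w T u)"
  shows "e \<subseteq> verts (attach H w T u)"
  using assms(3) unfolding edges_attach verts_attach
proof (elim UnE imageE)
  fix d assume "e = Inl ` d" "d \<in> edges H"
  then show "e \<subseteq> Inl ` verts H \<union> glue w u ` verts T" using sub(1)[of d] by (simp add: image_mono le_supI1)
next
  fix d assume "e = glue w u ` d" "d \<in> edges T"
  then show "e \<subseteq> Inl ` verts H \<union> glue w u ` verts T"
    using sub(2)[of d] by (simp add: image_mono le_supI2)
qed

lemma attach_cong_isomorphic:
  assumes f: "inj_on f (verts H)" "f ` verts H = verts H'" "(`) f ` edges H = edges H'"
    and h: "inj_on h (verts T)" "h ` verts T = verts T'" "(`) h ` edges T = edges T'"
    and sub: "\<And>e. e \<in> edges H \<Longrightarrow> e \<subseteq> verts H" "\<And>e. e \<in> edges T \<Longrightarrow> e \<subseteq> verts T"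
    and w: "w \<in> verts H" "f w = w'" and u: "u \<in> verts T" "h u = u'"
  shows "isomorphic (attach H w T u) (attach H' w' T' u')"
proof -
  define F where "F x = (case x of Inl c \<Rightarrow> Inl (f c) | Inr t \<Rightarrow> Inr (h t))" for x
  have Fg: "F (glue w u x) = glue w' u' (h x)" if "x \<in> verts T" for x
    using w u that h(1) by (auto simp: F_def glue_def inj_on_def)
  have FI: "F (Inl x) = Inl (f x)" for x by (simp add: F_def)
  have img_g: "F ` glue w u ` S = glue w' u' ` h ` S" if "S \<subseteq> verts T" for S
    using that Fg by (force simp: image_image intro!: image_cong)
  have img_I: "F ` Inl ` S = Inl ` f ` S" for S by (simp add: image_image FI)
  show ?thesis
  proof (rule isomorphicI[of F])
    show "F ` verts (attach H w T u) = verts (attach H' w' T' u')"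
      by (simp only: verts_attach image_Un img_I img_g[OF subset_refl] f h)
    have "(`) F ` (`) (glue w u) ` edges T = (`) (glue w' u') ` (`) h ` edges T"
      unfolding image_image[of "(`) F"] image_image[of "(`) (glue w' u')"]
      by (intro image_cong refl img_g sub)
    moreover have "(`) F ` (`) Inl ` edges H = (`) Inl ` (`) f ` edges H"
      unfolding image_image[of "(`) F"] image_image[of "(`) Inl"] by (simp only: img_I)
    ultimately show "(`) F ` edges (attach H w T u) = edges (attach H' w' T' u')"
      by (simp only: edges_attach image_Un f h)
    show "e \<subseteq> verts (attach H w T u)" if "e \<in> edges (attach H w T u)" for e
      by (rule sub_attach[OF sub that])
    show "inj_on F (verts (attach H w T u))"
    proof (rule inj_onI)
      fix x y assume xy: "x \<in> verts (attach H w T u)" "y \<in> verts (attach H w T u)" "F x = F y"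
      have split: "(\<exists>c\<in>verts H. x = Inl c) \<or> (\<exists>t\<in>verts T. t \<noteq> u \<and> x = Inr t)"
        if "x \<in> verts (attach H w T u)" for x
        using that w by (auto simp: verts_attach glue_def split: if_splits)
      show "x = y" using split[OF xy(1)] split[OF xy(2)] xy(3)
        by (auto simp: F_def dest: inj_onD[OF f(1)] inj_onD[OF h(1)])
    qed
  qed
qed

lemma hypergraph_attach:
  assumes H: "hypergraph H" and T: "hypergraph T"
  shows "hypergraph (attach H w T u)"
proof -
  have "card (Inl ` e :: ('a + 'b) set) = card e" for e :: "'a set" by (simp add: card_image)
  moreover have "card (glue w u ` e) = card e" for e
    by (rule card_image) (rule inj_on_subset[OF inj_glue], simp)
  moreover have "e \<subseteq> verts (attach H w T u)" if "e \<in> edges (attach H w T u)" for e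
    by (rule sub_attach[OF _ _ that]) (use assms in \<open>auto simp: hypergraph_def\<close>)
  ultimately show ?thesis
    using assms unfolding hypergraph_def edges_attach verts_attach by (simp add: ball_Un)
qed

lemma uniform_attach:
  assumes "uniform k H" and "uniform k T"
  shows "uniform k (attach H w T u)"
proof -
  have "card (Inl ` e :: ('a + 'b) set) = card e" for e :: "'a set" by (simp add: card_image)
  moreover have "card (glue w u ` e) = card e" for e
    by (rule card_image) (rule inj_on_subset[OF inj_glue], simp)
  ultimately show ?thesis using assms unfolding uniform_def edges_attach by auto
qed

lemma order_attach:
  assumes "finite (verts H)" and "finite (verts T)" and "w \<in> verts H" and "u \<in> verts T"
  shows "order_hg (attach H w T u) + 1 = order_hg H + order_hg T"
proof -
  have "Inl ` verts H \<inter> glue w u ` verts T = {Inl w}"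
    using assms(3,4) by (auto simp: glue_def)
  moreover have "card (glue w u ` verts T) = order_hg T"
    by (rule card_image) (rule inj_on_subset[OF inj_glue], simp)
  ultimately show ?thesis
    using card_Un_Int[of "Inl ` verts H" "glue w u ` verts T"] assms(1,2)
    by (simp add: verts_attach card_image)
qed

lemma edge_connected_attach:
  assumes H: "edge_connected (verts H) (edges H)" and T: "edge_connected (verts T) (edges T)"
    and w: "w \<in> verts H" and u: "u \<in> verts T"
    and sub: "\<And>e. e \<in> edges H \<Longrightarrow> e \<subseteq> verts H" "\<And>e. e \<in> edges T \<Longrightarrow> e \<subseteq> verts T"
  shows "edge_connected (verts (attach H w T u)) (edges (attach H w T u))"
  unfolding edge_connected_def
proof (intro allI impI, elim conjE)
  fix S assume S: "S \<subseteq> verts (attach H w T u)" "S \<noteq> {}"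
    and closed: "\<forall>e\<in>edges (attach H w T u). e \<inter> S \<noteq> {} \<longrightarrow> e \<subseteq> S"
  define SH ST where "SH = {c \<in> verts H. Inl c \<in> S}" and "ST = {t \<in> verts T. glue w u t \<in> S}"
  have closedH: "e \<subseteq> SH" if "e \<in> edges H" "e \<inter> SH \<noteq> {}" for e
  proof -
    have "Inl ` e \<inter> S \<noteq> {}" using that by (auto simp: SH_def)
    moreover have "Inl ` e \<in> edges (attach H w T u)" using that by (simp add: edges_attach)
    ultimately have "Inl ` e \<subseteq> S" using closed[rule_format, of "Inl ` e"] by simp
    then show ?thesis using sub(1)[OF that(1)] by (auto simp: SH_def)
  qed
  have closedT: "e \<subseteq> ST" if "e \<in> edges T" "e \<inter> ST \<noteq> {}" for e
  proof -
    have "glue w u ` e \<inter> S \<noteq> {}" using that by (auto simp: ST_def)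
    moreover have "glue w u ` e \<in> edges (attach H w T u)" using that by (simp add: edges_attach)
    ultimately have "glue w u ` e \<subseteq> S" using closed[rule_format, of "glue w u ` e"] by simp
    then show ?thesis using sub(2)[OF that(1)] by (auto simp: ST_def)
  qed
  have SH: "SH \<noteq> {} \<Longrightarrow> SH = verts H"
    using H[unfolded edge_connected_def, rule_format, of SH] closedH by (auto simp: SH_def)
  have ST: "ST \<noteq> {} \<Longrightarrow> ST = verts T"
    using T[unfolded edge_connected_def, rule_format, of ST] closedT by (auto simp: ST_def)
  obtain z where "z \<in> S" using S(2) by blast
  then have "(\<exists>c. c \<in> SH) \<or> (\<exists>t. t \<in> ST)"
    using S(1) by (auto simp: verts_attach SH_def ST_def)
  then have "w \<in> SH \<or> u \<in> ST" using SH ST w u by blast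
  then have "Inl w \<in> S" by (auto simp: SH_def ST_def)
  then have "SH \<noteq> {}" "ST \<noteq> {}" using w u by (auto simp: SH_def ST_def)
  then have "SH = verts H" "ST = verts T" using SH ST by auto
  then have "verts (attach H w T u) \<subseteq> S" by (auto simp: verts_attach SH_def ST_def)
  then show "S = verts (attach H w T u)" using S(1) by simp
qed

text \<open>An edge of the tree is never an edge of \<open>H\<close>, since it has a vertex other than \<open>u\<close>. So the two
  parts contribute separately, and both do so only at the common vertex.\<close>

lemma nbr_sum_attach:
  assumes fin: "finite (edges H)" "finite (edges T)"
    and sub: "\<And>e. e \<in> edges T \<Longrightarrow> card e \<ge> 2"
  shows "c \<noteq> w \<Longrightarrow> nbr_sum (edges (attach H w T u)) x (Inl c) = nbr_sum (edges H) (x \<circ> Inl) c"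
    and "t \<noteq> u \<Longrightarrow> nbr_sum (edges (attach H w T u)) x (Inr t) = nbr_sum (edges T) (x \<circ> glue w u) t"
    and "nbr_sum (edges (attach H w T u)) x (Inl w)
      = nbr_sum (edges H) (x \<circ> Inl) w + nbr_sum (edges T) (x \<circ> glue w u) u"
proof -
  let ?EH = "(`) Inl ` edges H :: ('a + 'b) set set" and ?ET = "(`) (glue w u) ` edges T"
  have "?EH \<inter> ?ET = {}"
  proof (rule ccontr)
    assume "\<not> ?thesis"
    then obtain d e where de: "e \<in> edges T" "Inl ` d = glue w u ` e" by blast
    have "e \<subseteq> {u}"
    proof
      fix t assume "t \<in> e"
      then have "glue w u t \<in> Inl ` d" using de by blast
      then show "t \<in> {u}" by (auto simp: glue_def split: if_splits)
    qed
    then have "card e \<le> 1" using card_mono[of "{u}" e] by simp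
    then show False using sub[OF de(1)] by simp
  qed
  then have un: "nbr_sum (edges (attach H w T u)) x v = nbr_sum ?EH x v + nbr_sum ?ET x v" for v
    unfolding edges_attach using fin by (intro nbr_sum_union_disjoint) auto
  have I: "nbr_sum ?EH x (Inl c) = nbr_sum (edges H) (x \<circ> Inl) c" for c
    by (rule nbr_sum_image) simp
  have g: "nbr_sum ?ET x (glue w u t) = nbr_sum (edges T) (x \<circ> glue w u) t" for t
    by (rule nbr_sum_image) (rule inj_glue)
  show "nbr_sum (edges (attach H w T u)) x (Inl w)
      = nbr_sum (edges H) (x \<circ> Inl) w + nbr_sum (edges T) (x \<circ> glue w u) u"
    using un[of "Inl w"] I[of w] g[of u] by simp
  show "nbr_sum (edges (attach H w T u)) x (Inl c) = nbr_sum (edges H) (x \<circ> Inl) c" if "c \<noteq> w"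
  proof -
    have "nbr_sum ?ET x (Inl c) = 0"
      using that by (intro nbr_sum_eq_0) (auto simp: glue_def split: if_splits)
    then show ?thesis using un[of "Inl c"] I by simp
  qed
  show "nbr_sum (edges (attach H w T u)) x (Inr t) = nbr_sum (edges T) (x \<circ> glue w u) t" if "t \<noteq> u"
  proof -
    have "nbr_sum ?EH x (Inr t) = 0" by (intro nbr_sum_eq_0) auto
    moreover have "glue w u t = Inr t" using that by (simp add: glue_def)
    ultimately show ?thesis using un[of "Inr t"] g[of t] by simp
  qed
qed

section \<open>The path as a rooted tree\<close>

lemma path_hg_rpath:
  assumes "k \<ge> 2"
  shows "rpath k 0 (verts (path_hg k s)) (edges (path_hg k s)) (s * (k - 1))"
proof (induction s)
  case 0
  show ?case using rpath.root[of k "0::nat"] by (simp add: path_hg_def)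
next
  case (Suc s)
  let ?e = "{s * (k - 1)..(s + 1) * (k - 1)}"
  have "rpath k 0 (verts (path_hg k s) \<union> ?e) (insert ?e (edges (path_hg k s))) (Suc s * (k - 1))"
    by (rule rpath.grow[OF Suc]) (use assms in \<open>auto simp: path_hg_def\<close>)
  moreover have "verts (path_hg k s) \<union> ?e = verts (path_hg k (Suc s))"
    by (auto simp: path_hg_def)
  moreover have "insert ?e (edges (path_hg k s)) = edges (path_hg k (Suc s))"
    by (simp add: path_hg_def lessThan_Suc)
  ultimately show ?case by simp
qed

lemma card_edges_path_hg:
  assumes "k \<ge> 2"
  shows "card (edges (path_hg k s)) = s"
proof -
  have "inj_on (\<lambda>i. {i * (k - 1)..(i + 1) * (k - 1)}) {..<s}"
  proof (rule inj_onI)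
    fix i j assume "{i * (k - 1)..(i + 1) * (k - 1)} = {j * (k - 1)..(j + 1) * (k - 1)}"
    then have "i * (k - 1) = j * (k - 1)" by (simp add: Icc_eq_Icc)
    then show "i = j" using assms by simp
  qed
  then show ?thesis by (simp add: path_hg_def card_image)
qed

lemma rpath_isomorphism:
  assumes "rpath k u V E t" and "k \<ge> 2"
  shows "\<exists>f. inj_on f V \<and> f u = (0::nat) \<and> f t = card E * (k - 1) \<and>
    f ` V = verts (path_hg k (card E)) \<and> (`) f ` E = edges (path_hg k (card E))"
  using assms(1)
proof induction
  case root
  show ?case by (auto simp: path_hg_def)
next
  case (grow V E t e t')
  note basic = rtree_basic[OF conjunct1[OF rpath_rtree[OF grow.hyps(1)]]]
  have tV: "t \<in> V" using grow.hyps by auto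
  have enE: "e \<notin> E" using basic not_subset_if_meets_once[OF grow.hyps(2,4) assms(2)] by blast
  let ?m = "card E"
  obtain f where f: "inj_on f V" "f u = 0" "f t = ?m * (k - 1)"
    "f ` V = verts (path_hg k ?m)" "(`) f ` E = edges (path_hg k ?m)" using grow.IH by blast
  let ?W = "e - {t} - {t'}" and ?I = "{?m * (k - 1)<..<Suc ?m * (k - 1)}"
  have "card ?W = card ?I"
    using grow.hyps by (auto simp: card_Diff_singleton_if)
  moreover have "finite ?W" "finite ?I" using grow.hyps by simp_all
  ultimately obtain p where p: "bij_betw p ?W ?I" using finite_same_card_bij[of ?W ?I] by metis
  define g where "g v = (if v \<in> V then f v else if v = t' then Suc ?m * (k - 1) else p v)" for v
  have V: "verts (path_hg k ?m) = {0..?m * (k - 1)}" by (simp add: path_hg_def)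
  have We: "e = insert t (insert t' ?W)" using grow.hyps by blast
  have disj: "?W \<inter> V = {}" "t' \<notin> V" using grow.hyps by auto
  have gV: "g ` S = f ` S" if "S \<subseteq> V" for S using that by (auto simp: g_def intro!: image_cong)
  have gW: "g ` ?W = ?I"
  proof -
    have "g ` ?W = p ` ?W" using disj by (intro image_cong) (auto simp: g_def)
    then show ?thesis using p by (simp add: bij_betw_def)
  qed
  have gt': "g t' = Suc ?m * (k - 1)" using disj by (simp add: g_def)
  have gt: "g t = ?m * (k - 1)" using f tV by (simp add: g_def)
  have km: "?m * (k - 1) < Suc ?m * (k - 1)" using assms(2) by simp
  have ge: "g ` e = {?m * (k - 1)..(?m + 1) * (k - 1)}"
  proof -
    have "g ` e = insert (g t) (insert (g t') (g ` ?W))" using We by (metis image_insert)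
    also have "\<dots> = {?m * (k - 1)..(?m + 1) * (k - 1)}" unfolding gt gt' gW using km by auto
    finally show ?thesis .
  qed
  have inj: "inj_on g (V \<union> e)"
  proof -
    have U: "V \<union> e = V \<union> insert t' ?W" using We tV by blast
    have injV: "inj_on g V"
      by (rule inj_on_cong[THEN iffD1, OF _ f(1)]) (simp add: g_def)
    have "inj_on p ?W" using p by (simp add: bij_betw_def)
    moreover have "g v = p v" if "v \<in> ?W" for v using disj that by (auto simp: g_def)
    ultimately have injW: "inj_on g ?W" using inj_on_cong[of ?W g p] by blast
    have "g t' \<notin> g ` ?W" unfolding gW gt' by simp
    then have inj': "inj_on g (insert t' ?W)" using injW unfolding inj_on_insert by blast
    have "g ` V = {0..?m * (k - 1)}" using gV[of V] f(4) V by simp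
    moreover have "g ` insert t' ?W \<subseteq> {?m * (k - 1)<..}"
      unfolding image_insert gW gt' using km by auto
    ultimately have "g ` V \<inter> g ` insert t' ?W = {}" by auto
    then show ?thesis unfolding U inj_on_Un using injV inj' by blast
  qed
  have "g ` (V \<union> e) = verts (path_hg k (Suc ?m))"
  proof -
    have "{0..?m * (k - 1)} \<union> {?m * (k - 1)..(?m + 1) * (k - 1)} = {0..(?m + 1) * (k - 1)}"
      by (rule ivl_disj_un_two_touch) simp_all
    then show ?thesis unfolding image_Un ge gV[OF subset_refl] f(4) by (simp add: path_hg_def)
  qed
  moreover have "(`) g ` insert e E = edges (path_hg k (Suc ?m))"
  proof -
    have "(`) g ` E = (`) f ` E" by (intro image_cong refl gV) (simp add: basic)
    then show ?thesis using ge f(5) by (simp add: path_hg_def lessThan_Suc)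
  qed
  moreover have "g u = 0" using f basic by (simp add: g_def)
  ultimately show ?case using inj gt' basic enE by (intro exI[of _ g]) simp
qed

section \<open>The hypercycle\<close>

definition nxt :: "nat \<Rightarrow> nat \<Rightarrow> nat" where
  "nxt g i = (if i = g then 1 else i + 1)"

lemma cycle_edge_nxt: "cycle_edge k g i = {Joint i, Joint (nxt g i)} \<union> Inner i ` {1..k - 2}"
  by (simp add: cycle_edge_def nxt_def)

lemma nxt_in: "i \<in> {1..g} \<Longrightarrow> nxt g i \<in> {1..g}"
  by (auto simp: nxt_def)

lemma nxt_neq: "g \<ge> 2 \<Longrightarrow> nxt g i \<noteq> i"
  by (auto simp: nxt_def)

lemma nxt_eq_1: "i \<in> {1..g} \<Longrightarrow> nxt g i = 1 \<longleftrightarrow> i = g"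
  by (auto simp: nxt_def)

lemma inj_nxt: "inj_on (nxt g) {1..g}"
  by (auto simp: nxt_def inj_on_def split: if_splits)

lemma bij_nxt: "bij_betw (nxt g) {1..g} {1..g}"
proof -
  have "nxt g ` {1..g} \<subseteq> {1..g}" using nxt_in by blast
  then have "nxt g ` {1..g} = {1..g}" by (rule endo_inj_surj[OF finite_atLeastAtMost _ inj_nxt])
  then show ?thesis using inj_nxt by (simp add: bij_betw_def)
qed

lemma ex_nxt: "i \<in> {1..g} \<Longrightarrow> \<exists>h\<in>{1..g}. i = nxt g h"
  using bij_nxt[of g] by (auto simp: bij_betw_def image_def)

lemma sum_nxt: "(\<Sum>i\<in>{1..g}. f (nxt g i)) = sum f {1..g}"
  by (rule sum.reindex_bij_betw[OF bij_nxt])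

lemma Joint_in_cycle_edge: "Joint a \<in> cycle_edge k g i \<longleftrightarrow> a = i \<or> a = nxt g i"
  and Inner_in_cycle_edge: "Inner a j \<in> cycle_edge k g i \<longleftrightarrow> a = i \<and> j \<in> {1..k - 2}"
  by (auto simp: cycle_edge_nxt)

lemma Joint_in_cycle: "Joint i \<in> verts (cycle_hg k g) \<longleftrightarrow> i \<in> {1..g}"
  and Inner_in_cycle: "Inner i j \<in> verts (cycle_hg k g) \<longleftrightarrow> i \<in> {1..g} \<and> j \<in> {1..k - 2}"
  by (auto simp: cycle_hg_def)

lemma edges_cycle: "edges (cycle_hg k g) = cycle_edge k g ` {1..g}"
  by (simp add: cycle_hg_def)

lemma cycle_vertex_cases:
  assumes "v \<in> verts (cycle_hg k g)"
  obtains (Joint) i where "v = Joint i" "i \<in> {1..g}"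
  | (Inner) i j where "v = Inner i j" "i \<in> {1..g}" "j \<in> {1..k - 2}"
  using assms by (auto simp: cycle_hg_def)

lemma cycle_edge_sub: "e \<in> edges (cycle_hg k g) \<Longrightarrow> e \<subseteq> verts (cycle_hg k g)"
  by (auto simp: edges_cycle cycle_edge_nxt Joint_in_cycle Inner_in_cycle nxt_def)

lemma inj_cycle_edge:
  assumes "k \<ge> 3"
  shows "inj_on (cycle_edge k g) A"
proof (rule inj_onI)
  fix i j assume eq: "cycle_edge k g i = cycle_edge k g j"
  have "Inner i 1 \<in> cycle_edge k g i" using assms by (simp add: Inner_in_cycle_edge)
  then have "Inner i 1 \<in> cycle_edge k g j" unfolding eq .
  then show "i = j" by (simp add: Inner_in_cycle_edge)
qed

lemma sum_cycle_edge:
  assumes "g \<ge> 2"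
  shows "sum z (cycle_edge k g i)
    = z (Joint i) + z (Joint (nxt g i)) + (\<Sum>j\<in>{1..k - 2}. z (Inner i j))"
proof -
  have "sum z (cycle_edge k g i) = sum z {Joint i, Joint (nxt g i)} + sum z (Inner i ` {1..k - 2})"
    unfolding cycle_edge_nxt by (rule sum.union_disjoint) auto
  also have "sum z (Inner i ` {1..k - 2}) = (\<Sum>j\<in>{1..k - 2}. z (Inner i j))"
    by (simp add: sum.reindex inj_on_def)
  also have "sum z {Joint i, Joint (nxt g i)} = z (Joint i) + z (Joint (nxt g i))"
    using nxt_neq[OF assms, of i] by simp
  finally show ?thesis .
qed

lemma nbr_sum_Inner:
  assumes "i \<in> {1..g}" and "j \<in> {1..k - 2}"
  shows "nbr_sum (edges (cycle_hg k g)) z (Inner i j) = sum z (cycle_edge k g i) - z (Inner i j)"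
proof -
  have "{e. e \<in> edges (cycle_hg k g) \<and> Inner i j \<in> e} = {cycle_edge k g i}"
    using assms by (auto simp: edges_cycle Inner_in_cycle_edge)
  then show ?thesis by (simp add: nbr_sum_def)
qed

lemma nbr_sum_Joint:
  assumes "k \<ge> 3" and "g \<ge> 2" and i: "i \<in> {1..g}"
  shows "nbr_sum (edges (cycle_hg k g)) z (Joint (nxt g i))
    = sum z (cycle_edge k g i) + sum z (cycle_edge k g (nxt g i)) - 2 * z (Joint (nxt g i))"
proof -
  have "{e. e \<in> edges (cycle_hg k g) \<and> Joint (nxt g i) \<in> e}
      = {cycle_edge k g i, cycle_edge k g (nxt g i)}"
  proof -
    have "{h \<in> {1..g}. Joint (nxt g i) \<in> cycle_edge k g h} = {i, nxt g i}"
      using i nxt_in[OF i] inj_on_eq_iff[OF inj_nxt i] by (auto simp: Joint_in_cycle_edge)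
    moreover have "{e. e \<in> cycle_edge k g ` {1..g} \<and> Joint (nxt g i) \<in> e}
        = cycle_edge k g ` {h \<in> {1..g}. Joint (nxt g i) \<in> cycle_edge k g h}" by blast
    ultimately show ?thesis by (simp add: edges_cycle)
  qed
  moreover have "cycle_edge k g i \<noteq> cycle_edge k g (nxt g i)"
    using inj_onD[OF inj_cycle_edge[OF assms(1), of g UNIV], of i "nxt g i"] nxt_neq[OF assms(2), of i]
    by force
  ultimately show ?thesis by (simp add: nbr_sum_def)
qed

lemma card_cycle_edge:
  assumes "k \<ge> 3" and "g \<ge> 2"
  shows "card (cycle_edge k g i) = k"
proof -
  have "card (cycle_edge k g i) = (\<Sum>v\<in>cycle_edge k g i. 1)" by simp
  then show ?thesis unfolding sum_cycle_edge[OF assms(2)] using assms(1) by simp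
qed

lemma order_cycle:
  assumes "k \<ge> 3"
  shows "order_hg (cycle_hg k g) = g * (k - 1)"
proof -
  have "order_hg (cycle_hg k g) = card (Joint ` {1..g}) +
      card ((\<lambda>(i, j). Inner i j) ` ({1..g} \<times> {1..k - 2}))"
    by (simp add: cycle_hg_def, rule card_Un_disjoint) auto
  also have "card (Joint ` {1..g}) = g" by (simp add: card_image inj_on_def)
  also have "card ((\<lambda>(i, j). Inner i j) ` ({1..g} \<times> {1..k - 2})) = g * (k - 2)"
    by (subst card_image) (auto simp: inj_on_def)
  also have "g + g * (k - 2) = g * (k - 1)"
  proof -
    have "k - 1 = Suc (k - 2)" using assms by simp
    then show ?thesis by simp
  qed
  finally show ?thesis .
qed

lemma hypergraph_cycle:
  assumes "k \<ge> 3" and "g \<ge> 2"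
  shows "hypergraph (cycle_hg k g)" and "uniform k (cycle_hg k g)"
proof -
  have card: "card e = k" if "e \<in> edges (cycle_hg k g)" for e
    using that card_cycle_edge[OF assms] by (auto simp: edges_cycle)
  then show "uniform k (cycle_hg k g)" by (simp add: uniform_def)
  have "finite (verts (cycle_hg k g))" "verts (cycle_hg k g) \<noteq> {}"
    using assms by (auto simp: cycle_hg_def)
  then show "hypergraph (cycle_hg k g)"
    using card cycle_edge_sub assms by (auto simp: hypergraph_def)
qed

lemma edge_connected_cycle:
  assumes "k \<ge> 3" and "g \<ge> 2"
  shows "edge_connected (verts (cycle_hg k g)) (edges (cycle_hg k g))"
  unfolding edge_connected_def
proof (intro allI impI, elim conjE)
  fix S assume S: "S \<subseteq> verts (cycle_hg k g)" "S \<noteq> {}"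
    and closed: "\<forall>e\<in>edges (cycle_hg k g). e \<inter> S \<noteq> {} \<longrightarrow> e \<subseteq> S"
  have edge: "cycle_edge k g i \<subseteq> S" if "i \<in> {1..g}" "v \<in> S" "v \<in> cycle_edge k g i" for i v
    using closed[rule_format, of "cycle_edge k g i"] that by (auto simp: edges_cycle)
  have next_joint: "Joint (nxt g i) \<in> S" if "i \<in> {1..g}" "Joint i \<in> S" for i
    using edge[OF that] by (auto simp: cycle_edge_nxt)
  have up: "Joint b \<in> S" if "a \<le> b" "1 \<le> a" "b \<le> g" "Joint a \<in> S" for a b
    using that
  proof (induction b rule: dec_induct)
    case (step b)
    then show ?case using next_joint[of b] by (auto simp: nxt_def split: if_splits)
  qed
  obtain v where v: "v \<in> S" using S by blast
  then have "v \<in> verts (cycle_hg k g)" using S(1) by blast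
  then have "\<exists>i\<in>{1..g}. Joint i \<in> S"
  proof (cases rule: cycle_vertex_cases)
    case (Inner i j)
    then have "cycle_edge k g i \<subseteq> S" using edge[of i v] v by (simp add: Inner_in_cycle_edge)
    then show ?thesis using Inner by (auto simp: cycle_edge_nxt)
  qed (use v in auto)
  then have "Joint g \<in> S" using up[of _ g] by auto
  then have "Joint 1 \<in> S" using next_joint[of g] assms by (simp add: nxt_def)
  then have joints: "Joint i \<in> S" if "i \<in> {1..g}" for i using up[of 1 i] that by simp
  have edges: "cycle_edge k g i \<subseteq> S" if "i \<in> {1..g}" for i
    using edge[OF that joints[OF that]] by (simp add: Joint_in_cycle_edge)
  have "verts (cycle_hg k g) \<subseteq> S"
  proof
    fix v assume "v \<in> verts (cycle_hg k g)"
    then show "v \<in> S"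
    proof (cases rule: cycle_vertex_cases)
      case (Inner i j)
      then show ?thesis using edges[of i] Inner_in_cycle_edge[of i j k g i] by blast
    qed (use joints in simp)
  qed
  then show "S = verts (cycle_hg k g)" using S(1) by simp
qed

text \<open>Summing the inequalities over the joints and over the inner vertices gives two linear
  inequalities between the total value \<open>X\<close> of the joints and the total value \<open>Y\<close> of the inner
  vertices, one of them strict. Eliminating \<open>Y\<close> gives the claim.\<close>

lemma above_cycle_if_strict_supersolution:
  assumes k: "k \<ge> 3" and g: "g \<ge> 2"
    and pos: "\<And>v. v \<in> verts (cycle_hg k g) \<Longrightarrow> z v > 0"
    and le: "\<And>v. v \<in> verts (cycle_hg k g) \<Longrightarrow> nbr_sum (edges (cycle_hg k g)) z v \<le> \<rho> * z v"
    and w: "w \<in> verts (cycle_hg k g)" "nbr_sum (edges (cycle_hg k g)) z w < \<rho> * z w"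
  shows "path_recursion k \<rho>"
proof -
  let ?I = "{1..g}" and ?J = "{1..k - 2}"
  define slack where "slack v = \<rho> * z v - nbr_sum (edges (cycle_hg k g)) z v" for v
  define S where "S i = sum z (cycle_edge k g i)" for i
  define X where "X = (\<Sum>i\<in>?I. z (Joint i))"
  define Y where "Y = (\<Sum>i\<in>?I. \<Sum>j\<in>?J. z (Inner i j))"
  have X: "X > 0" unfolding X_def using pos g by (intro sum_pos) (auto simp: Joint_in_cycle)
  have sumS: "sum S ?I = 2 * X + Y"
    unfolding S_def sum_cycle_edge[OF g] sum.distrib X_def Y_def
    using sum_nxt[of "\<lambda>i. z (Joint i)" g] by simp
  define DJ where "DJ = (\<Sum>i\<in>?I. slack (Joint (nxt g i)))"
  define DI where "DI = (\<Sum>i\<in>?I. \<Sum>j\<in>?J. slack (Inner i j))"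
  have "DJ = (\<Sum>i\<in>?I. (\<rho> + 2) * z (Joint (nxt g i)) - S i - S (nxt g i))"
    unfolding DJ_def slack_def S_def
    by (intro sum.cong refl) (simp add: nbr_sum_Joint[OF k g] algebra_simps)
  also have "\<dots> = (\<rho> + 2) * X - sum S ?I - sum S ?I"
    unfolding X_def sum_subtractf sum_nxt[of S] sum_distrib_left[symmetric]
      sum_nxt[of "\<lambda>i. z (Joint i)"] ..
  finally have DJ: "DJ = (\<rho> - 2) * X - 2 * Y" unfolding sumS by (simp add: algebra_simps)
  have "DI = (\<Sum>i\<in>?I. \<Sum>j\<in>?J. (\<rho> + 1) * z (Inner i j) - S i)"
    unfolding DI_def slack_def S_def
    by (intro sum.cong refl) (simp add: nbr_sum_Inner algebra_simps)
  also have "\<dots> = (\<rho> + 1) * Y - real (k - 2) * sum S ?I"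
    unfolding Y_def by (simp add: sum_subtractf sum_distrib_left)
  finally have DI: "DI = (\<rho> - real k + 3) * Y - 2 * (real k - 2) * X"
    unfolding sumS using k by (simp add: algebra_simps)
  have nn: "slack v \<ge> 0" if "v \<in> verts (cycle_hg k g)" for v using le[OF that] by (simp add: slack_def)
  have nnJ: "slack (Joint (nxt g i)) \<ge> 0" if "i \<in> ?I" for i
    using nn nxt_in[OF that] by (simp add: Joint_in_cycle)
  have nnI: "slack (Inner i j) \<ge> 0" if "i \<in> ?I" "j \<in> ?J" for i j
    using nn that by (simp add: Inner_in_cycle)
  have DJ0: "DJ \<ge> 0" unfolding DJ_def by (rule sum_nonneg) (rule nnJ)
  have DI0: "DI \<ge> 0" unfolding DI_def by (intro sum_nonneg nnI)
  have ws: "slack w > 0" using w by (simp add: slack_def)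
  have D: "DJ > 0 \<or> DI > 0"
    using w(1)
  proof (cases rule: cycle_vertex_cases)
    case (Joint i)
    then obtain h where "h \<in> ?I" "w = Joint (nxt g h)" using ex_nxt by blast
    then have "DJ > 0" unfolding DJ_def using ws by (intro sum_pos2[of _ h] nnJ) auto
    then show ?thesis ..
  next
    case (Inner i j)
    have "(\<Sum>j\<in>?J. slack (Inner i j)) > 0" using Inner ws by (intro sum_pos2[of ?J j] nnI) auto
    then have "DI > 0" unfolding DI_def
      by (intro sum_pos2[of ?I i, OF _ Inner(2)] sum_nonneg nnI) auto
    then show ?thesis ..
  qed
  have Y: "Y > 0" unfolding Y_def
    using pos g k by (intro sum_pos) (auto simp: Inner_in_cycle)
  have kX: "2 * (real k - 2) * X > 0" using k X by simp
  have "(\<rho> - real k + 3) * Y > 0" using DI DI0 kX by linarith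
  then have gap: "\<rho> - real k + 3 > 0" using Y by (simp add: zero_less_mult_iff)
  have "((\<rho> - 2) * (\<rho> - real k + 3) - 4 * (real k - 2)) * X
      = (\<rho> - real k + 3) * DJ + 2 * DI"
    unfolding DJ DI by (simp add: algebra_simps)
  also have "\<dots> > 0"
    using D DJ0 DI0 gap by (auto intro: add_pos_nonneg add_nonneg_pos)
  finally have "(\<rho> - 2) * (\<rho> - real k + 3) - 4 * (real k - 2) > 0"
    using X by (simp add: zero_less_mult_iff)
  then show ?thesis using k gap by unfold_locales linarith+
qed

section \<open>Attaching trees to the hypercycle\<close>

lemma rtree_hypergraph:
  assumes "rtree k u (verts T) (edges T)" and "k \<ge> 2"
  shows "hypergraph T" and "uniform k T" and "edge_connected (verts T) (edges T)"
  using rtree_basic[OF assms(1)] rtree_edge_connected[OF assms(1)] assms(2)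
  by (auto simp: hypergraph_def uniform_def)

lemma octopus_hypergraph:
  assumes k: "k \<ge> 3" and g: "g \<ge> 2" and w: "w \<in> verts (cycle_hg k g)"
    and T: "rtree k u (verts T) (edges T)"
  shows "hypergraph (attach (cycle_hg k g) w T u)"
    and "uniform k (attach (cycle_hg k g) w T u)"
    and "edge_connected (verts (attach (cycle_hg k g) w T u)) (edges (attach (cycle_hg k g) w T u))"
proof -
  have "k \<ge> 2" using k by simp
  note T' = rtree_hypergraph[OF T this] and C = hypergraph_cycle[OF k g]
  show "hypergraph (attach (cycle_hg k g) w T u)" by (rule hypergraph_attach[OF C(1) T'(1)])
  show "uniform k (attach (cycle_hg k g) w T u)" by (rule uniform_attach[OF C(2) T'(2)])
  show "edge_connected (verts (attach (cycle_hg k g) w T u)) (edges (attach (cycle_hg k g) w T u))"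
    using rtree_basic[OF T] T'(3) edge_connected_cycle[OF k g] w cycle_edge_sub
    by (intro edge_connected_attach) auto
qed

lemma nbr_sum_octopus:
  fixes w :: cycle_vertex and g :: nat
  assumes k: "k \<ge> 3" and T: "rtree k u (verts T) (edges T)"
  defines "E \<equiv> edges (attach (cycle_hg k g) w T u)"
  shows "c \<noteq> w \<Longrightarrow> nbr_sum E x (Inl c) = nbr_sum (edges (cycle_hg k g)) (x \<circ> Inl) c"
    and "t \<noteq> u \<Longrightarrow> nbr_sum E x (Inr t) = nbr_sum (edges T) (x \<circ> glue w u) t"
    and "nbr_sum E x (Inl w)
      = nbr_sum (edges (cycle_hg k g)) (x \<circ> Inl) w + nbr_sum (edges T) (x \<circ> glue w u) u"
  unfolding E_def
  using nbr_sum_attach[of "cycle_hg k g" T] rtree_basic[OF T] k by (auto simp: edges_cycle)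

lemma octopus_vertex_cases:
  assumes "v \<in> verts (attach H w T u)" and "w \<in> verts H"
  obtains (base) "v = Inl w"
  | (cycle) c where "v = Inl c" "c \<in> verts H" "c \<noteq> w"
  | (tree) t where "v = Inr t" "t \<in> verts T" "t \<noteq> u"
  using assms by (auto simp: verts_attach glue_def split: if_splits)

lemma in_octopus:
  "c \<in> verts H \<Longrightarrow> Inl c \<in> verts (attach H w T u)"
  "t \<in> verts T \<Longrightarrow> glue w u t \<in> verts (attach H w T u)"
  by (auto simp: verts_attach)

text \<open>The test vector for the lollipop \<open>L\<close> is the Perron vector of \<open>G\<close> on the cycle, continued by
  the solution on the path. Its neighbour sum differs from \<open>\<rho> y\<close> only at \<open>w\<close>, by the difference of
  the loads of the path and the tree.\<close>

lemma lollipop_minimal_at: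
  fixes T :: "'a pre_hypergraph"
  assumes k: "k \<ge> 3" and g: "g \<ge> 2" and w: "w \<in> verts (cycle_hg k g)"
    and T: "rtree k u (verts T) (edges T)" and s: "s = card (edges T)"
  defines "G \<equiv> attach (cycle_hg k g) w T u"
  defines "L \<equiv> attach (cycle_hg k g) w (path_hg k s) 0"
  shows "rho L \<le> rho G \<and> (rho L = rho G \<longleftrightarrow> isomorphic G L)"
proof -
  have k2: "k \<ge> 2" using k by simp
  note basic = rtree_basic[OF T] and G = octopus_hypergraph[OF k g w T, folded G_def]
  have P: "rpath k 0 (verts (path_hg k s)) (edges (path_hg k s)) (s * (k - 1))"
    by (rule path_hg_rpath[OF k2])
  have PT: "rtree k 0 (verts (path_hg k s)) (edges (path_hg k s))"
    by (rule conjunct1[OF rpath_rtree[OF P]])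
  note L = octopus_hypergraph[OF k g w PT, folded L_def]
  have iso: "isomorphic G L" if path: "rpath k u (verts T) (edges T) t" for t
  proof -
    obtain f where f: "inj_on f (verts T)" "f u = (0::nat)" "f ` verts T = verts (path_hg k s)"
      "(`) f ` edges T = edges (path_hg k s)"
      using rpath_isomorphism[OF path k2] unfolding s by blast
    show ?thesis unfolding G_def L_def
      by (rule attach_cong_isomorphic[where f = id and h = f]) (use f w basic cycle_edge_sub in auto)
  qed
  have "rho L \<le> rho G \<and> (rho L = rho G \<longrightarrow> isomorphic G L)"
  proof (cases "edges T = {}")
    case True
    then have "card (verts T) = 1" using rtree_card[OF T k2] by simp
    then have "verts T = {u}" using basic by (metis card_1_singletonE singletonD)
    then have "rpath k u (verts T) (edges T) u" using True rpath.root[of k u] by simp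
    then have "isomorphic G L" by (rule iso)
    then show ?thesis using isomorphic_rho[OF G(1) \<open>isomorphic G L\<close>] by simp
  next
    case False
    obtain x where x: "\<And>v. v \<in> verts G \<Longrightarrow> x v > 0"
      "\<And>v. v \<in> verts G \<Longrightarrow> nbr_sum (edges G) x v = (real k - 1) * rho G * x v"
      using perron_vector[OF G] by blast
    define \<rho> where "\<rho> = (real k - 1) * rho G"
    let ?C = "edges (cycle_hg k g)"
    define z q where "z = x \<circ> Inl" and "q = x \<circ> glue w u"
    have zq: "q u = z w" by (simp add: z_def q_def)
    have inG: "Inl c \<in> verts G" if "c \<in> verts (cycle_hg k g)" for c
    unfolding G_def by (rule in_octopus(1)[OF that])
  have zpos: "z c > 0" if "c \<in> verts (cycle_hg k g)" for c
      using x(1)[OF inG[OF that]] by (simp add: z_def)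
    have qpos: "q t > 0" if "t \<in> verts T" for t
      using x(1)[unfolded G_def, OF in_octopus(2)[OF that]] by (simp add: q_def)
    have cyc: "nbr_sum ?C z c = \<rho> * z c" if "c \<in> verts (cycle_hg k g)" "c \<noteq> w" for c
      using x(2)[OF inG[OF that(1)]] nbr_sum_octopus(1)[OF k T that(2)]
      by (simp add: z_def G_def \<rho>_def)
    have on_tree: "nbr_sum (edges T) q t = \<rho> * q t" if "t \<in> verts T - {u}" for t
      using x(2)[of "Inr t"] in_octopus(2)[of t T w u] nbr_sum_octopus(2)[OF k T, of t] that
      by (simp add: q_def G_def \<rho>_def glue_def)
    have at_root: "nbr_sum ?C z w + nbr_sum (edges T) q u = \<rho> * z w"
      using x(2)[OF inG[OF w]] nbr_sum_octopus(3)[OF k T]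
      by (simp add: z_def q_def G_def \<rho>_def)
    have "nbr_sum (edges T) q u > 0" by (rule nbr_sum_rtree_root_pos[OF T False k2 qpos])
    then have strict: "nbr_sum ?C z w < \<rho> * z w" using at_root by linarith
    have "path_recursion k \<rho>"
    proof (rule above_cycle_if_strict_supersolution[OF k g zpos _ w strict])
      show "nbr_sum ?C z v \<le> \<rho> * z v" if "v \<in> verts (cycle_hg k g)" for v
        using cyc[OF that] strict by (cases "v = w") auto
    qed
    then interpret path_recursion k \<rho> .
    have load: "load s * z w \<le> nbr_sum (edges T) q u \<and>
      (load s * z w = nbr_sum (edges T) q u \<longrightarrow> (\<exists>t. rpath k u (verts T) (edges T) t))"
      using rtree_load[OF T, of q "\<lambda>_. 0"] qpos on_tree by (auto simp: load_0 s zq)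
    obtain p where p: "\<And>v. v \<in> verts (path_hg k s) \<Longrightarrow> p v > 0" "p 0 = 1"
      "\<And>v. v \<in> verts (path_hg k s) - {0} \<Longrightarrow> nbr_sum (edges (path_hg k s)) p v = \<rho> * p v"
      "nbr_sum (edges (path_hg k s)) p 0 = load s"
      using rpath_solution[OF P, of 0]
      unfolding load_0 card_edges_path_hg[OF k2] mult_zero_left if_cancel add_0_right by blast
    define y where "y v = (case v of Inl c \<Rightarrow> z c | Inr t \<Rightarrow> z w * p t)" for v
    have yI: "y \<circ> Inl = z" by (auto simp: y_def)
    have yg: "y \<circ> glue w 0 = (\<lambda>t. z w * p t)" using p(2) by (auto simp: y_def glue_def)
    have ypos: "y v > 0" if "v \<in> verts L" for v
      using that[unfolded L_def] w
      by (cases rule: octopus_vertex_cases) (use zpos p(1) w in \<open>auto simp: y_def\<close>)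
    have y_base: "nbr_sum (edges L) y (Inl w) = nbr_sum ?C z w + z w * load s"
      unfolding L_def nbr_sum_octopus(3)[OF k PT] yI yg nbr_sum_scale p(4) ..
    have yle: "nbr_sum (edges L) y v \<le> (real k - 1) * rho G * y v" if "v \<in> verts L" for v
      using that[unfolded L_def] w
    proof (cases rule: octopus_vertex_cases)
      case base
      then show ?thesis using y_base load at_root
        by (simp add: y_def \<rho>_def algebra_simps)
    next
      case (cycle c)
      then show ?thesis
        using nbr_sum_octopus(1)[OF k PT cycle(3), where x = y and g = g] cyc[OF cycle(2,3)]
        by (simp add: L_def yI) (simp add: y_def \<rho>_def)
    next
      case (tree t)
      then show ?thesis
        using nbr_sum_octopus(2)[OF k PT tree(3), where x = y and g = g and w = w] p(3)[of t]
        by (simp add: L_def yg nbr_sum_scale) (simp add: y_def \<rho>_def)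
    qed
    note super = rho_le_if_supersolution[OF L k2 ypos yle]
    have "rho L < rho G" if "load s * z w \<noteq> nbr_sum (edges T) q u"
    proof (rule super(2))
      show "Inl w \<in> verts L" using in_octopus(1)[OF w] by (simp add: L_def)
      show "nbr_sum (edges L) y (Inl w) < (real k - 1) * rho G * y (Inl w)"
        using y_base load at_root that by (simp add: y_def \<rho>_def algebra_simps)
    qed
    then show ?thesis using super(1) load iso by force
  qed
  then show ?thesis using isomorphic_rho[OF G(1)] by force
qed

text \<open>Let \<open>x\<close> be the Perron vector with the tree at the inner vertex \<open>a\<close>, and let \<open>\<sigma>\<close> be the neighbour
  sum that the tree contributes at \<open>a\<close>. The vertex \<open>a\<close> exceeds the other inner vertices of its edge
  by \<open>\<mu> = \<sigma> / (\<rho> + 1)\<close>. Adding to \<open>x\<close> its rotation and moving this surplus from the two copies of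
  \<open>a\<close> to the joint \<open>v\<close> between their edges keeps the edge sums, so that the neighbour sums are right
  except at \<open>v\<close>, where \<open>(\<rho> + 2) \<mu>\<close> is missing. The tree at \<open>v\<close> contributes more than that,
  because the value at \<open>v\<close> is large enough compared with \<open>x a\<close>.\<close>

lemma rho_inner_less_joint:
  fixes T :: "'a pre_hypergraph"
  assumes k: "k \<ge> 3" and g: "g \<ge> 2"
    and T: "rtree k u (verts T) (edges T)" and "edges T \<noteq> {}"
  shows "rho (attach (cycle_hg k g) (Inner 1 1) T u) < rho (attach (cycle_hg k g) (Joint 1) T u)"
proof -
  have k2: "k \<ge> 2" using k by simp
  let ?C = "edges (cycle_hg k g)" and ?a = "Inner 1 1" and ?v = "Joint 1"
  let ?I = "{1..g}" and ?J = "{1..k - 2}"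
  define G L where "G = attach (cycle_hg k g) ?v T u" and "L = attach (cycle_hg k g) ?a T u"
  have v: "?v \<in> verts (cycle_hg k g)" and a: "?a \<in> verts (cycle_hg k g)"
    using k g by (auto simp: Joint_in_cycle Inner_in_cycle)
  note basic = rtree_basic[OF T]
    and G = octopus_hypergraph[OF k g v T, folded G_def]
    and L = octopus_hypergraph[OF k g a T, folded L_def]
  obtain x where x: "\<And>v. v \<in> verts L \<Longrightarrow> x v > 0"
    "\<And>v. v \<in> verts L \<Longrightarrow> nbr_sum (edges L) x v = (real k - 1) * rho L * x v"
    using perron_vector[OF L] by blast
  define \<rho> where "\<rho> = (real k - 1) * rho L"
  have \<rho>0: "\<rho> \<ge> 0" using adjacency_subeigenvector(2)[OF L(1)] k by (simp add: \<rho>_def)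
  define z q where "z = x \<circ> Inl" and "q = x \<circ> glue ?a u"
  have zq: "q u = z ?a" by (simp add: z_def q_def)
  have inL: "Inl c \<in> verts L" if "c \<in> verts (cycle_hg k g)" for c
    unfolding L_def by (rule in_octopus(1)[OF that])
  have zpos: "z c > 0" if "c \<in> verts (cycle_hg k g)" for c
    using x(1)[OF inL[OF that]] by (simp add: z_def)
  have qpos: "q t > 0" if "t \<in> verts T" for t
    using x(1)[unfolded L_def, OF in_octopus(2)[OF that]] by (simp add: q_def)
  have cyc: "nbr_sum ?C z c = \<rho> * z c" if "c \<in> verts (cycle_hg k g)" "c \<noteq> ?a" for c
    using x(2)[OF inL[OF that(1)]] nbr_sum_octopus(1)[OF k T that(2)]
    by (simp add: z_def L_def \<rho>_def)
  have on_tree: "nbr_sum (edges T) q t = \<rho> * q t" if "t \<in> verts T - {u}" for t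
    using x(2)[of "Inr t"] in_octopus(2)[of t T ?a u] nbr_sum_octopus(2)[OF k T, of t] that
    by (simp add: q_def L_def \<rho>_def glue_def)
  define \<sigma> where "\<sigma> = nbr_sum (edges T) q u"
  have at_root: "nbr_sum ?C z ?a + \<sigma> = \<rho> * z ?a"
    using x(2)[OF inL[OF a]] nbr_sum_octopus(3)[OF k T]
    by (simp add: z_def q_def L_def \<rho>_def \<sigma>_def)
  have \<sigma>: "\<sigma> > 0" unfolding \<sigma>_def by (rule nbr_sum_rtree_root_pos[OF T assms(4) k2 qpos])
  define S where "S i = sum z (cycle_edge k g i)" for i
  have Spos: "S i > 0" if "i \<in> ?I" for i unfolding S_def
    using that zpos cycle_edge_sub[of "cycle_edge k g i" k g]
    by (intro sum_pos) (auto simp: edges_cycle cycle_edge_nxt)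
  have zJ: "(\<rho> + 2) * z (Joint (nxt g i)) = S i + S (nxt g i)" if "i \<in> ?I" for i
    using cyc[of "Joint (nxt g i)"] nxt_in[OF that] nbr_sum_Joint[OF k g that, of z]
    by (simp add: Joint_in_cycle S_def algebra_simps)
  have zI: "(\<rho> + 1) * z (Inner i j) = S i + (if i = 1 \<and> j = 1 then \<sigma> else 0)"
    if "i \<in> ?I" "j \<in> ?J" for i j
    using cyc[of "Inner i j"] at_root nbr_sum_Inner[OF that, of z] that
    by (auto simp: Inner_in_cycle S_def algebra_simps)
  define \<mu> where "\<mu> = \<sigma> / (\<rho> + 1)"
  have \<mu>: "(\<rho> + 1) * \<mu> = \<sigma>" "\<mu> > 0" using \<rho>0 \<sigma> by (auto simp: \<mu>_def)
  define y0 where "y0 c = (case c of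
      Joint i \<Rightarrow> z (Joint i) + z (Joint (nxt g i)) + (if i = 1 then \<mu> else 0)
    | Inner i j \<Rightarrow> z (Inner i j) + z (Inner (nxt g i) j) - (if j = 1 \<and> (i = 1 \<or> i = g) then \<mu> else 0))"
    for c
  have sum_y0: "sum y0 (cycle_edge k g i) = S i + S (nxt g i)" if i: "i \<in> ?I" for i
  proof -
    have "(\<Sum>j\<in>?J. if j = 1 \<and> (i = 1 \<or> i = g) then \<mu> else 0) = (if i = 1 \<or> i = g then \<mu> else 0)"
      using k by (auto simp: sum.delta)
    then have "(\<Sum>j\<in>?J. y0 (Inner i j)) = (\<Sum>j\<in>?J. z (Inner i j)) + (\<Sum>j\<in>?J. z (Inner (nxt g i) j))
        - (if i = 1 \<or> i = g then \<mu> else 0)"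
      by (simp add: y0_def sum.distrib sum_subtractf)
    then show ?thesis
      using i g nxt_eq_1[OF i] by (simp add: S_def sum_cycle_edge[OF g] y0_def)
  qed
  have y0I: "(\<rho> + 1) * y0 (Inner i j) = S i + S (nxt g i)" if "i \<in> ?I" "j \<in> ?J" for i j
    using zI[OF that] zI[OF nxt_in[OF that(1)] that(2)] nxt_eq_1[OF that(1)] \<mu>(1) g
    by (auto simp: y0_def algebra_simps split: if_splits)
  have y0J: "(\<rho> + 2) * y0 (Joint (nxt g i))
      = S i + 2 * S (nxt g i) + S (nxt g (nxt g i)) + (if nxt g i = 1 then (\<rho> + 2) * \<mu> else 0)"
    if "i \<in> ?I" for i
    using zJ[OF that] zJ[OF nxt_in[OF that]] by (simp add: y0_def algebra_simps)
  have y0pos: "y0 c > 0" if "c \<in> verts (cycle_hg k g)" for c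
    using that
  proof (cases rule: cycle_vertex_cases)
    case (Joint i)
    have "z (Joint i) > 0" "z (Joint (nxt g i)) > 0"
      using zpos Joint nxt_in[of i g] by (auto simp: Joint_in_cycle)
    then have "z (Joint i) + z (Joint (nxt g i)) > 0" by simp
    then show ?thesis using Joint \<mu>(2) by (auto simp: y0_def intro: add_pos_pos)
  next
    case (Inner i j)
    have "(\<rho> + 1) * y0 c > 0"
      using y0I[OF Inner(2,3)] Inner Spos[of i] Spos[OF nxt_in[OF Inner(2)]] by simp
    then show ?thesis using \<rho>0 by (simp add: zero_less_mult_iff)
  qed
  have gI: "g \<in> ?I" and ng: "nxt g g = 1" using g by (auto simp: nxt_def)
  have y0_nbr: "nbr_sum ?C y0 c = \<rho> * y0 c" if "c \<in> verts (cycle_hg k g)" "c \<noteq> ?v" for c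
    using that(1)
  proof (cases rule: cycle_vertex_cases)
    case (Joint i)
    then obtain h where h: "h \<in> ?I" "i = nxt g h" using ex_nxt by blast
    then show ?thesis
      using Joint that nbr_sum_Joint[OF k g h(1), of y0] y0J[OF h(1)] sum_y0[OF h(1)]
        sum_y0[OF nxt_in[OF h(1)]] by (simp add: algebra_simps)
  next
    case (Inner i j)
    then show ?thesis using nbr_sum_Inner[OF Inner(2,3), of y0] y0I[OF Inner(2,3)] sum_y0[OF Inner(2)]
      by (simp add: algebra_simps)
  qed
  have y0_v: "nbr_sum ?C y0 ?v = \<rho> * y0 ?v - (\<rho> + 2) * \<mu>"
    using nbr_sum_Joint[OF k g gI, of y0] y0J[OF gI] sum_y0[OF gI] sum_y0[OF nxt_in[OF gI]]
    by (simp add: ng algebra_simps)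
  \<comment> \<open>by the equations at \<open>a\<close> and at the two joints of its edge, the difference of the two sides is
    at least \<open>S g + S (nxt g 1)\<close>\<close>
  have gain: "(\<rho> + 1) * y0 ?v > (\<rho> + 2) * z ?a"
  proof -
    have one: "1 \<in> ?I" "1 \<in> ?J" using g k by auto
    have zv: "(\<rho> + 2) * z ?v = S g + S 1" and zv': "(\<rho> + 2) * z (Joint (nxt g 1)) = S 1 + S (nxt g 1)"
      using zJ[OF gI] zJ[OF one(1)] by (simp_all add: ng)
    have za: "(\<rho> + 1) * z ?a = S 1 + \<sigma>" using zI[OF one] by simp
    have "z ?a \<le> (\<Sum>j\<in>?J. z (Inner 1 j))"
      using one zpos by (intro member_le_sum) (auto simp: Inner_in_cycle less_imp_le)
    then have "z ?v + z (Joint (nxt g 1)) + z ?a \<le> S 1"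
      by (simp add: S_def sum_cycle_edge[OF g])
    moreover have "S g > 0" "S (nxt g 1) > 0" using Spos gI nxt_in[OF one(1)] by auto
    moreover have "(\<rho> + 1) * y0 ?v = (\<rho> + 2) * z ?v + (\<rho> + 2) * z (Joint (nxt g 1))
        - z ?v - z (Joint (nxt g 1)) + \<sigma>"
      using \<mu>(1) by (simp add: y0_def algebra_simps)
    moreover have "(\<rho> + 2) * z ?a = S 1 + \<sigma> + z ?a" using za by (simp add: algebra_simps)
    ultimately show ?thesis using zv zv' by linarith
  qed
  define c where "c = y0 ?v / z ?a"
  have za: "z ?a > 0" by (rule zpos[OF a])
  have cpos: "c > 0" using y0pos[OF v] za by (simp add: c_def)
  have cu: "c * q u = y0 ?v" using za by (simp add: c_def zq)
  define y where "y v = (case v of Inl c' \<Rightarrow> y0 c' | Inr t \<Rightarrow> c * q t)" for v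
  have yI: "y \<circ> Inl = y0" by (auto simp: y_def)
  have yg: "y \<circ> glue ?v u = (\<lambda>t. c * q t)" using cu by (auto simp: y_def glue_def)
  have y_base: "nbr_sum (edges G) y (Inl ?v) = \<rho> * y0 ?v - (\<rho> + 2) * \<mu> + c * \<sigma>"
    unfolding G_def nbr_sum_octopus(3)[OF k T] yI yg nbr_sum_scale y0_v \<sigma>_def ..
  have "(\<rho> + 2) * \<mu> < c * \<sigma>"
  proof -
    have "(\<rho> + 2) * \<mu> * z ?a < y0 ?v * ((\<rho> + 1) * \<mu>)"
      using mult_strict_right_mono[OF gain \<mu>(2)] by (simp add: algebra_simps)
    then show ?thesis using za unfolding \<mu>(1) by (simp add: c_def field_simps)
  qed
  then have strict: "nbr_sum (edges G) y (Inl ?v) > (real k - 1) * rho L * y (Inl ?v)"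
    using y_base by (simp add: y_def \<rho>_def)
  have "rho G > rho L"
  proof (rule rho_greater_if_subsolution[OF G k2 _ _ _ strict])
    show "Inl ?v \<in> verts G" using in_octopus(1)[OF v] by (simp add: G_def)
    fix b assume b: "b \<in> verts G"
    show "y b > 0"
      using b[unfolded G_def] v
      by (cases rule: octopus_vertex_cases) (use y0pos qpos v cpos in \<open>auto simp: y_def\<close>)
    show "(real k - 1) * rho L * y b \<le> nbr_sum (edges G) y b"
      using b[unfolded G_def] v
    proof (cases rule: octopus_vertex_cases)
      case base
      then show ?thesis using strict by simp
    next
      case (cycle c')
      then show ?thesis
        using nbr_sum_octopus(1)[OF k T cycle(3), where x = y and g = g] y0_nbr[OF cycle(2,3)]
        by (simp add: G_def yI) (simp add: y_def \<rho>_def)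
    next
      case (tree t)
      have "nbr_sum (edges G) y b = c * nbr_sum (edges T) q t"
        unfolding tree(1) G_def nbr_sum_octopus(2)[OF k T tree(3)] yg nbr_sum_scale ..
      then show ?thesis using on_tree[of t] tree by (simp add: y_def \<rho>_def)
    qed
  qed
  then show ?thesis by (simp add: G_def L_def)
qed

section \<open>Positions of the supertree\<close>

lemma octopuslike_at_automorphism:
  fixes G :: "'a pre_hypergraph"
  assumes "octopuslike_at k g w G" and w: "w \<in> verts (cycle_hg k g)"
    and f: "inj_on f (verts (cycle_hg k g))" "f ` verts (cycle_hg k g) = verts (cycle_hg k g)"
      "(`) f ` edges (cycle_hg k g) = edges (cycle_hg k g)"
  shows "octopuslike_at k g (f w) G"
proof -
  obtain T :: "'a pre_hypergraph" and u where T: "supertree T" "uniform k T" "u \<in> verts T"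
    and iso: "isomorphic G (attach (cycle_hg k g) w T u)" and G: "hypergraph G"
    using assms(1) by (auto simp: octopuslike_at_def)
  have "isomorphic (attach (cycle_hg k g) w T u) (attach (cycle_hg k g) (f w) T u)"
    by (rule attach_cong_isomorphic[where f = f and h = id])
      (use f w T cycle_edge_sub in \<open>auto simp: supertree_def hypergraph_def\<close>)
  then show ?thesis
    using T G isomorphic_trans[OF iso] unfolding octopuslike_at_def by blast
qed

text \<open>The case distinction is the rotation of the cycle by one edge, an automorphism.\<close>

lemma octopuslike_at_nxt:
  assumes "w \<in> verts (cycle_hg k g)" and "octopuslike_at k g w G"
  shows "octopuslike_at k g (case w of Joint i \<Rightarrow> Joint (nxt g i) | Inner i j \<Rightarrow> Inner (nxt g i) j) G"
proof -
  let ?f = "\<lambda>w. case w of Joint i \<Rightarrow> Joint (nxt g i) | Inner i j \<Rightarrow> Inner (nxt g i) j"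
  have img: "nxt g ` {1..g} = {1..g}" using bij_nxt by (simp add: bij_betw_def)
  have inj: "inj_on ?f (verts (cycle_hg k g))"
    using inj_onD[OF inj_nxt[of g]] by (auto simp: cycle_hg_def inj_on_def)
  have "?f ` verts (cycle_hg k g) \<subseteq> verts (cycle_hg k g)"
  proof (rule image_subsetI)
    fix v assume "v \<in> verts (cycle_hg k g)"
    then show "?f v \<in> verts (cycle_hg k g)"
    proof (cases rule: cycle_vertex_cases)
      case (Joint i)
      then show ?thesis using nxt_in[of i g] by (simp add: Joint_in_cycle)
    next
      case (Inner i j)
      then show ?thesis using nxt_in[of i g] by (simp add: Inner_in_cycle)
    qed
  qed
  moreover have "finite (verts (cycle_hg k g))" by (simp add: cycle_hg_def)
  ultimately have onto: "?f ` verts (cycle_hg k g) = verts (cycle_hg k g)"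
    using inj by (intro endo_inj_surj)
  have "?f ` cycle_edge k g i = cycle_edge k g (nxt g i)" for i
    by (simp add: cycle_edge_nxt image_Un image_image)
  then have "(`) ?f ` edges (cycle_hg k g) = cycle_edge k g ` nxt g ` {1..g}"
    by (simp add: edges_cycle image_image)
  then have "(`) ?f ` edges (cycle_hg k g) = edges (cycle_hg k g)" by (simp only: img edges_cycle)
  then show ?thesis using octopuslike_at_automorphism[OF assms(2,1) inj onto] by simp
qed

lemma octopuslike_at_swap:
  assumes "i \<in> {1..g}" and "j \<in> {1..k - 2}" and "octopuslike_at k g (Inner i j) G"
  shows "octopuslike_at k g (Inner i 1) G"
proof -
  define t where "t m = (if m = 1 then j else if m = j then 1 else m)" for m
  let ?f = "\<lambda>w. case w of Joint i \<Rightarrow> Joint i | Inner i m \<Rightarrow> Inner i (t m)"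
  have tt: "t (t m) = m" for m by (auto simp: t_def)
  have tJ: "t ` {1..k - 2} = {1..k - 2}"
  proof
    show "t ` {1..k - 2} \<subseteq> {1..k - 2}" using assms(2) by (auto simp: t_def)
    show "{1..k - 2} \<subseteq> t ` {1..k - 2}"
    proof
      fix m assume "m \<in> {1..k - 2}"
      then have "t m \<in> {1..k - 2}" using assms(2) by (auto simp: t_def)
      then show "m \<in> t ` {1..k - 2}" using image_eqI[of m t "t m"] tt[of m] by simp
    qed
  qed
  have ff: "?f (?f w) = w" for w by (simp add: tt split: cycle_vertex.split)
  have inj: "inj_on ?f (verts (cycle_hg k g))" by (rule inj_on_inverseI[of _ ?f]) (rule ff)
  have "?f ` verts (cycle_hg k g) \<subseteq> verts (cycle_hg k g)"
  proof (rule image_subsetI)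
    fix v assume "v \<in> verts (cycle_hg k g)"
    then show "?f v \<in> verts (cycle_hg k g)"
      by (cases rule: cycle_vertex_cases) (use tJ in \<open>auto simp: Joint_in_cycle Inner_in_cycle\<close>)
  qed
  moreover have "finite (verts (cycle_hg k g))" by (simp add: cycle_hg_def)
  ultimately have onto: "?f ` verts (cycle_hg k g) = verts (cycle_hg k g)"
    using inj by (intro endo_inj_surj)
  have "?f ` cycle_edge k g h = cycle_edge k g h" for h
  proof -
    have "?f ` Inner h ` {1..k - 2} = Inner h ` t ` {1..k - 2}" by (simp add: image_image)
    then show ?thesis unfolding tJ by (simp add: cycle_edge_nxt image_Un)
  qed
  then have "(`) ?f ` edges (cycle_hg k g) = edges (cycle_hg k g)"
    by (simp add: edges_cycle image_image)
  from octopuslike_at_automorphism[OF assms(3) _ inj onto this]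
  show ?thesis using assms by (cases "j = 1") (simp_all add: Inner_in_cycle t_def)
qed

lemma octopuslike_at_standard:
  assumes "w \<in> verts (cycle_hg k g)" and "octopuslike_at k g w G"
  shows "octopuslike_at k g (Joint 1) G \<or> octopuslike_at k g (Inner 1 1) G"
  using assms(1)
proof (cases rule: cycle_vertex_cases)
  case (Joint i)
  have "octopuslike_at k g (Joint b) G" if "i \<le> b" "b \<le> g" for b
    using that
  proof (induction b rule: dec_induct)
    case base
    then show ?case using assms(2) Joint by simp
  next
    case (step b)
    then show ?case using octopuslike_at_nxt[of "Joint b" k g G] Joint
      by (simp add: Joint_in_cycle nxt_def)
  qed
  then have "octopuslike_at k g (Joint g) G" using Joint by simp
  then show ?thesis using octopuslike_at_nxt[of "Joint g" k g G] Joint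
    by (simp add: Joint_in_cycle nxt_def)
next
  case (Inner i j)
  have "octopuslike_at k g (Inner b j) G" if "i \<le> b" "b \<le> g" for b
    using that
  proof (induction b rule: dec_induct)
    case base
    then show ?case using assms(2) Inner by simp
  next
    case (step b)
    then show ?case using octopuslike_at_nxt[of "Inner b j" k g G] Inner
      by (simp add: Inner_in_cycle nxt_def)
  qed
  then have "octopuslike_at k g (Inner g j) G" using Inner by simp
  then have "octopuslike_at k g (Inner 1 j) G"
    using octopuslike_at_nxt[of "Inner g j" k g G] Inner by (simp add: Inner_in_cycle nxt_def)
  then show ?thesis using octopuslike_at_swap[of 1 g j k G] Inner by simp
qed

text \<open>Counting vertices shows that the tree has \<open>s\<close> edges.\<close>

lemma octopuslike_at_tree:
  fixes G :: "'a pre_hypergraph"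
  assumes k: "k \<ge> 3" and g: "g \<ge> 2" and w: "w \<in> verts (cycle_hg k g)"
    and G: "octopuslike_at k g w G"
    and s: "real s = real (order_hg G) / (real k - 1) - real g"
  obtains T :: "'a pre_hypergraph" and u where "rtree k u (verts T) (edges T)"
    and "supertree T" and "uniform k T" and "u \<in> verts T"
    and "card (edges T) = s" and "isomorphic G (attach (cycle_hg k g) w T u)"
proof -
  obtain T :: "'a pre_hypergraph" and u where T: "supertree T" "uniform k T" "u \<in> verts T"
    and iso: "isomorphic G (attach (cycle_hg k g) w T u)"
    using G by (auto simp: octopuslike_at_def)
  have k2: "k \<ge> 2" using k by simp
  have rt: "rtree k u (verts T) (edges T)" by (rule supertree_rtree[OF T k2])
  have "order_hg G + 1 = g * (k - 1) + (1 + (k - 1) * card (edges T))"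
    using order_attach[of "cycle_hg k g" T w u] hypergraph_cycle(1)[OF k g] w T rtree_basic[OF rt]
      isomorphic_order[OF iso] order_cycle[OF k, of g] rtree_card[OF rt k2]
    by (simp add: hypergraph_def)
  then have "order_hg G = (k - 1) * (g + card (edges T))" by (simp add: algebra_simps)
  then have "real (order_hg G) = (real k - 1) * (real g + real (card (edges T)))"
    using k by (simp add: of_nat_diff)
  then have "real s = real (card (edges T))" using s k by simp
  then show thesis using that[OF rt T _ iso] by simp
qed

lemma octopuslike_at_minimal:
  fixes G :: "'a pre_hypergraph"
  assumes k: "k \<ge> 3" and g: "g \<ge> 2" and w: "w \<in> verts (cycle_hg k g)"
    and G: "octopuslike_at k g w G"
    and s: "real s = real (order_hg G) / (real k - 1) - real g"
  defines "L \<equiv> attach (cycle_hg k g) w (path_hg k s) 0"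
  shows "rho L \<le> rho G \<and> (rho L = rho G \<longleftrightarrow> isomorphic G L)"
proof -
  obtain T :: "'a pre_hypergraph" and u where T: "rtree k u (verts T) (edges T)"
    "card (edges T) = s" and iso: "isomorphic G (attach (cycle_hg k g) w T u)"
    using octopuslike_at_tree[OF k g w G s] by blast
  have hG: "hypergraph G" using G by (simp add: octopuslike_at_def)
  then have sub: "\<And>e. e \<in> edges G \<Longrightarrow> e \<subseteq> verts G" by (simp add: hypergraph_def)
  have "isomorphic G L \<longleftrightarrow> isomorphic (attach (cycle_hg k g) w T u) L"
    by (rule iffI[OF isomorphic_trans[OF isomorphic_sym[OF iso sub]] isomorphic_trans[OF iso]])
  then show ?thesis
    using lollipop_minimal_at[OF k g w T(1) T(2)[symmetric]] isomorphic_rho[OF hG iso]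
    by (simp add: L_def)
qed

theorem theorem1p4:
  fixes k g n s :: nat
  assumes "k \<ge> 3" and "g \<ge> 2"
    and "real s = real n / (real k - 1) - real g"
  shows
    "(\<forall>G :: 'a pre_hypergraph. octopuslike k g G \<and> order_hg G = n \<longrightarrow>
        rho (Lop2 g k s) \<le> rho G \<and>
        (rho (Lop2 g k s) = rho G \<longleftrightarrow> isomorphic G (Lop2 g k s))) \<and>
     (\<forall>G :: 'a pre_hypergraph. octopuslike1 k g G \<and> order_hg G = n \<longrightarrow>
        rho (Lop1 g k s) \<le> rho G \<and>
        (rho (Lop1 g k s) = rho G \<longleftrightarrow> isomorphic G (Lop1 g k s))) \<and>
     (\<forall>G :: 'a pre_hypergraph. octopuslike2 k g G \<and> order_hg G = n \<longrightarrow>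
        rho (Lop2 g k s) \<le> rho G \<and>
        (rho (Lop2 g k s) = rho G \<longleftrightarrow> isomorphic G (Lop2 g k s)))"
proof -
  note k = assms(1) and g = assms(2) and s = assms(3)
  have J: "Joint 1 \<in> verts (cycle_hg k g)" and I: "Inner 1 1 \<in> verts (cycle_hg k g)"
    using k g by (auto simp: Joint_in_cycle Inner_in_cycle)
  have joint: "rho (Lop1 g k s) \<le> rho G \<and> (rho (Lop1 g k s) = rho G \<longleftrightarrow> isomorphic G (Lop1 g k s))"
    if "octopuslike_at k g (Joint 1) G" "order_hg G = n" for G :: "'a pre_hypergraph"
    unfolding Lop1_def by (rule octopuslike_at_minimal[OF k g J that(1)]) (simp add: s that(2))
  have inner: "rho (Lop2 g k s) \<le> rho G \<and> (rho (Lop2 g k s) = rho G \<longleftrightarrow> isomorphic G (Lop2 g k s))"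
    if "octopuslike_at k g (Inner 1 1) G" "order_hg G = n" for G :: "'a pre_hypergraph"
    unfolding Lop2_def by (rule octopuslike_at_minimal[OF k g I that(1)]) (simp add: s that(2))
  have any: "rho (Lop2 g k s) \<le> rho G \<and> (rho (Lop2 g k s) = rho G \<longleftrightarrow> isomorphic G (Lop2 g k s))"
    if G: "octopuslike_at k g (Joint 1) G" "order_hg G = n" for G :: "'a pre_hypergraph"
  proof -
    have hG: "hypergraph G" using G by (simp add: octopuslike_at_def)
    obtain T :: "'a pre_hypergraph" and u where T: "rtree k u (verts T) (edges T)"
      "supertree T" "uniform k T" "u \<in> verts T" "card (edges T) = s"
      and iso: "isomorphic G (attach (cycle_hg k g) (Joint 1) T u)"
      using octopuslike_at_tree[OF k g J G(1)] s G(2) by metis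
    show ?thesis
    proof (cases "edges T = {}")
      case True
      then have "card (verts T) = 1" using rtree_card[OF T(1)] k by simp
      then have "verts T = {u}" using T(4) by (metis card_1_singletonE singletonD)
      \<comment> \<open>a single vertex leaves no trace of where it is attached\<close>
      then have "attach (cycle_hg k g) (Joint 1) T u = attach (cycle_hg k g) (Inner 1 1) T u"
        using True I J by (auto simp: attach_def Let_def)
      then have "octopuslike_at k g (Inner 1 1) G"
        using T iso hG unfolding octopuslike_at_def by metis
      then show ?thesis using G(2) by (rule inner)
    next
      case False
      have "rho (Lop2 g k s) \<le> rho (attach (cycle_hg k g) (Inner 1 1) T u)"
        using lollipop_minimal_at[OF k g I T(1) T(5)[symmetric]] by (simp add: Lop2_def)
      also have "\<dots> < rho (attach (cycle_hg k g) (Joint 1) T u)"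
        by (rule rho_inner_less_joint[OF k g T(1) False])
      also have "\<dots> = rho G" using isomorphic_rho[OF hG iso] by simp
      finally show ?thesis using isomorphic_rho[OF hG, of "Lop2 g k s"] by auto
    qed
  qed
  have everywhere: "rho (Lop2 g k s) \<le> rho G \<and>
      (rho (Lop2 g k s) = rho G \<longleftrightarrow> isomorphic G (Lop2 g k s))"
    if G: "octopuslike k g G" "order_hg G = n" for G :: "'a pre_hypergraph"
  proof -
    from G(1) obtain w where w: "w \<in> verts (cycle_hg k g)" "octopuslike_at k g w G"
      unfolding octopuslike_def by (elim bexE)
    from octopuslike_at_standard[OF w] show ?thesis
    proof
      assume "octopuslike_at k g (Joint 1) G"
      then show ?thesis using G(2) by (rule any)
    next
      assume "octopuslike_at k g (Inner 1 1) G"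
      then show ?thesis using G(2) by (rule inner)
    qed
  qed
  show ?thesis
    unfolding octopuslike1_def octopuslike2_def
    by (intro conjI[of "All _"] allI impI; elim conjE) (rule everywhere joint inner; assumption)+
qed

end
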